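(* Suppose that $w$ is a cyclic, almost-alternating 3-braid word whose closure is a knot with determinant one. Then that knot is the unknot, and $w$ takes one of the following forms: (1) $\sigma_1^{-n_1-1\pm1}\sigma_2^{n_2}\cdots\sigma_1^{-n_{k-1}}\sigma_2^{n_k+1}\,\sigma_1\,\sigma_2\sigma_1^{-n_k}\sigma_2^{n_{k-1}}\cdots\sigma_1^{-n_2}\sigma_2^{n_1-1}$, with $k\ge2$ even and $n_1,\dots,n_k\ge1$ (every exponent not displayed being of the form $\pm n_i$); (2) $\sigma_1^{-n_1-1\pm1}\sigma_2^{n_2}\cdots\sigma_1^{-n_k}\sigma_2\,\sigma_1\,\sigma_2^{n_k+1}\cdots\sigma_1^{-n_2}\sigma_2^{n_1-1}$, with $k\ge3$ odd and $n_1,\dots,n_k\ge1$ (every exponent not displayed being of the form $\pm n_i$); (3) $\sigma_1^{-n-1\pm1}\sigma_2\sigma_1\sigma_2^n$, with $n\ge0$; (4) $\sigma_1^{-2}\sigma_1\sigma_2$, $\ \sigma_1\sigma_1^{-2}\sigma_2$, $\ \sigma_1^{-1}\sigma_1\sigma_1^{-1}\sigma_2$; (5) the result of swapping $\sigma_1^{-1}$ and $\sigma_2$ in one of these words; or (6) the inverse of one of these words (including those of case (5)).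
   Context: $\sigma_1,\sigma_2$ are the standard generators of the 3-strand braid group $B_3$. A cyclic word is a word considered up to cyclic permutation. An alternating 3-braid word is a word in the letters $\sigma_1^{-1}$ and $\sigma_2$, i.e. of the form $\sigma_1^{-a_1}\sigma_2^{b_1}\cdots\sigma_1^{-a_m}\sigma_2^{b_m}$ with $m\ge1$ and all $a_i,b_i\ge1$ (or, likewise, a word in $\sigma_1$ and $\sigma_2^{-1}$). A cyclic, almost-alternating 3-braid word is the result of changing one crossing in a cyclic, alternating 3-braid word, i.e. replacing a single letter by its inverse (words are not freely reduced). Swapping $\sigma_1^{-1}$ and $\sigma_2$ means the substitution $\sigma_1^{-1}\leftrightarrow\sigma_2$, $\sigma_1\leftrightarrow\sigma_2^{-1}$. In (1), the indices of the successive exponents increase $1,2,\dots,k$ up to the distinguished letter $\sigma_1$, with odd indices on powers of $\sigma_1$ and even indices on powers of $\sigma_2$, and after $\sigma_1\sigma_2$ they decrease $k,k-1,\dots,1$, with even indices on powers of $\sigma_1$ and odd indices on powers of $\sigma_2$. In (2), likewise the exponents before $\sigma_2\sigma_1$ are indexed $1,2,\dots,k$ with odd indices on powers of $\sigma_1$ and even on powers of $\sigma_2$, and the exponents after it are indexed $k,k-1,\dots,1$ with odd indices on powers of $\sigma_2$ and even on powers of $\sigma_1$. Powers of $\sigma_1$ (other than the distinguished letter) have non-positive exponents and powers of $\sigma_2$ non-negative exponents. *)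

theory Defs
  imports "HOL-Analysis.Analysis" "Jordan_Normal_Form.Determinant"
begin

section \<open>Words in the generators of the 3-strand braid group\<close>

datatype gen = \<sigma>\<^sub>1 | \<sigma>\<^sub>2

text \<open>The letter (g, True) is the generator g, and (g, False) is its inverse. Words are plain
  lists: nothing is freely reduced.\<close>

type_synonym letter = "gen \<times> bool"
type_synonym word = "letter list"

definition inv_letter :: "letter \<Rightarrow> letter" where
  "inv_letter x = (fst x, \<not> snd x)"

definition inv_word :: "word \<Rightarrow> word" where
  "inv_word w = rev (map inv_letter w)"

definition gpow :: "gen \<Rightarrow> int \<Rightarrow> word" where
  "gpow g e = replicate (nat \<bar>e\<bar>) (g, 0 < e)"

fun swap_letter :: "letter \<Rightarrow> letter" where
  "swap_letter (\<sigma>\<^sub>1, s) = (\<sigma>\<^sub>2, \<not> s)"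
| "swap_letter (\<sigma>\<^sub>2, s) = (\<sigma>\<^sub>1, \<not> s)"

definition swap_word :: "word \<Rightarrow> word" where
  "swap_word w = map swap_letter w"

text \<open>A cyclic word is represented by any of its linear representatives.\<close>

definition cyclic_eq :: "word \<Rightarrow> word \<Rightarrow> bool" where
  "cyclic_eq v w \<longleftrightarrow> (\<exists>k. w = rotate k v)"

definition alternating :: "word \<Rightarrow> bool" where
  "alternating w \<longleftrightarrow>
     (\<exists>(m::nat) (a :: nat \<Rightarrow> nat) (b :: nat \<Rightarrow> nat).
        m \<ge> 1 \<and> (\<forall>i\<in>{1..m}. a i \<ge> 1 \<and> b i \<ge> 1) \<and>
        (w = concat (map (\<lambda>i. gpow \<sigma>\<^sub>1 (- int (a i)) @ gpow \<sigma>\<^sub>2 (int (b i))) [1..<Suc m]) \<or>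
         w = concat (map (\<lambda>i. gpow \<sigma>\<^sub>1 (int (a i)) @ gpow \<sigma>\<^sub>2 (- int (b i))) [1..<Suc m])))"

definition cyclic_almost_alternating :: "word \<Rightarrow> bool" where
  "cyclic_almost_alternating w \<longleftrightarrow>
     (\<exists>u i. alternating u \<and> i < length u \<and> cyclic_eq (u[i := inv_letter (u ! i)]) w)"


section \<open>The words of the classification\<close>

text \<open>One indexed power on the way up to, respectively down from, the middle of the word.\<close>

definition up_power :: "(nat \<Rightarrow> nat) \<Rightarrow> nat \<Rightarrow> word" where
  "up_power n i = (if odd i then gpow \<sigma>\<^sub>1 (- int (n i)) else gpow \<sigma>\<^sub>2 (int (n i)))"

definition down_power :: "(nat \<Rightarrow> nat) \<Rightarrow> nat \<Rightarrow> word" where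
  "down_power n i = (if odd i then gpow \<sigma>\<^sub>2 (int (n i)) else gpow \<sigma>\<^sub>1 (- int (n i)))"

text \<open>The parameter e is the sign in the exponent \<open>- n\<^sub>1 - 1 \<plusminus> 1\<close>.\<close>

definition word1 :: "nat \<Rightarrow> (nat \<Rightarrow> nat) \<Rightarrow> int \<Rightarrow> word" where
  "word1 k n e =
     gpow \<sigma>\<^sub>1 (- int (n 1) - 1 + e) @ concat (map (up_power n) [2..<k]) @ gpow \<sigma>\<^sub>2 (int (n k) + 1)
     @ gpow \<sigma>\<^sub>1 1 @ gpow \<sigma>\<^sub>2 1
     @ gpow \<sigma>\<^sub>1 (- int (n k)) @ concat (map (down_power n) (rev [2..<k])) @ gpow \<sigma>\<^sub>2 (int (n 1) - 1)"

definition word2 :: "nat \<Rightarrow> (nat \<Rightarrow> nat) \<Rightarrow> int \<Rightarrow> word" where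
  "word2 k n e =
     gpow \<sigma>\<^sub>1 (- int (n 1) - 1 + e) @ concat (map (up_power n) [2..<k]) @ gpow \<sigma>\<^sub>1 (- int (n k))
     @ gpow \<sigma>\<^sub>2 1 @ gpow \<sigma>\<^sub>1 1
     @ gpow \<sigma>\<^sub>2 (int (n k) + 1) @ concat (map (down_power n) (rev [2..<k])) @ gpow \<sigma>\<^sub>2 (int (n 1) - 1)"

definition word3 :: "nat \<Rightarrow> int \<Rightarrow> word" where
  "word3 n e = gpow \<sigma>\<^sub>1 (- int n - 1 + e) @ gpow \<sigma>\<^sub>2 1 @ gpow \<sigma>\<^sub>1 1 @ gpow \<sigma>\<^sub>2 (int n)"

definition form1 :: "word \<Rightarrow> bool" where
  "form1 w \<longleftrightarrow> (\<exists>k n e. k \<ge> 2 \<and> even k \<and> (\<forall>i\<in>{1..k}. n i \<ge> 1) \<and> e \<in> {1, -1} \<and> w = word1 k n e)"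

definition form2 :: "word \<Rightarrow> bool" where
  "form2 w \<longleftrightarrow> (\<exists>k n e. k \<ge> 3 \<and> odd k \<and> (\<forall>i\<in>{1..k}. n i \<ge> 1) \<and> e \<in> {1, -1} \<and> w = word2 k n e)"

definition form3 :: "word \<Rightarrow> bool" where
  "form3 w \<longleftrightarrow> (\<exists>n e. e \<in> {1, -1} \<and> w = word3 n e)"

definition form4 :: "word \<Rightarrow> bool" where
  "form4 w \<longleftrightarrow>
     w = gpow \<sigma>\<^sub>1 (-2) @ gpow \<sigma>\<^sub>1 1 @ gpow \<sigma>\<^sub>2 1 \<or>
     w = gpow \<sigma>\<^sub>1 1 @ gpow \<sigma>\<^sub>1 (-2) @ gpow \<sigma>\<^sub>2 1 \<or>
     w = gpow \<sigma>\<^sub>1 (-1) @ gpow \<sigma>\<^sub>1 1 @ gpow \<sigma>\<^sub>1 (-1) @ gpow \<sigma>\<^sub>2 1"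

definition form1234 :: "word \<Rightarrow> bool" where
  "form1234 w \<longleftrightarrow> form1 w \<or> form2 w \<or> form3 w \<or> form4 w"

definition form5 :: "word \<Rightarrow> bool" where
  "form5 w \<longleftrightarrow> (\<exists>v. form1234 v \<and> w = swap_word v)"

definition form6 :: "word \<Rightarrow> bool" where
  "form6 w \<longleftrightarrow> (\<exists>v. (form1234 v \<or> form5 v) \<and> w = inv_word v)"


section \<open>Knots in 3-space\<close>

definition ambient_isotopic :: "'a::topological_space set \<Rightarrow> 'a set \<Rightarrow> bool" where
  "ambient_isotopic K L \<longleftrightarrow>
     (\<exists>H :: real \<Rightarrow> 'a \<Rightarrow> 'a.
        continuous_on ({0..1} \<times> UNIV) (\<lambda>(t, x). H t x) \<and>
        (\<forall>t\<in>{0..1}. \<exists>G. homeomorphism UNIV UNIV (H t) G) \<and>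
        (\<forall>x. H 0 x = x) \<and> H 1 ` K = L)"

text \<open>Euclidean 3-space is taken in the form \<open>\<complex> \<times> \<real>\<close>, so that closed braids wind around the axis
  \<open>{0} \<times> \<real>\<close> and project to diagrams in \<open>\<complex>\<close>, seen from the positive end of the axis. Tameness is not
  part of \<open>is_knot\<close>: it is applied only to closed braids, which are piecewise smooth.\<close>

type_synonym space3 = "complex \<times> real"

definition is_knot :: "space3 set \<Rightarrow> bool" where
  "is_knot K \<longleftrightarrow> K homeomorphic sphere (0::complex) 1"

definition is_unknot :: "space3 set \<Rightarrow> bool" where
  "is_unknot K \<longleftrightarrow> ambient_isotopic K {(z, h). norm z = 1 \<and> h = 0}"


section \<open>The closure of a 3-braid word\<close>

fun gen_index :: "gen \<Rightarrow> nat" where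
  "gen_index \<sigma>\<^sub>1 = 1"
| "gen_index \<sigma>\<^sub>2 = 2"

text \<open>Position and height, at time t in [0,1], of the strand that starts at position p in
  {1,2,3} in the elementary braid of a letter. The generator \<open>\<sigma>\<^sub>i\<close> exchanges positions i and i + 1,
  with the strand going from i to i + 1 on top.\<close>

definition strand :: "letter \<Rightarrow> nat \<Rightarrow> real \<Rightarrow> real \<times> real" where
  "strand x p t =
     (let i = gen_index (fst x); h = (if snd x then 1 else -1) * t * (1 - t)
      in if p = i then (real i + t, h)
         else if p = i + 1 then (real i + 1 - t, - h)
         else (real p, 0))"

text \<open>The j-th letter occupies the j-th of length w equal angular sectors, and the position becomes
  the distance from the axis. Only meant for nonempty words.\<close>

definition braid_closure :: "word \<Rightarrow> space3 set" where
  "braid_closure w =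
     {(of_real (fst (strand (w ! j) p t)) * cis (2 * pi * (real j + t) / real (length w)),
       snd (strand (w ! j) p t)) | j p t. j < length w \<and> p \<in> {1, 2, 3} \<and> t \<in> {0..1}}"


section \<open>The determinant\<close>

text \<open>The determinant is computed from the diagram obtained by projecting \<open>braid_closure w\<close> to \<open>\<complex>\<close>.
  The pair (j, p) stands for the edge of this diagram that enters the j-th sector at position p.
  At the j-th crossing the overstrand goes from position \<open>over_in\<close> to position \<open>over_out\<close>, and the
  understrand the other way.\<close>

definition over_in :: "letter \<Rightarrow> nat" where
  "over_in x = (if snd x then gen_index (fst x) else gen_index (fst x) + 1)"

definition over_out :: "letter \<Rightarrow> nat" where
  "over_out x = (if snd x then gen_index (fst x) + 1 else gen_index (fst x))"

abbreviation under_in :: "letter \<Rightarrow> nat" where "under_in \<equiv> over_out"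
abbreviation under_out :: "letter \<Rightarrow> nat" where "under_out \<equiv> over_in"

definition next_level :: "word \<Rightarrow> nat \<Rightarrow> nat" where
  "next_level w j = Suc j mod length w"

text \<open>Continuation of an edge through a sector in which it is not the understrand.\<close>

definition overpass :: "word \<Rightarrow> ((nat \<times> nat) \<times> (nat \<times> nat)) set" where
  "overpass w =
     {((j, over_in (w ! j)), (next_level w j, over_out (w ! j))) | j. j < length w} \<union>
     {((j, p), (next_level w j, p)) | j p.
        j < length w \<and> p \<in> {1, 2, 3} \<and> p \<notin> {over_in (w ! j), over_out (w ! j)}}"

text \<open>The a-th arc of the diagram is the one that leaves the a-th crossing as its understrand. In a
  knot diagram with at least one crossing, every arc arises in this way from exactly one a.\<close>

definition diagram_arc :: "word \<Rightarrow> nat \<Rightarrow> (nat \<times> nat) set" where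
  "diagram_arc w a = (overpass w)\<^sup>* `` {(next_level w a, under_out (w ! a))}"

text \<open>The Fox colouring matrix: the row of a crossing says that twice the overarc equals the sum of
  the two underarcs.\<close>

definition colouring_matrix :: "word \<Rightarrow> int mat" where
  "colouring_matrix w =
     mat (length w) (length w) (\<lambda>(c, a).
       2 * of_bool ((c, over_in (w ! c)) \<in> diagram_arc w a)
       - of_bool ((c, under_in (w ! c)) \<in> diagram_arc w a)
       - of_bool ((next_level w c, under_out (w ! c)) \<in> diagram_arc w a))"

text \<open>The determinant of a knot is the absolute value of any first minor of the colouring matrix of
  any of its diagrams. The definition below is only meant for words whose closure is a knot.\<close>

definition closure_determinant :: "word \<Rightarrow> int" where
  "closure_determinant w = \<bar>Determinant.det (mat_delete (colouring_matrix w) 0 0)\<bar>"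

end

theory Submission
  imports Defs
begin

text \<open>Inversion, the swap of \<open>\<sigma>\<^sub>1\<inverse>\<close> with \<open>\<sigma>\<^sub>2\<close> and rotation bring every cyclic almost alternating word into
  the shape \<open>\<sigma>\<^sub>1 V\<close>, where V is a word in \<open>a = \<sigma>\<^sub>1\<inverse>\<close> and \<open>b = \<sigma>\<^sub>2\<close> that contains b
  (\<open>almost_alternating_normal_form\<close>). The determinant enters through the Burau matrix at -1: a vector
  that it fixes modulo a prime m, unless it is 0 modulo m, gives a non-constant Fox colouring modulo m of the closed braid, which is
  impossible when a first minor of the colouring matrix is a unit. Since the matrix has determinant 1,
  such vectors exist for every prime divisor m of 2 minus its trace, so that the trace is 1 or 3
  (\<open>trace_of_determinant_one\<close>).

  The Burau matrices of words in a and b have entries of fixed signs which grow with every letter.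
  If V starts or ends with a, this letter cancels against \<open>\<sigma>\<^sub>1\<close>, and few words remain. Otherwise
  V = b U b up to the trivial case V = b, the word is conjugate to the product of U with the half twist
  \<open>\<Delta> = \<sigma>\<^sub>2 \<sigma>\<^sub>1 \<sigma>\<^sub>2\<close>, and its trace is the difference of the two off-diagonal entries of the matrix of U.
  This difference does not change when U loses a first letter and a last letter that are swapped
  with one another. Hence U consists of a centre a or aaa between a word Y and its mirror image under
  reversal and swap (\<open>almost_symmetric_words\<close>), and the run lengths of Y are the exponents of the
  classification.

  The same symmetry gives the unknot. The relations \<open>b \<Delta> a = \<Delta>\<close> and \<open>a \<Delta> b = \<Delta>\<close> of the braid group let
  \<open>\<Delta>\<close> absorb Y and its mirror image letter by letter, up to conjugation, and \<open>\<Delta> a\<close> and \<open>\<Delta> a a a\<close> are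
  conjugate to \<open>\<sigma>\<^sub>1 \<sigma>\<^sub>2\<close> and \<open>\<sigma>\<^sub>1\<inverse> \<sigma>\<^sub>2\<close> (\<open>unknot_word_classified\<close>).

  What is left is topology. The half planes bounded by the axis of a closed braid are the pages of an
  open book, and a closed braid is the trace of a path in the space of configurations of three points
  of a page. A homotopy of such paths, cut into small steps, is realised by ambient isotopies that
  move the points within their pages (\<open>path_closure_homotopy\<close>). This makes the closure an
  invariant of braid words up to equivalence and conjugation. The closure of \<open>\<sigma>\<^sub>1 \<sigma>\<^sub>2\<close>, with arbitrary
  signs, is isotopic to a curve given by trigonometric functions whose height has a single maximum and
  a single minimum, and such a curve can be straightened level by level to a round circle
  (\<open>is_unknot_trig_knot\<close>).\<close>

section \<open>The reduced Burau representation at -1\<close>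

type_synonym mat2 = "int \<times> int \<times> int \<times> int"

fun mat2_mult :: "mat2 \<Rightarrow> mat2 \<Rightarrow> mat2" where
  "mat2_mult (p, q, r, s) (p', q', r', s') =
     (p * p' + q * r', p * q' + q * s', r * p' + s * r', r * q' + s * s')"

fun trace2 :: "mat2 \<Rightarrow> int" where
  "trace2 (p, q, r, s) = p + s"

fun burau_letter :: "letter \<Rightarrow> mat2" where
  "burau_letter (\<sigma>\<^sub>1, e) = (1, 0, if e then 1 else -1, 1)"
| "burau_letter (\<sigma>\<^sub>2, e) = (1, if e then -1 else 1, 0, 1)"

text \<open>The matrix by which a word acts on the two differences of Fox colours at neighbouring positions, read
  from the first letter on. This is the reduced Burau representation at -1.\<close>

fun burau :: "word \<Rightarrow> mat2" where
  "burau [] = (1, 0, 0, 1)"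
| "burau (x # w) = mat2_mult (burau w) (burau_letter x)"

lemma mat2_mult_assoc: "mat2_mult (mat2_mult a b) c = mat2_mult a (mat2_mult b c)"
  by (cases a; cases b; cases c) (simp add: algebra_simps)

lemma mat2_mult_one [simp]: "mat2_mult a (1, 0, 0, 1) = a" "mat2_mult (1, 0, 0, 1) a = a"
  by (cases a; simp)+

lemma burau_append: "burau (u @ v) = mat2_mult (burau v) (burau u)"
  by (induction u) (simp_all add: mat2_mult_assoc)

lemma trace2_mult_commute: "trace2 (mat2_mult a b) = trace2 (mat2_mult b a)"
  by (cases a; cases b) (simp add: algebra_simps)

lemma trace_burau_rotate: "trace2 (burau (rotate k w)) = trace2 (burau w)"
proof -
  have "trace2 (burau (rotate k w)) = trace2 (burau (take (k mod length w) w @ drop (k mod length w) w))"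
    by (simp only: rotate_drop_take burau_append trace2_mult_commute)
  then show ?thesis by simp
qed

fun det2 :: "mat2 \<Rightarrow> int" where
  "det2 (p, q, r, s) = p * s - q * r"

lemma det2_burau: "det2 (burau w) = 1"
proof (induction w)
  case (Cons x w)
  obtain p q r s where m: "burau w = (p, q, r, s)" by (cases "burau w")
  show ?case using Cons m
    by (cases x rule: burau_letter.cases) (auto simp: algebra_simps)
qed simp

text \<open>Conjugation by the exchange of the two coordinates, which is the effect of swapping \<open>\<sigma>\<^sub>1\<inverse>\<close>
  with \<open>\<sigma>\<^sub>2\<close>.\<close>

fun flip2 :: "mat2 \<Rightarrow> mat2" where
  "flip2 (p, q, r, s) = (s, r, q, p)"

lemma burau_swap_word: "burau (swap_word w) = flip2 (burau w)"
proof (induction w)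
  case (Cons x w)
  obtain p q r s where m: "burau w = (p, q, r, s)" by (cases "burau w")
  show ?case using Cons m
    by (cases x rule: burau_letter.cases) (auto simp: swap_word_def algebra_simps)
qed (simp add: swap_word_def)

lemma trace_burau_swap_word: "trace2 (burau (swap_word w)) = trace2 (burau w)"
  by (cases "burau w") (simp add: burau_swap_word)

fun adj2 :: "mat2 \<Rightarrow> mat2" where
  "adj2 (p, q, r, s) = (s, - q, - r, p)"

lemma adj2_mult: "adj2 (mat2_mult a b) = mat2_mult (adj2 b) (adj2 a)"
  by (cases a; cases b) (simp add: algebra_simps)

lemma burau_inv_word: "burau (inv_word w) = adj2 (burau w)"
proof (induction w)
  case (Cons x w)
  have "burau [inv_letter x] = adj2 (burau_letter x)"
    by (cases x rule: burau_letter.cases) (auto simp: inv_letter_def)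
  then show ?case using Cons
    by (simp add: inv_word_def burau_append adj2_mult)
qed (simp add: inv_word_def)

lemma trace_burau_inv_word: "trace2 (burau (inv_word w)) = trace2 (burau w)"
  by (cases "burau w") (simp add: burau_inv_word)

section \<open>Alternating words whose trace is one or three\<close>

abbreviation letter_a :: letter where "letter_a \<equiv> (\<sigma>\<^sub>1, False)"
abbreviation letter_b :: letter where "letter_b \<equiv> (\<sigma>\<^sub>2, True)"

text \<open>Up to signs, a further letter adds one column of the matrix to the other. So the entries keep
  their signs, and the total of their moduli grows by at least one with every letter.\<close>

lemma burau_alternating_entries:
  assumes "set V \<subseteq> {letter_a, letter_b}"
  obtains p q r s where "burau V = (p, - q, - r, s)" "p \<ge> 1" "s \<ge> 1" "q \<ge> 0" "r \<ge> 0"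
    "p * s = 1 + q * r" "p + q + r + s \<ge> int (length V) + 2"
proof -
  have "\<exists>p q r s. burau V = (p, - q, - r, s) \<and> p \<ge> 1 \<and> s \<ge> 1 \<and> q \<ge> 0 \<and> r \<ge> 0 \<and>
    p + q + r + s \<ge> int (length V) + 2"
    using assms
  proof (induction V)
    case (Cons x V)
    then obtain p q r s where *: "burau V = (p, - q, - r, s)" "p \<ge> 1" "s \<ge> 1" "q \<ge> 0" "r \<ge> 0"
      "p + q + r + s \<ge> int (length V) + 2" by auto
    from Cons.prems consider "x = letter_a" | "x = letter_b" by auto
    then show ?case
    proof cases
      case 1
      show ?thesis using *
        by (intro exI[of _ "p + q"] exI[of _ q] exI[of _ "r + s"] exI[of _ s]) (auto simp: 1)
    next
      case 2
      show ?thesis using *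
        by (intro exI[of _ "p"] exI[of _ "p + q"] exI[of _ "r"] exI[of _ "r + s"]) (auto simp: 2)
    qed
  qed auto
  then obtain p q r s where *: "burau V = (p, - q, - r, s)" "p \<ge> 1" "s \<ge> 1" "q \<ge> 0" "r \<ge> 0"
      "p + q + r + s \<ge> int (length V) + 2" by auto
  moreover have "p * s = 1 + q * r" using det2_burau[of V] *(1) by simp
  ultimately show thesis using that by blast
qed

text \<open>Both diagonal entries are positive, so that the trace is 3 and the off-diagonal entries are -1. The
  entries bound the length of the word, and only finitely many words have to be examined.\<close>

lemma trace_three_words:
  assumes "set V \<subseteq> {letter_a, letter_b}" "letter_b \<in> set V" "trace2 (burau V) \<in> {1, 3}"
  shows "V = [letter_a, letter_b] \<or> V = [letter_b, letter_a]"
proof -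
  obtain p q r s where *: "burau V = (p, - q, - r, s)" "p \<ge> 1" "s \<ge> 1" "q \<ge> 0" "r \<ge> 0"
    "p * s = 1 + q * r" "p + q + r + s \<ge> int (length V) + 2"
    using burau_alternating_entries[OF assms(1)] by metis
  from assms(3) *(1-3) have ps: "p + s = 3" by auto
  then have "p = 1 \<and> s = 2 \<or> p = 2 \<and> s = 1" using *(2,3) by auto
  then have qr: "q * r = 1" using *(6) by auto
  then have "q = 1 \<and> r = 1" using *(4,5) by (simp add: zmult_eq_1_iff)
  then have "length V \<le> 3" using *(7) ps by auto
  then consider "V = []" | x where "V = [x]" | x y where "V = [x,y]" | x y z where "V = [x,y,z]"
    by (auto simp: le_Suc_eq length_Suc_conv numeral_3_eq_3)
  then show ?thesis using assms by cases auto
qed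

text \<open>The mirror image under which the half twist passes from one side of a word to the other.\<close>

definition dual_word :: "word \<Rightarrow> word" where
  "dual_word Y = rev (swap_word Y)"

text \<open>Strip the outer letters of V. If they are swapped with one another, then the difference of the
  off-diagonal entries stays the same, and induction applies to the inner word. Two outer letters b
  make the difference negative, and two outer letters a make it so large that V = aaa.\<close>

lemma almost_symmetric_words:
  assumes "set V \<subseteq> {letter_a, letter_b}" "burau V = (p, q, r, s)" "q - r \<in> {1, 3}"
  shows "\<exists>Y \<epsilon>. set Y \<subseteq> {letter_a, letter_b} \<and> \<epsilon> \<in> {1, 3} \<and>
     V = Y @ replicate \<epsilon> letter_a @ dual_word Y"
  using assms
proof (induction "length V" arbitrary: V p q r s rule: less_induct)
  case less
  consider "V = []" | x where "V = [x]" | x U y where "V = x # U @ [y]"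
    by (metis append_Cons append_Nil neq_Nil_conv rev_exhaust)
  then show ?case
  proof cases
    case 1
    then show ?thesis using less by auto
  next
    case (2 x)
    then show ?thesis using less
      by (intro exI[of _ "[]"] exI[of _ 1]) (auto simp: dual_word_def swap_word_def)
  next
    case (3 x U y)
    have U: "set U \<subseteq> {letter_a, letter_b}" and xy: "x \<in> {letter_a, letter_b}" "y \<in> {letter_a, letter_b}"
      using less.prems(1) 3 by auto
    obtain p' q' r' s' where *: "burau U = (p', - q', - r', s')" "p' \<ge> 1" "s' \<ge> 1" "q' \<ge> 0" "r' \<ge> 0"
      "p' * s' = 1 + q' * r'" "p' + q' + r' + s' \<ge> int (length U) + 2"
      using burau_alternating_entries[OF U] by metis
    have dual: ?thesis if "y = swap_letter x" "r' - q' \<in> {1, 3}"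
    proof -
      have "\<exists>Y \<epsilon>. set Y \<subseteq> {letter_a, letter_b} \<and> \<epsilon> \<in> {1, 3} \<and>
          U = Y @ replicate \<epsilon> letter_a @ dual_word Y"
        by (rule less.hyps[OF _ U *(1)]) (use 3 that(2) in auto)
      then obtain Y \<epsilon> where "set Y \<subseteq> {letter_a, letter_b}" "\<epsilon> \<in> {1, 3}"
          "U = Y @ replicate \<epsilon> letter_a @ dual_word Y" by blast
      then show ?thesis using 3 that(1) xy
        by (intro exI[of _ "x # Y"] exI[of _ \<epsilon>]) (auto simp: dual_word_def swap_word_def)
    qed
    consider "x = letter_a" "y = letter_b" | "x = letter_b" "y = letter_a"
      | "x = letter_a" "y = letter_a" | "x = letter_b" "y = letter_b" using xy by auto
    then show ?thesis
    proof cases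
      case 1
      with less.prems 3 * have "r' - q' \<in> {1, 3}" by (auto simp: burau_append)
      with dual 1 show ?thesis by auto
    next
      case 2
      with less.prems 3 * have "r' - q' \<in> {1, 3}" by (auto simp: burau_append)
      with dual 2 show ?thesis by auto
    next
      case aa: 3
      with less.prems 3 * have "p' + r' + s' \<in> {1, 3}" by (auto simp: burau_append)
      then have "p' + r' + s' = 3" using * by auto
      moreover have "p' + s' \<noteq> 3"
      proof
        assume "p' + s' = 3"
        with \<open>p' + r' + s' = 3\<close> have "r' = 0" by auto
        moreover have "p' = 1 \<and> s' = 2 \<or> p' = 2 \<and> s' = 1" using \<open>p' + s' = 3\<close> *(2,3) by auto
        ultimately show False using *(6) by auto
      qed
      ultimately have "p' = 1" "s' = 1" "r' = 1" using *(2-5) by auto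
      then have "q' = 0" using *(6) by auto
      then have "length U \<le> 1" using *(7) \<open>p' = 1\<close> \<open>s' = 1\<close> \<open>r' = 1\<close> by auto
      moreover have "U \<noteq> []" using *(1) \<open>r' = 1\<close> by auto
      ultimately obtain z where z: "U = [z]" by (cases U) auto
      then have "z = letter_a" using U *(1) \<open>r' = 1\<close> by auto
      then have "V = replicate 3 letter_a" using 3 aa z by (simp add: numeral_3_eq_3)
      then show ?thesis
        by (intro exI[of _ "[]"] exI[of _ 3]) (auto simp: dual_word_def swap_word_def)
    next
      case 4
      with less.prems 3 * have "- (p' + q' + s') \<in> {1, 3}" by (auto simp: burau_append)
      then show ?thesis using * by auto
    qed
  qed
qed

text \<open>A letter a at either end of W cancels against \<open>\<sigma>\<^sub>1\<close> and leaves a word in a and b of trace 1 or 3. If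
  W starts and ends with b, then these two letters and \<open>\<sigma>\<^sub>1\<close> form a half twist in the cyclic word. Its
  matrix (0, -1, 1, 0) turns the trace into a difference of off-diagonal entries.\<close>

lemma trace_classification:
  assumes "set W \<subseteq> {letter_a, letter_b}" "letter_b \<in> set W"
    and "trace2 (burau ((\<sigma>\<^sub>1, True) # W)) \<in> {1, 3}"
  shows "W \<in> {[letter_b], [letter_a, letter_a, letter_b], [letter_a, letter_b, letter_a],
      [letter_b, letter_a, letter_a]} \<or>
    (\<exists>Y \<epsilon>. set Y \<subseteq> {letter_a, letter_b} \<and> \<epsilon> \<in> {1, 3} \<and>
     W = letter_b # Y @ replicate \<epsilon> letter_a @ dual_word Y @ [letter_b])"
proof -
  consider (a_first) W' where "W = letter_a # W'" | (a_last) W' where "W = W' @ [letter_a]"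
    | (b) "W = [letter_b]" | (bb) V where "W = letter_b # V @ [letter_b]"
  proof (cases W rule: rev_cases)
    case Nil
    then show thesis using assms by auto
  next
    case (snoc W' y)
    then have y: "y = letter_a \<or> y = letter_b" using assms(1) by auto
    show thesis
    proof (cases W')
      case Nil
      then show thesis using y snoc that by auto
    next
      case (Cons x V)
      then have "x = letter_a \<or> x = letter_b" using assms(1) snoc by auto
      then show thesis using y snoc Cons that by auto
    qed
  qed
  then show ?thesis
  proof cases
    case a_first
    then have "burau ((\<sigma>\<^sub>1, True) # W) = burau W'"
      by (cases "burau W'") auto
    then have "W' = [letter_a, letter_b] \<or> W' = [letter_b, letter_a]"
      using trace_three_words[of W'] assms a_first by auto
    then show ?thesis using a_first by auto
  next
    case a_last
    then have "trace2 (burau ((\<sigma>\<^sub>1, True) # W)) = trace2 (burau W')"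
      by (cases "burau W'") (auto simp: burau_append)
    then have "W' = [letter_a, letter_b] \<or> W' = [letter_b, letter_a]"
      using trace_three_words[of W'] assms a_last by auto
    then show ?thesis using a_last by auto
  next
    case b
    then show ?thesis by simp
  next
    case (bb V)
    obtain p q r s where m: "burau V = (p, q, r, s)" by (cases "burau V")
    have "trace2 (burau ((\<sigma>\<^sub>1, True) # W)) = q - r"
      using bb m by (simp add: burau_append)
    then show ?thesis
      using almost_symmetric_words[OF _ m] assms bb by force
  qed
qed

section \<open>Run-length encoding\<close>

definition up_runs :: "(nat \<Rightarrow> nat) \<Rightarrow> nat \<Rightarrow> word" where
  "up_runs n k = concat (map (up_power n) [2..<Suc k])"

definition down_runs :: "(nat \<Rightarrow> nat) \<Rightarrow> nat \<Rightarrow> word" where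
  "down_runs n k = concat (map (down_power n) (rev [2..<Suc k]))"

lemma runs_Suc:
  assumes "k \<ge> 1"
  shows "up_runs n (Suc k) = up_runs n k @ up_power n (Suc k)"
    and "down_runs n (Suc k) = down_power n (Suc k) @ down_runs n k"
  using assms by (auto simp: up_runs_def down_runs_def)

lemma runs_cong:
  assumes "\<And>i. i \<in> {2..k} \<Longrightarrow> n i = n' i"
  shows "up_runs n k = up_runs n' k" "down_runs n k = down_runs n' k"
  using assms by (auto simp: up_runs_def down_runs_def up_power_def down_power_def
      intro!: arg_cong[where f = concat] simp del: upt_Suc)

lemma gpow_neg: "gpow \<sigma>\<^sub>1 (- int m) = replicate m letter_a"
  by (cases "m = 0") (simp_all add: gpow_def)

lemma gpow_pos: "gpow \<sigma>\<^sub>2 (int m) = replicate m letter_b"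
  by (cases "m = 0") (simp_all add: gpow_def)

lemma power_one_more:
  "n' i = Suc (n i) \<Longrightarrow> up_power n' i = up_power n i @ [if odd i then letter_a else letter_b]"
  "n' i = Suc (n i) \<Longrightarrow> down_power n' i = (if odd i then letter_b else letter_a) # down_power n i"
  by (simp_all add: up_power_def down_power_def gpow_neg gpow_pos replicate_append_same
      del: of_nat_Suc)

text \<open>The decreasing runs of the classification are a reading of Y from its first letter and the increasing
  runs are the reading of its dual. The exponent of index 1 is special, as it is shared with the
  centre of the word: it may be 0 in Y, which is why it is shifted by one. In the induction a new
  first letter of Y either lengthens the run of highest index or opens the next one.\<close>

lemma run_length_encoding:
  assumes "set Y \<subseteq> {letter_a, letter_b}"
  shows "\<exists>k n. k \<ge> 1 \<and> (\<forall>i\<in>{1..k}. n i \<ge> 1) \<and>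
     Y = down_runs n k @ replicate (n 1 - 1) letter_b \<and>
     dual_word Y = replicate (n 1 - 1) letter_a @ up_runs n k"
  using assms
proof (induction Y)
  case Nil
  show ?case
    by (intro exI[of _ 1] exI[of _ "\<lambda>_. 1"])
      (auto simp: dual_word_def swap_word_def up_runs_def down_runs_def)
next
  case (Cons x Y)
  then obtain k n where k: "k \<ge> 1" and n: "\<forall>i\<in>{1..k}. n i \<ge> (1::nat)"
    and Y: "Y = down_runs n k @ replicate (n 1 - 1) letter_b"
    and dY: "dual_word Y = replicate (n 1 - 1) letter_a @ up_runs n k"
    by auto
  have dual_Cons: "dual_word (x # Y) = dual_word Y @ [swap_letter x]"
    by (simp add: dual_word_def swap_word_def)
  have x: "x = letter_a \<or> x = letter_b" using Cons.prems by auto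
  consider (base) "x = letter_b" "k = 1"
    | (same) l where "x = (if odd k then letter_b else letter_a)" "k = Suc l" "l \<ge> 1"
    | (new) "x = (if odd k then letter_a else letter_b)"
  proof -
    assume *: "x = letter_b \<Longrightarrow> k = 1 \<Longrightarrow> thesis"
      "\<And>l. x = (if odd k then letter_b else letter_a) \<Longrightarrow> k = Suc l \<Longrightarrow> 1 \<le> l \<Longrightarrow> thesis"
      "x = (if odd k then letter_a else letter_b) \<Longrightarrow> thesis"
    obtain l where l: "k = Suc l" using k by (cases k) auto
    show thesis
    proof (cases "x = (if odd k then letter_a else letter_b)")
      case False
      then have "x = (if odd k then letter_b else letter_a)" using x by presburger
      then show thesis using *(1) *(2)[of l] l by (cases "l = 0") auto
    qed (rule *(3))
  qed
  then show ?case
  proof cases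
    case base
    have runs1: "up_runs m 1 = []" "down_runs m 1 = []" for m
      by (simp_all add: up_runs_def down_runs_def)
    have "n 1 \<ge> 1" using n base by auto
    then obtain c where c: "n 1 = Suc c" by (cases "n 1") auto
    have "x # Y = replicate (Suc c) letter_b"
      using Y base c runs1 by simp
    moreover have "dual_word (x # Y) = replicate (Suc c) letter_a"
      using dY base c runs1 dual_Cons by (simp add: replicate_append_same)
    ultimately show ?thesis
      using runs1 by (intro exI[of _ 1] exI[of _ "\<lambda>_. Suc (Suc c)"]) simp
  next
    case (same l)
    define n' where "n' = n(k := Suc (n k))"
    have "up_runs n' k = up_runs n k @ [swap_letter x]"
      using same runs_Suc(1)[of l] runs_cong(1)[of l n n'] power_one_more(1)[of n' k n]
      by (auto simp: n'_def)
    moreover have "down_runs n' k = x # down_runs n k"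
      using same runs_Suc(2)[of l] runs_cong(2)[of l n n'] power_one_more(2)[of n' k n]
      by (auto simp: n'_def)
    moreover have "n' 1 = n 1" using same by (simp add: n'_def)
    moreover have "\<forall>i\<in>{1..k}. n' i \<ge> 1" using n by (auto simp: n'_def)
    ultimately show ?thesis
      using k Y dY dual_Cons by (intro exI[of _ k] exI[of _ n']) simp
  next
    case new
    define n' where "n' = n(Suc k := 1)"
    have "up_power n' (Suc k) = [swap_letter x]" "down_power n' (Suc k) = [x]"
      using new by (auto simp: n'_def up_power_def down_power_def gpow_def)
    then have "up_runs n' (Suc k) = up_runs n k @ [swap_letter x]" "down_runs n' (Suc k) = x # down_runs n k"
      using k runs_Suc[of k n'] runs_cong[of k n n'] by (auto simp: n'_def)
    moreover have "n' 1 = n 1" using k by (simp add: n'_def)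
    moreover have "\<forall>i\<in>{1..Suc k}. n' i \<ge> 1" using n by (auto simp: n'_def)
    ultimately show ?thesis
      using k Y dY dual_Cons by (intro exI[of _ "Suc k"] exI[of _ n']) simp
  qed
qed

lemma cyclic_eq_append: "cyclic_eq (u @ v) (v @ u)"
  unfolding cyclic_eq_def by (rule exI[of _ "length u"]) (simp add: rotate_append)

text \<open>The rotation that starts at the centre \<open>a\<^sup>\<epsilon>\<close> displays the exponents in the order of the
  classification. The centre and the first run of the dual of Y merge into the exponent
  \<open>- n\<^sub>1 - 1 \<plusminus> 1\<close>, whose sign is \<open>2 - \<epsilon>\<close>. Of the two letters b around \<open>\<sigma>\<^sub>1\<close>, one merges into the
  neighbouring run of index k and the other one is displayed; the parity of k decides which is which.\<close>

lemma palindromic_words_are_forms: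
  assumes "set Y \<subseteq> {letter_a, letter_b}" "\<epsilon> \<in> {1, 3}"
  shows "\<exists>v. cyclic_eq ((\<sigma>\<^sub>1, True) # letter_b # Y @ replicate \<epsilon> letter_a @ dual_word Y @ [letter_b]) v \<and>
     (form1 v \<or> form2 v \<or> form3 v)"
proof -
  obtain k n where k: "k \<ge> 1" and n: "\<forall>i\<in>{1..k}. n i \<ge> 1"
    and Y: "Y = down_runs n k @ replicate (n 1 - 1) letter_b"
    and dY: "dual_word Y = replicate (n 1 - 1) letter_a @ up_runs n k"
    using run_length_encoding[OF assms(1)] by blast
  have "n 1 \<ge> 1" using n k by auto
  then obtain c where c: "n 1 = Suc c" by (cases "n 1") auto
  define e where "e = 2 - int \<epsilon>"
  have e: "e \<in> {1, -1}" using assms(2) by (auto simp: e_def)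
  have centre: "gpow \<sigma>\<^sub>1 (- int (n 1) - 1 + e) = replicate \<epsilon> letter_a @ replicate c letter_a"
  proof -
    have "- int (n 1) - 1 + e = - int (\<epsilon> + c)" unfolding e_def c by simp
    then show ?thesis by (simp only: gpow_neg replicate_add)
  qed
  have last: "gpow \<sigma>\<^sub>2 (int (n 1) - 1) = replicate c letter_b"
    using gpow_pos[of c] c by simp
  let ?W = "((\<sigma>\<^sub>1, True) # letter_b # down_runs n k @ replicate c letter_b) @
     (replicate \<epsilon> letter_a @ replicate c letter_a @ up_runs n k @ [letter_b])"
  let ?v = "(replicate \<epsilon> letter_a @ replicate c letter_a @ up_runs n k @ [letter_b]) @
     ((\<sigma>\<^sub>1, True) # letter_b # down_runs n k @ replicate c letter_b)"
  have rot: "cyclic_eq ?W ?v" by (rule cyclic_eq_append)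
  have W: "(\<sigma>\<^sub>1, True) # letter_b # Y @ replicate \<epsilon> letter_a @ dual_word Y @ [letter_b] = ?W"
    using Y dY c by simp
  have gens: "gpow \<sigma>\<^sub>1 1 = [(\<sigma>\<^sub>1, True)]" "gpow \<sigma>\<^sub>2 1 = [letter_b]"
    by (simp_all add: gpow_def)
  have "form1 ?v \<or> form2 ?v \<or> form3 ?v"
  proof (cases "k = 1")
    case True
    have "gpow \<sigma>\<^sub>1 (- int (Suc c) - 1 + e) = replicate \<epsilon> letter_a @ replicate c letter_a"
      using centre c by simp
    then have "?v = word3 (Suc c) e"
      using True gpow_pos[of "Suc c"] by (simp add: word3_def up_runs_def down_runs_def gens)
    then show ?thesis unfolding form3_def using e by blast
  next
    case False
    then obtain l where l: "k = Suc l" "l \<ge> 1" using k by (cases k) auto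
    have up: "up_runs n k = concat (map (up_power n) [2..<k]) @ up_power n k"
      and down: "down_runs n k = down_power n k @ concat (map (down_power n) (rev [2..<k]))"
      using runs_Suc[of l n] l by (simp_all add: up_runs_def down_runs_def)
    have more: "gpow \<sigma>\<^sub>2 (int (n k) + 1) = replicate (n k) letter_b @ [letter_b]"
      "gpow \<sigma>\<^sub>2 (int (n k) + 1) = letter_b # replicate (n k) letter_b"
      using gpow_pos[of "Suc (n k)"] by (simp_all add: replicate_append_same add.commute)
    show ?thesis
    proof (cases "even k")
      case True
      then have "?v = word1 k n e"
        by (simp add: word1_def up down centre[simplified] last[simplified] gens up_power_def[of n k] down_power_def[of n k]
           more(1) gpow_pos gpow_neg)
      moreover have "k \<ge> 2" using l by simp
      ultimately show ?thesis unfolding form1_def using True n e by blast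
    next
      case odd: False
      then have "?v = word2 k n e"
        by (simp add: word2_def up down centre[simplified] last[simplified] gens up_power_def[of n k] down_power_def[of n k]
           more(2) gpow_pos gpow_neg)
      moreover have "k \<ge> 3" using l False odd by (cases "k = 2") auto
      ultimately show ?thesis unfolding form2_def using odd n e by blast
    qed
  qed
  with W rot show ?thesis by metis
qed

lemma word_forms:
  assumes "set W \<subseteq> {letter_a, letter_b}" "letter_b \<in> set W"
    and "trace2 (burau ((\<sigma>\<^sub>1, True) # W)) \<in> {1, 3}"
  shows "\<exists>v. cyclic_eq ((\<sigma>\<^sub>1, True) # W) v \<and> form1234 v"
proof -
  have short: "form1234 v" if "v \<in> {[letter_a, letter_a, (\<sigma>\<^sub>1, True), letter_b],
      [(\<sigma>\<^sub>1, True), letter_a, letter_a, letter_b], [letter_a, (\<sigma>\<^sub>1, True), letter_a, letter_b],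
      [letter_b, (\<sigma>\<^sub>1, True)]}" for v
  proof -
    have "[letter_b, (\<sigma>\<^sub>1, True)] = word3 0 1"
      by (simp add: word3_def gpow_def)
    then show ?thesis using that
      by (auto simp: form1234_def form4_def gpow_def numeral_2_eq_2 form3_def)
  qed
  have cyc: "cyclic_eq ((\<sigma>\<^sub>1, True) # W) (v @ u)" if "(\<sigma>\<^sub>1, True) # W = u @ v" for u v
    using cyclic_eq_append[of u v] that by simp
  from trace_classification[OF assms] consider
    "W = [letter_b]" | "W = [letter_a, letter_a, letter_b]" | "W = [letter_a, letter_b, letter_a]"
    | "W = [letter_b, letter_a, letter_a]"
    | Y \<epsilon> where "set Y \<subseteq> {letter_a, letter_b}" "\<epsilon> \<in> {1, 3}"
     "W = letter_b # Y @ replicate \<epsilon> letter_a @ dual_word Y @ [letter_b]"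
    by blast
  then show ?thesis
  proof cases
    case 1
    with cyc[of "[(\<sigma>\<^sub>1, True)]" "[letter_b]"] short show ?thesis by fastforce
  next
    case 2
    with cyc[of "[]"] short show ?thesis by fastforce
  next
    case 3
    with cyc[of "[(\<sigma>\<^sub>1, True), letter_a, letter_b]" "[letter_a]"] short show ?thesis by fastforce
  next
    case 4
    with cyc[of "[(\<sigma>\<^sub>1, True), letter_b]" "[letter_a, letter_a]"] short show ?thesis by fastforce
  next
    case 5
    with palindromic_words_are_forms[of Y \<epsilon>] show ?thesis by (auto simp: form1234_def)
  qed
qed

section \<open>Normal forms of almost alternating words\<close>

lemma cyclic_eq_refl: "cyclic_eq w w"
  unfolding cyclic_eq_def by (rule exI[of _ 0]) simp

lemma cyclic_eq_trans: "cyclic_eq u v \<Longrightarrow> cyclic_eq v w \<Longrightarrow> cyclic_eq u w"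
  unfolding cyclic_eq_def by (metis rotate_rotate)

lemma cyclic_eq_iff_append: "cyclic_eq v w \<longleftrightarrow> (\<exists>x y. v = x @ y \<and> w = y @ x)"
proof
  assume "cyclic_eq v w"
  then obtain k where "w = rotate k v" by (auto simp: cyclic_eq_def)
  then show "\<exists>x y. v = x @ y \<and> w = y @ x"
    by (intro exI[of _ "take (k mod length v) v"] exI[of _ "drop (k mod length v) v"])
      (simp add: rotate_drop_take)
qed (auto intro: cyclic_eq_append)

lemma cyclic_eq_sym: "cyclic_eq v w \<Longrightarrow> cyclic_eq w v"
  unfolding cyclic_eq_iff_append by blast

lemma inv_letter_involution [simp]: "inv_letter (inv_letter x) = x"
  by (simp add: inv_letter_def)

lemma swap_letter_involution [simp]: "swap_letter (swap_letter x) = x"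
  by (cases x rule: swap_letter.cases) auto

lemma inv_word_involution [simp]: "inv_word (inv_word w) = w"
  by (simp add: inv_word_def rev_map comp_def)

lemma inv_word_append: "inv_word (u @ v) = inv_word v @ inv_word u"
  by (simp add: inv_word_def)

lemma swap_word_append: "swap_word (u @ v) = swap_word u @ swap_word v"
  by (simp add: swap_word_def)

lemma set_swap_word: "x \<in> set w \<Longrightarrow> swap_letter x \<in> set (swap_word w)"
  by (simp add: swap_word_def)

lemma set_swap_word_subset:
  assumes "set W \<subseteq> {letter_a, letter_b}"
  shows "set (swap_word W) \<subseteq> {letter_a, letter_b}"
proof
  fix y assume "y \<in> set (swap_word W)"
  then obtain x where "x \<in> set W" "y = swap_letter x" by (auto simp: swap_word_def)
  moreover from this assms have "x = letter_a \<or> x = letter_b" by blast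
  ultimately show "y \<in> {letter_a, letter_b}" by fastforce
qed

lemma set_inv_word_subset:
  assumes "set W \<subseteq> {inv_letter letter_a, inv_letter letter_b}"
  shows "set (inv_word W) \<subseteq> {letter_a, letter_b}"
proof
  fix y assume "y \<in> set (inv_word W)"
  then obtain x where "x \<in> set W" "y = inv_letter x" by (auto simp: inv_word_def)
  moreover from this assms have "x = inv_letter letter_a \<or> x = inv_letter letter_b" by blast
  ultimately show "y \<in> {letter_a, letter_b}" by fastforce
qed

lemma set_inv_word: "x \<in> set w \<Longrightarrow> inv_letter x \<in> set (inv_word w)"
  by (simp add: inv_word_def)

lemma cyclic_eq_inv_word: "cyclic_eq v w \<Longrightarrow> cyclic_eq (inv_word v) (inv_word w)"
  unfolding cyclic_eq_iff_append by (metis inv_word_append)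

lemma cyclic_eq_swap_word: "cyclic_eq v w \<Longrightarrow> cyclic_eq (swap_word v) (swap_word w)"
  unfolding cyclic_eq_iff_append by (metis swap_word_append)

lemma set_alternating:
  assumes "alternating u"
  shows "set u = {letter_a, letter_b} \<or> set u = {inv_letter letter_a, inv_letter letter_b}"
proof -
  from assms obtain m a b where *: "m \<ge> 1 \<and> (\<forall>i\<in>{1..m}. a i \<ge> 1 \<and> b i \<ge> 1) \<and>
     (u = concat (map (\<lambda>i. gpow \<sigma>\<^sub>1 (- int (a i)) @ gpow \<sigma>\<^sub>2 (int (b i))) [1..<Suc m]) \<or>
      u = concat (map (\<lambda>i. gpow \<sigma>\<^sub>1 (int (a i)) @ gpow \<sigma>\<^sub>2 (- int (b i))) [1..<Suc m]))"
    unfolding alternating_def by (elim exE)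
  then have m: "m \<ge> 1" and ab: "\<And>i. i \<in> {1..m} \<Longrightarrow> a i \<ge> 1 \<and> b i \<ge> 1"
    and u: "u = concat (map (\<lambda>i. gpow \<sigma>\<^sub>1 (- int (a i)) @ gpow \<sigma>\<^sub>2 (int (b i))) [1..<Suc m]) \<or>
      u = concat (map (\<lambda>i. gpow \<sigma>\<^sub>1 (int (a i)) @ gpow \<sigma>\<^sub>2 (- int (b i))) [1..<Suc m])"
    by auto
  have nonzero: "a i \<noteq> 0" "b i \<noteq> 0" if "i \<in> {1..m}" for i using ab[OF that] by auto
  have 1: "set (gpow \<sigma>\<^sub>1 (- int (a i)) @ gpow \<sigma>\<^sub>2 (int (b i))) = {letter_a, letter_b}"
    and 2: "set (gpow \<sigma>\<^sub>1 (int (a i)) @ gpow \<sigma>\<^sub>2 (- int (b i))) = {inv_letter letter_a, inv_letter letter_b}"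
    if "i \<in> {1..m}" for i
    using nonzero[OF that] by (auto simp: gpow_def inv_letter_def)
  have "{1..<Suc m} = {1..m}" "{1..m} \<noteq> {}" using m by auto
  with u 1 2 show ?thesis
    by (auto simp del: set_append upt_Suc)
qed

text \<open>The changed letter is rotated to the front. The four alternatives correspond to the two kinds of
  alternating words and to the two generators to which the changed letter can belong.\<close>

lemma almost_alternating_normal_form:
  assumes "cyclic_almost_alternating w"
  obtains W X where "set W \<subseteq> {letter_a, letter_b}" "letter_b \<in> set W"
    and "X = (\<sigma>\<^sub>1, True) # W"
    and "cyclic_eq w X \<or> cyclic_eq w (swap_word X) \<or> cyclic_eq w (inv_word X) \<or>
      cyclic_eq w (inv_word (swap_word X))"
proof -
  note result = that
  obtain u i where u: "alternating u" "i < length u"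
    and w: "cyclic_eq (u[i := inv_letter (u ! i)]) w"
    using assms unfolding cyclic_almost_alternating_def by blast
  define x where "x = u ! i"
  define U where "U = drop (Suc i) u @ take i u"
  have "u[i := inv_letter x] = take i u @ (inv_letter x # drop (Suc i) u)"
    using u(2) by (simp add: upd_conv_take_nth_drop)
  moreover have "cyclic_eq (take i u @ (inv_letter x # drop (Suc i) u)) (inv_letter x # U)"
    using cyclic_eq_append[of "take i u" "inv_letter x # drop (Suc i) u"] by (simp add: U_def)
  ultimately have w_U: "cyclic_eq w (inv_letter x # U)"
    using w cyclic_eq_sym cyclic_eq_trans x_def by metis
  have "u = take i u @ x # drop (Suc i) u" using u(2) by (simp add: x_def id_take_nth_drop)
  then have "set u = set (take i u @ x # drop (Suc i) u)" by simp
  then have set_u: "set u = insert x (set U)" by (auto simp: U_def)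
  have mapped: thesis if "set W \<subseteq> {letter_a, letter_b}" "letter_b \<in> set W" "X = (\<sigma>\<^sub>1, True) # W"
    "cyclic_eq (inv_letter x # U) Z" "Z = X \<or> Z = swap_word X \<or> Z = inv_word X \<or> Z = inv_word (swap_word X)"
    for W X Z
    by (rule result[OF that(1-3)]) (use that(4,5) cyclic_eq_trans[OF w_U] in blast)
  have inv_turn: "cyclic_eq (inv_letter x # U) (inv_word (x # inv_word U))"
    using cyclic_eq_append[of "[inv_letter x]" U] by (simp add: inv_word_def rev_map comp_def)
  from set_alternating[OF u(1)] show thesis
  proof
    assume set: "set u = {letter_a, letter_b}"
    then have "x = letter_a \<or> x = letter_b" using set_u by auto
    then show thesis
    proof
      assume x: "x = letter_a"
      have "letter_b \<in> set U" "set U \<subseteq> {letter_a, letter_b}" using x set set_u by auto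
      moreover have "cyclic_eq (inv_letter x # U) ((\<sigma>\<^sub>1, True) # U)"
        using x by (simp add: inv_letter_def cyclic_eq_refl)
      ultimately show thesis using mapped by blast
    next
      assume x: "x = letter_b"
      have "letter_a \<in> set U" "set U \<subseteq> {letter_a, letter_b}" using set set_u x by auto
      then have "letter_b \<in> set (swap_word U)" "set (swap_word U) \<subseteq> {letter_a, letter_b}"
        using set_swap_word[of letter_a U] set_swap_word_subset by simp_all
      moreover have "cyclic_eq (inv_letter x # U) (swap_word ((\<sigma>\<^sub>1, True) # swap_word U))"
        using x by (simp add: inv_letter_def swap_word_def comp_def cyclic_eq_refl)
      ultimately show thesis using mapped by blast
    qed
  next
    assume set: "set u = {inv_letter letter_a, inv_letter letter_b}"
    have U: "set (inv_word U) \<subseteq> {letter_a, letter_b}"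
      using set set_u by (intro set_inv_word_subset) auto
    from set set_u have "x = inv_letter letter_a \<or> x = inv_letter letter_b" by auto
    then show thesis
    proof
      assume x: "x = inv_letter letter_a"
      have "inv_letter letter_b \<in> set U" using set set_u x by (auto simp: inv_letter_def)
      then have "letter_b \<in> set (inv_word U)"
        using set_inv_word[of "inv_letter letter_b" U] by simp
      moreover have "cyclic_eq (inv_letter x # U) (inv_word ((\<sigma>\<^sub>1, True) # inv_word U))"
        using inv_turn x by (simp add: inv_letter_def)
      ultimately show thesis using U mapped by blast
    next
      assume x: "x = inv_letter letter_b"
      have "inv_letter letter_a \<in> set U" using set set_u x by (auto simp: inv_letter_def)
      then have "letter_a \<in> set (inv_word U)"
        using set_inv_word[of "inv_letter letter_a" U] by simp
      then have "letter_b \<in> set (swap_word (inv_word U))"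
        using set_swap_word[of letter_a "inv_word U"] by simp
      moreover have "set (swap_word (inv_word U)) \<subseteq> {letter_a, letter_b}"
        using U by (rule set_swap_word_subset)
      moreover have "x # inv_word U = swap_word ((\<sigma>\<^sub>1, True) # swap_word (inv_word U))"
        using x by (simp add: inv_letter_def swap_word_def comp_def)
      then have "cyclic_eq (inv_letter x # U) (inv_word (swap_word ((\<sigma>\<^sub>1, True) # swap_word (inv_word U))))"
        using inv_turn by simp
      ultimately show thesis using mapped by blast
    qed
  qed
qed

lemma trace_cyclic_eq: "cyclic_eq v w \<Longrightarrow> trace2 (burau w) = trace2 (burau v)"
  by (auto simp: cyclic_eq_def trace_burau_rotate)

lemma almost_alternating_forms:
  assumes "cyclic_almost_alternating w" "trace2 (burau w) \<in> {1, 3}"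
  shows "\<exists>v. cyclic_eq w v \<and>
      (form1 v \<or> form2 v \<or> form3 v \<or> form4 v \<or> form5 v \<or> form6 v)"
proof -
  obtain W X where W: "set W \<subseteq> {letter_a, letter_b}" "letter_b \<in> set W"
    and X: "X = (\<sigma>\<^sub>1, True) # W"
    and w: "cyclic_eq w X \<or> cyclic_eq w (swap_word X) \<or> cyclic_eq w (inv_word X) \<or>
      cyclic_eq w (inv_word (swap_word X))"
    using almost_alternating_normal_form[OF assms(1)] .
  have "trace2 (burau w) = trace2 (burau X)"
    using w trace_cyclic_eq[of w] trace_burau_swap_word trace_burau_inv_word by metis
  with assms(2) have "trace2 (burau X) \<in> {1, 3}" by simp
  with word_forms[OF W] X obtain v where v: "cyclic_eq X v" "form1234 v" by blast
  have forms: "form5 (swap_word v)" "form6 (inv_word v)" "form6 (inv_word (swap_word v))"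
    using v(2) by (auto simp: form5_def form6_def)
  from w consider "cyclic_eq w v" | "cyclic_eq w (swap_word v)" | "cyclic_eq w (inv_word v)"
    | "cyclic_eq w (inv_word (swap_word v))"
    using v(1) cyclic_eq_trans cyclic_eq_swap_word cyclic_eq_inv_word by metis
  then show ?thesis
  proof cases
    case 1
    then show ?thesis using v(2) unfolding form1234_def by blast
  qed (use forms in blast)+
qed

section \<open>Ambient isotopies\<close>

text \<open>From here on the dollar sign is reserved for the components of the vectors of type
  \<open>complex ^ 3\<close> that serve as configurations of three points.\<close>

no_notation vec_index (infixl "$" 100)

lemma ambient_isotopic_refl: "ambient_isotopic K K"
  unfolding ambient_isotopic_def
proof (intro exI[of _ "\<lambda>t x. x"] conjI ballI)
  show "continuous_on ({0..1} \<times> UNIV) (\<lambda>(t::real, x). x)"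
    by (simp add: case_prod_unfold continuous_intros)
  show "\<exists>G. homeomorphism UNIV UNIV (\<lambda>x. x) G"
    by (intro exI[of _ "\<lambda>x. x"] homeomorphism_ident)
qed auto

lemma ambient_isotopic_trans [trans]:
  assumes "ambient_isotopic K L" "ambient_isotopic L M"
  shows "ambient_isotopic K M"
proof -
  obtain A where A: "continuous_on ({0..1} \<times> UNIV) (\<lambda>(t, x). A t x)"
    "\<And>t. t \<in> {0..1::real} \<Longrightarrow> \<exists>G. homeomorphism UNIV UNIV (A t) G" "\<And>x. A 0 x = x" "A 1 ` K = L"
    using assms(1) unfolding ambient_isotopic_def by metis
  obtain B where B: "continuous_on ({0..1} \<times> UNIV) (\<lambda>(t, x). B t x)"
    "\<And>t. t \<in> {0..1::real} \<Longrightarrow> \<exists>G. homeomorphism UNIV UNIV (B t) G" "\<And>x. B 0 x = x" "B 1 ` L = M"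
    using assms(2) unfolding ambient_isotopic_def by metis
  define H where "H t x = (if t \<le> 1/2 then A (2 * t) x else B (2 * t - 1) (A 1 x))" for t :: real and x
  have A1: "continuous_on UNIV (A 1)"
    using A(2)[of 1] by (auto simp: homeomorphism_def)
  have "continuous_on ({0..1/2} \<times> UNIV \<union> {1/2..1} \<times> UNIV)
     (\<lambda>p. if fst p \<le> 1/2 then A (2 * fst p) (snd p) else B (2 * fst p - 1) (A 1 (snd p)))"
  proof (rule continuous_on_cases)
    show "continuous_on ({0..1/2} \<times> UNIV) (\<lambda>p. A (2 * fst p) (snd p))"
      using continuous_on_compose2[OF A(1), of "{0..1/2} \<times> UNIV" "\<lambda>p. (2 * fst p, snd p)"]
      by (force intro!: continuous_intros)
    show "continuous_on ({1/2..1} \<times> UNIV) (\<lambda>p. B (2 * fst p - 1) (A 1 (snd p)))"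
      using continuous_on_compose2[OF B(1), of "{1/2..1} \<times> UNIV" "\<lambda>p. (2 * fst p - 1, A 1 (snd p))"]
      by (force intro!: continuous_intros continuous_on_compose2[OF A1])
  qed (auto intro!: closed_Times simp: B(3) mult.commute[of 2])
  moreover have "{0..1/2} \<times> UNIV \<union> {1/2..1} \<times> UNIV = {0..1::real} \<times> (UNIV :: 'a set)" by auto
  ultimately have "continuous_on ({0..1} \<times> UNIV) (\<lambda>(t, x). H t x)"
    unfolding H_def case_prod_unfold by metis
  moreover have "\<exists>G. homeomorphism UNIV UNIV (H t) G" if t: "t \<in> {0..1}" for t
  proof (cases "t \<le> 1/2")
    case True
    then have "H t = A (2 * t)" by (simp add: H_def fun_eq_iff)
    then show ?thesis using A(2)[of "2 * t"] True t by simp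
  next
    case False
    then have "H t = B (2 * t - 1) \<circ> A 1" by (simp add: H_def fun_eq_iff)
    moreover obtain G where "homeomorphism UNIV UNIV (A 1) G" using A(2)[of 1] by auto
    moreover obtain G' where "homeomorphism UNIV UNIV (B (2 * t - 1)) G'"
      using B(2)[of "2 * t - 1"] False t by auto
    ultimately show ?thesis by (metis homeomorphism_compose)
  qed
  moreover have "H 0 x = x" for x by (simp add: H_def A(3))
  moreover have "H 1 ` K = M" unfolding A(4)[symmetric] B(4)[symmetric] by (simp add: H_def image_image)
  ultimately show ?thesis unfolding ambient_isotopic_def by blast
qed

text \<open>A continuous bijection of space is a homeomorphism by invariance of domain, so that the continuity of
  the inverses need not be checked.\<close>

lemma ambient_isotopic_displacement:
  fixes V :: "space3 \<Rightarrow> space3"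
  assumes "continuous_on UNIV V" "\<And>s. s \<in> {0..1} \<Longrightarrow> bij (\<lambda>x. x + s *\<^sub>R V x)"
  shows "ambient_isotopic K ((\<lambda>x. x + V x) ` K)"
  unfolding ambient_isotopic_def
proof (intro exI[of _ "\<lambda>s x. x + s *\<^sub>R V x"] conjI ballI allI)
  have "continuous_on ({0..1} \<times> UNIV) (\<lambda>p. V (snd p))"
    by (rule continuous_on_compose2[OF assms(1)]) (auto intro!: continuous_intros)
  then show "continuous_on ({0..1} \<times> UNIV) (\<lambda>(s::real, x). x + s *\<^sub>R V x)"
    unfolding case_prod_unfold by (intro continuous_intros)
  show "\<exists>G. homeomorphism UNIV UNIV (\<lambda>x. x + s *\<^sub>R V x) G" if s: "s \<in> {0..1}" for s
  proof -
    have "continuous_on UNIV (\<lambda>x. x + s *\<^sub>R V x)" using assms(1) by (intro continuous_intros)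
    then obtain G where "homeomorphism UNIV (range (\<lambda>x. x + s *\<^sub>R V x)) (\<lambda>x. x + s *\<^sub>R V x) G"
      using invariance_of_domain_homeomorphism[of UNIV "\<lambda>x. x + s *\<^sub>R V x"]
        bij_is_inj[OF assms(2)[OF s]] by auto
    then show ?thesis using bij_is_surj[OF assms(2)[OF s]] by auto
  qed
qed auto

text \<open>Continuity may be tested after composition with a quotient map, and a continuous surjection of a
  compact space onto a Hausdorff space is one.\<close>

lemma continuous_on_factor_compact:
  fixes q :: "'a::t2_space \<Rightarrow> 'b::t2_space"
  assumes "compact T" "continuous_on T q" "continuous_on T (\<lambda>x. f (q x))"
  shows "continuous_on (q ` T) f"
proof -
  have "closed (q ` T)" using assms by (intro compact_imp_closed compact_continuous_image)
  moreover have "closed (f -` B \<inter> q ` T)" if "closed B" for B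
  proof -
    have "closed T" using assms(1) by (rule compact_imp_closed)
    then have "closed ((\<lambda>x. f (q x)) -` B \<inter> T)"
      using assms(3) that by (simp add: continuous_on_closed_vimage)
    then have "compact ((\<lambda>x. f (q x)) -` B \<inter> T)"
      using compact_Int_closed[OF assms(1)] by (metis Int_absorb1 Int_commute inf_le2)
    then have "compact (q ` ((\<lambda>x. f (q x)) -` B \<inter> T))"
      using assms(2) by (intro compact_continuous_image) (auto elim: continuous_on_subset)
    moreover have "q ` ((\<lambda>x. f (q x)) -` B \<inter> T) = f -` B \<inter> q ` T" by auto
    ultimately show ?thesis using compact_imp_closed by metis
  qed
  ultimately show ?thesis by (simp add: continuous_on_closed_vimage)
qed

section \<open>Closures of paths of configurations\<close>

text \<open>The page at angle \<open>2 \<pi> t\<close> of the open book with axis \<open>{0} \<times> \<real>\<close>. Only points with nonnegative real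
  part belong to it.\<close>

definition page :: "real \<Rightarrow> complex \<Rightarrow> space3" where
  "page t \<zeta> = (of_real (Re \<zeta>) * cis (2 * pi * t), Im \<zeta>)"

text \<open>The paths of interest have values in \<open>Conf\<close> and permute the three points when t runs from 0 to 1, so
  that their traces close up.\<close>

definition path_closure :: "(real \<Rightarrow> complex ^ 3) \<Rightarrow> space3 set" where
  "path_closure c = (\<lambda>(t, i). page t (c t $ i)) ` ({0..1} \<times> UNIV)"

definition Conf :: "(complex ^ 3) set" where
  "Conf = {v. (\<forall>i. Re (v $ i) > 0) \<and> (\<forall>i j. i \<noteq> j \<longrightarrow> v $ i \<noteq> v $ j)}"

lemma page_add: "page t (\<zeta> + \<eta>) = page t \<zeta> + page t \<eta>"
  by (simp add: page_def algebra_simps)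

lemma page_scaleR: "page t (s *\<^sub>R \<zeta>) = s *\<^sub>R page t \<zeta>"
  by (simp add: page_def scaleR_conv_of_real algebra_simps)

lemma continuous_on_page [continuous_intros]:
  "continuous_on S f \<Longrightarrow> continuous_on S g \<Longrightarrow> continuous_on S (\<lambda>x. page (f x) (g x))"
  unfolding page_def by (intro continuous_intros)

lemma norm_page: "norm (page t \<zeta>) = norm \<zeta>"
  by (simp add: page_def norm_prod_def norm_mult, simp add: cmod_def)

lemma page_0 [simp]: "page t 0 = 0"
  by (simp add: page_def zero_prod_def)

lemma page_1: "page 1 \<zeta> = page 0 \<zeta>"
  using cis_multiple_2pi[of 1] by (simp add: page_def)

definition page_angle :: "space3 \<Rightarrow> real" where
  "page_angle x = Arg2pi (fst x) / (2 * pi)"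

definition page_point :: "space3 \<Rightarrow> complex" where
  "page_point x = Complex (norm (fst x)) (snd x)"

lemma page_angle_bounds: "0 \<le> page_angle x" "page_angle x < 1"
  using Arg2pi[of "fst x"] by (auto simp: page_angle_def)

lemma page_coordinates: "page (page_angle x) (page_point x) = x"
  using Arg2pi_eq[of "fst x"]
  by (cases x) (simp add: page_def page_angle_def page_point_def cis_conv_exp)

lemma page_point_nonneg: "Re (page_point x) \<ge> 0"
  by (simp add: page_point_def)

lemma page_point_page: "Re \<zeta> \<ge> 0 \<Longrightarrow> page_point (page t \<zeta>) = \<zeta>"
  by (simp add: page_point_def page_def norm_mult)

lemma page_angle_page:
  assumes "Re \<zeta> > 0" "0 \<le> t" "t < 1"
  shows "page_angle (page t \<zeta>) = t"
proof -
  have "Arg2pi (of_real (Re \<zeta>) * exp (\<i> * of_real (2 * pi * t))) = 2 * pi * t"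
    using assms by (intro Arg2pi_unique[of "Re \<zeta>"]) auto
  then show ?thesis by (simp add: page_angle_def page_def cis_conv_exp)
qed

lemma page_axis: "Re \<zeta> = 0 \<Longrightarrow> page t \<zeta> = page t' \<zeta>"
  by (simp add: page_def)

text \<open>The field g acts within each page and vanishes on the axis. As it contracts distances by the factor
  1/2, adding any fraction s of it to the identity gives a bijection of each page: injectivity is
  immediate and surjectivity is Banach's fixed point theorem. The contraction also bounds the field by
  half the distance to the axis, so that no point crosses the axis.\<close>

lemma fibrewise_isotopy:
  fixes g :: "real \<Rightarrow> complex \<Rightarrow> complex"
  assumes cont: "continuous_on ({0..1} \<times> UNIV) (\<lambda>(t, \<zeta>). g t \<zeta>)"
    and lip: "\<And>t \<zeta> \<xi>. t \<in> {0..1} \<Longrightarrow> norm (g t \<zeta> - g t \<xi>) \<le> norm (\<zeta> - \<xi>) / 2"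
    and axis: "\<And>t \<zeta>. t \<in> {0..1} \<Longrightarrow> Re \<zeta> \<le> 0 \<Longrightarrow> g t \<zeta> = 0"
    and closed: "\<And>\<zeta>. g 1 \<zeta> = g 0 \<zeta>"
    and c: "\<And>t i. t \<in> {0..1} \<Longrightarrow> Re (c t $ i) > 0"
    and d: "\<And>t i. t \<in> {0..1} \<Longrightarrow> d t $ i = c t $ i + g t (c t $ i)"
  shows "ambient_isotopic (path_closure c) (path_closure d)"
proof -
  define V where "V x = page (page_angle x) (g (page_angle x) (page_point x))" for x
  have angle: "page_angle x \<in> {0..1}" for x
    using page_angle_bounds[of x] by simp
  have V_page: "V (page t \<zeta>) = page t (g t \<zeta>)" if t: "t \<in> {0..1}" and \<zeta>: "Re \<zeta> \<ge> 0" for t \<zeta>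
  proof -
    consider "Re \<zeta> = 0" | "Re \<zeta> > 0" "t < 1" | "Re \<zeta> > 0" "t = 1" using t \<zeta> by force
    then show ?thesis
    proof cases
      case 1
      then show ?thesis
        using axis[OF t, of \<zeta>] axis[OF angle, of \<zeta>] by (simp add: V_def page_point_page)
    next
      case 2
      then show ?thesis using t by (simp add: V_def page_point_page page_angle_page)
    next
      case 3
      then show ?thesis
        by (simp add: page_1 V_def page_point_page page_angle_page closed)
    qed
  qed
  have bound: "norm (g t \<zeta>) \<le> Re \<zeta> / 2" if t: "t \<in> {0..1}" and \<zeta>: "Re \<zeta> \<ge> 0" for t \<zeta>
  proof -
    have "\<zeta> - Complex 0 (Im \<zeta>) = of_real (Re \<zeta>)" by (simp add: complex_eq_iff)
    then have "norm (\<zeta> - Complex 0 (Im \<zeta>)) = Re \<zeta>" using \<zeta> by simp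
    then show ?thesis
      using lip[OF t, of \<zeta> "Complex 0 (Im \<zeta>)"] axis[OF t, of "Complex 0 (Im \<zeta>)"] by simp
  qed
  have cont_V: "continuous_on UNIV V"
  proof -
    have "isCont V x" for x
    proof -
      (* Near x the field V is the image of g under the quotient map from angles and page points to
         space, restricted to a compact piece. *)
      define R where "R = norm x + 1"
      define T where "T = {0..1::real} \<times> (cball 0 R \<inter> {\<zeta>. Re \<zeta> \<ge> 0})"
      have "closed {\<zeta>. Re \<zeta> \<ge> 0}" by (rule closed_halfspace_Re_ge)
      then have "compact T"
        unfolding T_def by (intro compact_Times compact_Int_closed) auto
      moreover have "continuous_on T (\<lambda>p. page (fst p) (snd p))"
        by (intro continuous_intros)
      moreover have "continuous_on T (\<lambda>p. V (page (fst p) (snd p)))"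
      proof -
        have "continuous_on T (\<lambda>p. g (fst p) (snd p))"
          using continuous_on_subset[OF cont, of T] by (auto simp: T_def case_prod_unfold)
        then have "continuous_on T (\<lambda>p. page (fst p) (g (fst p) (snd p)))"
          by (intro continuous_intros)
        then show ?thesis
          by (rule continuous_on_eq) (auto simp: T_def V_page)
      qed
      ultimately have "continuous_on ((\<lambda>p. page (fst p) (snd p)) ` T) V"
        by (rule continuous_on_factor_compact)
      moreover have "ball 0 R \<subseteq> (\<lambda>p. page (fst p) (snd p)) ` T"
      proof
        fix y :: space3 assume "y \<in> ball 0 R"
        moreover have "norm (page_point y) = norm y"
          using norm_page[of "page_angle y" "page_point y"] by (simp add: page_coordinates)
        ultimately have "(page_angle y, page_point y) \<in> T"
          using angle[of y] page_point_nonneg[of y] by (auto simp: T_def)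
        then show "y \<in> (\<lambda>p. page (fst p) (snd p)) ` T"
          by (rule rev_image_eqI) (simp add: page_coordinates)
      qed
      ultimately have "continuous_on (ball 0 R) V" by (rule continuous_on_subset)
      moreover have "x \<in> ball 0 R" by (simp add: R_def)
      ultimately show ?thesis by (simp add: continuous_on_eq_continuous_at)
    qed
    then show ?thesis by (simp add: continuous_on_eq_continuous_at)
  qed
  have bij: "bij (\<lambda>x. x + s *\<^sub>R V x)" if s: "s \<in> {0..1}" for s
  proof (rule bijI)
    have F: "page t \<zeta> + s *\<^sub>R V (page t \<zeta>) = page t (\<zeta> + s *\<^sub>R g t \<zeta>)"
      if "t \<in> {0..1}" "Re \<zeta> \<ge> 0" for t \<zeta>
      using V_page[OF that] by (simp add: page_add page_scaleR)
    have contract: "norm (s *\<^sub>R g t \<zeta> - s *\<^sub>R g t \<xi>) \<le> norm (\<zeta> - \<xi>) / 2" if "t \<in> {0..1}" for t \<zeta> \<xi>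
    proof -
      have "norm (s *\<^sub>R g t \<zeta> - s *\<^sub>R g t \<xi>) = s * norm (g t \<zeta> - g t \<xi>)"
        using s by (simp flip: scaleR_diff_right)
      also have "\<dots> \<le> norm (g t \<zeta> - g t \<xi>)"
        using s by (simp add: mult_left_le_one_le)
      finally show ?thesis using lip[OF that, of \<zeta> \<xi>] by simp
    qed
    have Re_pos: "Re (\<zeta> + s *\<^sub>R g t \<zeta>) \<ge> Re \<zeta> / 2" if "t \<in> {0..1}" "Re \<zeta> \<ge> 0" for t \<zeta>
    proof -
      have "\<bar>Re (s *\<^sub>R g t \<zeta>)\<bar> \<le> norm (s *\<^sub>R g t \<zeta>)" by (rule abs_Re_le_cmod)
      also have "\<dots> \<le> norm (g t \<zeta>)" using s by (simp add: mult_left_le_one_le)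
      finally show ?thesis using bound[OF that] by simp
    qed
    show "inj (\<lambda>x. x + s *\<^sub>R V x)"
    proof (rule injI)
      fix x y assume eq: "x + s *\<^sub>R V x = y + s *\<^sub>R V y"
      define t \<zeta> t' \<xi> where "t = page_angle x" "\<zeta> = page_point x" "t' = page_angle y" "\<xi> = page_point y"
      note defs = this
      have x: "x = page t \<zeta>" and y: "y = page t' \<xi>" by (simp_all add: defs page_coordinates)
      have t: "t \<in> {0..1}" "t < 1" "t' \<in> {0..1}" "t' < 1" and nn: "Re \<zeta> \<ge> 0" "Re \<xi> \<ge> 0"
        using angle page_angle_bounds page_point_nonneg by (simp_all add: defs)
      have eq': "page t (\<zeta> + s *\<^sub>R g t \<zeta>) = page t' (\<xi> + s *\<^sub>R g t' \<xi>)"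
        using eq F[OF t(1) nn(1)] F[OF t(3) nn(2)] by (simp add: x y)
      have nn': "Re (\<zeta> + s *\<^sub>R g t \<zeta>) \<ge> 0" "Re (\<xi> + s *\<^sub>R g t' \<xi>) \<ge> 0"
        using Re_pos[OF t(1) nn(1)] Re_pos[OF t(3) nn(2)] nn by linarith+
      have pt: "\<zeta> + s *\<^sub>R g t \<zeta> = \<xi> + s *\<^sub>R g t' \<xi>"
        using arg_cong[OF eq', of page_point] nn' by (simp only: page_point_page)
      show "x = y"
      proof (cases "Re (\<zeta> + s *\<^sub>R g t \<zeta>) > 0")
        case True
        then have "t = t'"
          using arg_cong[OF eq', of page_angle] t pt by (simp add: page_angle_page)
        then have "\<zeta> - \<xi> = s *\<^sub>R g t \<xi> - s *\<^sub>R g t \<zeta>" using pt by (simp add: algebra_simps)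
        then have "norm (\<zeta> - \<xi>) \<le> norm (\<zeta> - \<xi>) / 2"
          using contract[OF t(1), of \<xi> \<zeta>] by (metis norm_minus_commute)
        then show ?thesis using x y \<open>t = t'\<close> by simp
      next
        case False
        then have "Re \<zeta> = 0" "Re \<xi> = 0"
          using Re_pos[OF t(1) nn(1)] Re_pos[OF t(3) nn(2)] nn nn' arg_cong[OF pt, of Re] by linarith+
        then have "\<zeta> = \<xi>" using pt axis t by simp
        then show ?thesis using x y page_axis[OF \<open>Re \<zeta> = 0\<close>] by metis
      qed
    qed
    show "surj (\<lambda>x. x + s *\<^sub>R V x)"
    proof (rule surjI[of _ "\<lambda>y. SOME x. x + s *\<^sub>R V x = y"], rule someI_ex)
      fix y
      define t \<eta> where "t = page_angle y" "\<eta> = page_point y"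
      note defs = this
      have t: "t \<in> {0..1}" using angle by (simp add: defs)
      have "\<exists>!\<zeta>. \<eta> - s *\<^sub>R g t \<zeta> = \<zeta>"
      proof (rule banach_fix_type[of "1/2"])
        have "dist (\<eta> - s *\<^sub>R g t \<zeta>) (\<eta> - s *\<^sub>R g t \<xi>) \<le> 1 / 2 * dist \<zeta> \<xi>" for \<zeta> \<xi>
          using contract[OF t, of \<xi> \<zeta>] by (simp add: dist_norm norm_minus_commute)
        then show "\<forall>\<zeta> \<xi>. dist (\<eta> - s *\<^sub>R g t \<zeta>) (\<eta> - s *\<^sub>R g t \<xi>) \<le> 1 / 2 * dist \<zeta> \<xi>"
          by blast
      qed auto
      then obtain \<zeta> where "\<eta> - s *\<^sub>R g t \<zeta> = \<zeta>" by blast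
      then have \<zeta>: "\<eta> = \<zeta> + s *\<^sub>R g t \<zeta>" by (simp add: diff_eq_eq)
      have "Re \<zeta> \<ge> 0"
      proof (rule ccontr)
        assume "\<not> Re \<zeta> \<ge> 0"
        then have "\<eta> = \<zeta>" using \<zeta> axis[OF t] by simp
        then show False using \<open>\<not> Re \<zeta> \<ge> 0\<close> page_point_nonneg[of y] by (simp add: defs)
      qed
      have "page t \<zeta> + s *\<^sub>R V (page t \<zeta>) = page t \<eta>"
        using F[OF t \<open>Re \<zeta> \<ge> 0\<close>] unfolding \<zeta> .
      also have "\<dots> = y" unfolding defs by (rule page_coordinates)
      finally have "page t \<zeta> + s *\<^sub>R V (page t \<zeta>) = y" .
      then show "\<exists>x. x + s *\<^sub>R V x = y" by (rule exI[of _ "page t \<zeta>"])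
    qed
  qed
  have "ambient_isotopic (path_closure c) ((\<lambda>x. x + V x) ` path_closure c)"
    by (rule ambient_isotopic_displacement[OF cont_V bij])
  moreover have "(\<lambda>x. x + V x) ` path_closure c = path_closure d"
  proof -
    have "page t (c t $ i) + V (page t (c t $ i)) = page t (d t $ i)" if "t \<in> {0..1}" for t i
      using V_page[OF that, of "c t $ i"] c[OF that, of i] d[OF that, of i] by (simp add: page_add)
    then show ?thesis
      unfolding path_closure_def image_image by (intro image_cong) auto
  qed
  ultimately show ?thesis by simp
qed

text \<open>A bump function around each of the points carries the displacement from c to d. The bump has slope
  \<open>1 / \<epsilon>\<close> and the displacement is at most \<open>\<epsilon> / 6\<close>, so that the three bumps together are
  \<open>1/2\<close>-Lipschitz.\<close>

lemma path_closure_small_step: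
  assumes cont: "continuous_on {0..1} c" "continuous_on {0..1} d" and \<epsilon>: "\<epsilon> > 0"
    and sep: "\<And>t i j. t \<in> {0..1} \<Longrightarrow> i \<noteq> j \<Longrightarrow> dist (c t $ i) (c t $ j) \<ge> \<epsilon>"
    and pos: "\<And>t i. t \<in> {0..1} \<Longrightarrow> Re (c t $ i) \<ge> \<epsilon>"
    and small: "\<And>t i. t \<in> {0..1} \<Longrightarrow> dist (d t $ i) (c t $ i) \<le> \<epsilon> / 6"
    and \<sigma>: "bij \<sigma>" "\<And>i. c 1 $ i = c 0 $ \<sigma> i" "\<And>i. d 1 $ i = d 0 $ \<sigma> i"
  shows "ambient_isotopic (path_closure c) (path_closure d)"
proof -
  (* The bump around one point of c vanishes at the other two points and on the axis, by the
     separation of c; so g moves every point of c exactly to its counterpart in d. *)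
  define b where "b t i \<zeta> = max 0 (1 - dist \<zeta> (c t $ i) / \<epsilon>)" for t i \<zeta>
  define g where "g t \<zeta> = (\<Sum>i\<in>UNIV. b t i \<zeta> *\<^sub>R (d t $ i - c t $ i))" for t \<zeta>
  show ?thesis
  proof (rule fibrewise_isotopy[of g])
    have c': "continuous_on ({0..1} \<times> UNIV) (\<lambda>p. c (fst p))"
      and d': "continuous_on ({0..1} \<times> UNIV) (\<lambda>p. d (fst p))"
      by (rule continuous_on_compose2[OF cont(1)] continuous_on_compose2[OF cont(2)];
          auto intro!: continuous_intros)+
    have "continuous_on ({0..1} \<times> UNIV) (\<lambda>p. g (fst p) (snd p))"
      unfolding g_def b_def using \<epsilon>
      by (intro continuous_intros c' d') auto
    then show "continuous_on ({0..1} \<times> UNIV) (\<lambda>(t, \<zeta>). g t \<zeta>)"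
      by (simp add: case_prod_unfold)
  next
    fix t \<zeta> \<xi> assume t: "t \<in> {0..1::real}"
    have "norm ((b t i \<zeta> - b t i \<xi>) *\<^sub>R (d t $ i - c t $ i)) \<le> norm (\<zeta> - \<xi>) / 6" for i
    proof -
      have "\<bar>b t i \<zeta> - b t i \<xi>\<bar> \<le> \<bar>dist \<xi> (c t $ i) / \<epsilon> - dist \<zeta> (c t $ i) / \<epsilon>\<bar>"
        unfolding b_def by linarith
      also have "\<dots> = \<bar>dist \<xi> (c t $ i) - dist \<zeta> (c t $ i)\<bar> / \<epsilon>"
        using \<epsilon> by (simp flip: diff_divide_distrib)
      also have "\<dots> \<le> norm (\<zeta> - \<xi>) / \<epsilon>"
        using abs_dist_diff_le[of \<xi> "c t $ i" \<zeta>] \<epsilon>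
        by (intro divide_right_mono) (auto simp: dist_norm norm_minus_commute)
      finally have "\<bar>b t i \<zeta> - b t i \<xi>\<bar> * norm (d t $ i - c t $ i) \<le> norm (\<zeta> - \<xi>) / \<epsilon> * (\<epsilon> / 6)"
        using small[OF t, of i] \<epsilon> by (intro mult_mono) (auto simp: dist_norm)
      then show ?thesis using \<epsilon> by simp
    qed
    then have "(\<Sum>i\<in>UNIV. norm ((b t i \<zeta> - b t i \<xi>) *\<^sub>R (d t $ i - c t $ i))) \<le> (\<Sum>i\<in>(UNIV::3 set). norm (\<zeta> - \<xi>) / 6)"
      by (intro sum_mono)
    moreover have "g t \<zeta> - g t \<xi> = (\<Sum>i\<in>UNIV. (b t i \<zeta> - b t i \<xi>) *\<^sub>R (d t $ i - c t $ i))"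
      by (simp add: g_def sum_subtractf scaleR_left_diff_distrib)
    moreover have "norm \<dots> \<le> (\<Sum>i\<in>UNIV. norm ((b t i \<zeta> - b t i \<xi>) *\<^sub>R (d t $ i - c t $ i)))"
      by (rule norm_sum)
    ultimately show "norm (g t \<zeta> - g t \<xi>) \<le> norm (\<zeta> - \<xi>) / 2" by simp
  next
    fix t \<zeta> assume t: "t \<in> {0..1::real}" and \<zeta>: "Re \<zeta> \<le> 0"
    have "dist \<zeta> (c t $ i) \<ge> \<epsilon>" for i
      using abs_Re_le_cmod[of "\<zeta> - c t $ i"] pos[OF t, of i] \<zeta> by (simp add: dist_norm)
    then have "b t i \<zeta> = 0" for i using \<epsilon> by (simp add: b_def)
    then show "g t \<zeta> = 0" by (simp add: g_def)
  next
    fix \<zeta>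
    have "g 1 \<zeta> = (\<Sum>i\<in>UNIV. b 0 (\<sigma> i) \<zeta> *\<^sub>R (d 0 $ \<sigma> i - c 0 $ \<sigma> i))"
      by (simp add: g_def b_def \<sigma>)
    also have "\<dots> = g 0 \<zeta>"
      unfolding g_def using sum.reindex_bij_betw[OF \<sigma>(1)] .
    finally show "g 1 \<zeta> = g 0 \<zeta>" .
  next
    fix t i assume t: "t \<in> {0..1::real}"
    show "Re (c t $ i) > 0" using pos[OF t, of i] \<epsilon> by simp
    have "b t j (c t $ i) *\<^sub>R (d t $ j - c t $ j) = (if j = i then d t $ i - c t $ i else 0)" for j
      using sep[OF t, of i j] \<epsilon> by (auto simp: b_def)
    then show "d t $ i = c t $ i + g t (c t $ i)"
      by (simp add: g_def)
  qed
qed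

lemma open_Conf: "open Conf"
proof -
  have "open {v :: complex ^ 3. Re (v $ i) > 0}" for i
    by (intro open_Collect_less continuous_intros)
  moreover have "open {v :: complex ^ 3. v $ i \<noteq> v $ j}" for i j
    by (intro open_Collect_neq continuous_intros)
  moreover have eq: "Conf = (\<Inter>i. {v. Re (v $ i) > 0}) \<inter> (\<Inter>i. \<Inter>j\<in>- {i}. {v. v $ i \<noteq> v $ j})"
    by (auto simp: Conf_def)
  ultimately show ?thesis unfolding eq by (intro open_Int open_INT ballI) auto
qed

text \<open>If the distance in question were smaller than \<open>\<epsilon>\<close>, then the ball would contain the configuration
  in which one point is moved onto the axis or onto the other point.\<close>

lemma Conf_separation:
  assumes "\<epsilon> > 0" "ball v \<epsilon> \<subseteq> Conf"
  shows "Re (v $ i) \<ge> \<epsilon>" "i \<noteq> j \<Longrightarrow> dist (v $ i) (v $ j) \<ge> \<epsilon>"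
proof -
  have move: "dist v (\<chi> k. if k = i then z else v $ k) = dist (v $ i) z" for z
  proof -
    have "v - (\<chi> k. if k = i then z else v $ k) = axis i (v $ i - z)"
      by (simp add: Finite_Cartesian_Product.vec_eq_iff axis_def)
    moreover have "norm (axis i (v $ i - z)) = norm (v $ i - z)"
      by (simp add: norm_vec_def L2_set_def axis_def if_distrib[of norm] if_distrib[of "\<lambda>x. x\<^sup>2"]
          cong: if_cong)
    ultimately show ?thesis by (simp add: dist_norm)
  qed
  show "Re (v $ i) \<ge> \<epsilon>"
  proof (rule ccontr)
    assume less: "\<not> Re (v $ i) \<ge> \<epsilon>"
    have "v \<in> Conf" using assms by auto
    then have "Re (v $ i) > 0" by (simp add: Conf_def)
    have "dist (v $ i) (Complex 0 (Im (v $ i))) = Re (v $ i)"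
      using \<open>Re (v $ i) > 0\<close> by (simp add: dist_norm cmod_def)
    with less have "(\<chi> k. if k = i then Complex 0 (Im (v $ i)) else v $ k) \<in> ball v \<epsilon>"
      by (simp add: move)
    then have "(\<chi> k. if k = i then Complex 0 (Im (v $ i)) else v $ k) \<in> Conf" using assms by blast
    then have "Re ((\<chi> k. if k = i then Complex 0 (Im (v $ i)) else v $ k) $ i) > 0"
      unfolding Conf_def by blast
    then show False by simp
  qed
  show "dist (v $ i) (v $ j) \<ge> \<epsilon>" if "i \<noteq> j"
  proof (rule ccontr)
    assume "\<not> dist (v $ i) (v $ j) \<ge> \<epsilon>"
    then have "(\<chi> k. if k = i then v $ j else v $ k) \<in> ball v \<epsilon>" by (simp add: move)
    then have "(\<chi> k. if k = i then v $ j else v $ k) \<in> Conf" using assms by blast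
    then have "(\<chi> k. if k = i then v $ j else v $ k) $ i \<noteq> (\<chi> k. if k = i then v $ j else v $ k) $ j"
      using that unfolding Conf_def by blast
    then show False using that by simp
  qed
qed

text \<open>By compactness the configurations of the homotopy keep a distance \<open>\<epsilon>\<close> from the complement of \<open>Conf\<close>.
  By uniform continuity the homotopy is a composition of steps shorter than \<open>\<epsilon> / 6\<close>.\<close>

lemma path_closure_homotopy:
  assumes cont: "continuous_on ({0..1} \<times> {0..1}) (\<lambda>(s, t). H s t)"
    and conf: "\<And>s t. s \<in> {0..1} \<Longrightarrow> t \<in> {0..1} \<Longrightarrow> H s t \<in> Conf"
    and \<sigma>: "bij \<sigma>" "\<And>s i. s \<in> {0..1} \<Longrightarrow> H s 1 $ i = H s 0 $ \<sigma> i"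
  shows "ambient_isotopic (path_closure (H 0)) (path_closure (H (1::real)))"
proof -
  let ?Q = "{0..1::real} \<times> {0..1::real}"
  have Q: "compact ?Q" by (intro compact_Times) auto
  then have "compact ((\<lambda>(s, t). H s t) ` ?Q)" by (rule compact_continuous_image[OF cont])
  moreover have "(\<lambda>(s, t). H s t) ` ?Q \<subseteq> Conf" using conf by auto
  ultimately obtain \<epsilon> where \<epsilon>: "\<epsilon> > 0" "(\<Union>v\<in>(\<lambda>(s, t). H s t) ` ?Q. ball v \<epsilon>) \<subseteq> Conf"
    using compact_subset_open_imp_ball_epsilon_subset[OF _ open_Conf] by metis
  have ball: "ball (H s t) \<epsilon> \<subseteq> Conf" if "s \<in> {0..1}" "t \<in> {0..1}" for s t
  proof -
    have "H s t \<in> (\<lambda>(s, t). H s t) ` ?Q" using that by (intro rev_image_eqI[of "(s, t)"]) auto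
    then show ?thesis using \<epsilon>(2) by blast
  qed
  obtain \<delta> where \<delta>: "\<delta> > 0"
    "\<And>p q. p \<in> ?Q \<Longrightarrow> q \<in> ?Q \<Longrightarrow> dist q p < \<delta> \<Longrightarrow> dist (case q of (s, t) \<Rightarrow> H s t) (case p of (s, t) \<Rightarrow> H s t) < \<epsilon> / 6"
    using uniformly_continuous_onE[OF compact_uniformly_continuous[OF cont Q], of "\<epsilon> / 6"] \<epsilon>(1)
    by (metis divide_pos_pos zero_less_numeral)
  obtain N :: nat where N: "N > 0" "1 / real N < \<delta>"
    using \<delta>(1) by (metis nat_approx_posE zero_less_Suc)
  have "ambient_isotopic (path_closure (H 0)) (path_closure (H (real k / real N)))" if "k \<le> N" for k
    using that
  proof (induction k)
    case 0
    then show ?case by (simp add: ambient_isotopic_refl)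
  next
    case (Suc k)
    let ?s = "real k / real N" and ?s' = "real (Suc k) / real N"
    have s: "?s \<in> {0..1}" "?s' \<in> {0..1}" using Suc.prems N(1) by (auto simp: divide_simps)
    have cs: "continuous_on {0..1} (H s)" if "s \<in> {0..1}" for s
      using continuous_on_compose2[OF cont, of "{0..1}" "\<lambda>t. (s, t)"] that
      by (force intro!: continuous_intros)
    have "ambient_isotopic (path_closure (H ?s)) (path_closure (H ?s'))"
    proof (rule path_closure_small_step[OF cs[OF s(1)] cs[OF s(2)] \<epsilon>(1)])
      fix t i assume t: "t \<in> {0..1::real}"
      show "Re (H ?s t $ i) \<ge> \<epsilon>" by (rule Conf_separation(1)[OF \<epsilon>(1) ball[OF s(1) t]])
      have "dist (?s', t) (?s, t) = 1 / real N"
        by (simp add: dist_Pair_Pair dist_real_def diff_divide_distrib[symmetric])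
      then have "dist (H ?s' t) (H ?s t) < \<epsilon> / 6"
        using \<delta>(2)[of "(?s, t)" "(?s', t)"] s t N(2) by auto
      then show "dist (H ?s' t $ i) (H ?s t $ i) \<le> \<epsilon> / 6"
        using dist_vec_nth_le[of "H ?s' t" i "H ?s t"] by linarith
    next
      fix t i j assume t: "t \<in> {0..1::real}" and "i \<noteq> (j :: 3)"
      then show "dist (H ?s t $ i) (H ?s t $ j) \<ge> \<epsilon>"
        using Conf_separation(2)[OF \<epsilon>(1) ball[OF s(1) t]] by blast
    qed (use \<sigma> s in auto)
    with Suc show ?case using ambient_isotopic_trans by fastforce
  qed
  from this[of N] show ?thesis using N(1) by simp
qed

section \<open>Braid words as paths of configurations\<close>

definition strand_point :: "letter \<Rightarrow> nat \<Rightarrow> real \<Rightarrow> complex" where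
  "strand_point x p t = Complex (fst (strand x p t)) (snd (strand x p t))"

definition next_pos :: "letter \<Rightarrow> nat \<Rightarrow> nat" where
  "next_pos x p = (if p = gen_index (fst x) then gen_index (fst x) + 1
     else if p = gen_index (fst x) + 1 then gen_index (fst x) else p)"

text \<open>The permutation of the positions 1, 2, 3 that underlies a word.\<close>

definition end_pos :: "word \<Rightarrow> nat \<Rightarrow> nat" where
  "end_pos w = fold next_pos w"

lemma end_pos_simps [simp]:
  "end_pos [] = id" "end_pos (x # w) = end_pos w \<circ> next_pos x" "end_pos (u @ v) = end_pos v \<circ> end_pos u"
  by (simp_all add: end_pos_def fun_eq_iff)

lemma gen_index_cases: "gen_index g = 1 \<or> gen_index g = 2"
  by (cases g) auto

lemma strand_point_0: "strand_point x p 0 = of_nat p"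
  by (simp add: strand_point_def strand_def complex_eq_iff Let_def)

lemma strand_point_1: "strand_point x p 1 = of_nat (next_pos x p)"
  by (auto simp: strand_point_def strand_def complex_eq_iff Let_def next_pos_def)

lemma continuous_on_strand_point: "continuous_on S (strand_point x p)"
proof -
  have "continuous_on S (strand x p)"
    unfolding strand_def Let_def
    by (cases "p = gen_index (fst x)"; cases "p = gen_index (fst x) + 1"; cases "snd x")
      (simp_all add: continuous_intros)
  then show ?thesis
    unfolding strand_point_def Complex_eq by (intro continuous_intros)
qed

lemma strand_point_inv:
  "strand_point (inv_letter x) (next_pos x p) t = strand_point x p (1 - t)"
  by (auto simp: strand_point_def strand_def Let_def next_pos_def inv_letter_def algebra_simps)

lemma strands_meet:
  assumes "p \<in> {1, 2, 3}" "q \<in> {1, 2, 3}" "p \<noteq> q" "t \<in> {0..1}"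
    and "Re (strand_point x p t) = Re (strand_point x q t)"
  shows "t = 1 / 2" and "(p = gen_index (fst x) \<and> q = gen_index (fst x) + 1) \<or>
    (q = gen_index (fst x) \<and> p = gen_index (fst x) + 1)"
proof -
  define h where "h = (if snd x then 1 else -1) * t * (1 - t)"
  define i where "i = gen_index (fst x)"
  have i: "i = 1 \<or> i = 2" unfolding i_def by (rule gen_index_cases)
  have s: "strand x r t = (if r = i then (real i + t, h) else if r = i + 1 then (real i + 1 - t, - h) else (real r, 0))" for r
    by (simp add: strand_def Let_def h_def i_def)
  have fst: "fst (strand x p t) = fst (strand x q t)"
    using assms(5) by (simp add: strand_point_def)
  have *: "t = 1 / 2 \<and> ((p = i \<and> q = i + 1) \<or> (q = i \<and> p = i + 1))"
  proof (cases "(p = i \<and> q = i + 1) \<or> (q = i \<and> p = i + 1)")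
    case True
    then show ?thesis using fst by (auto simp: s)
  next
    case False
    then show ?thesis using fst assms i by (auto simp: s split: if_splits)
  qed
  then show "t = 1 / 2" and "(p = gen_index (fst x) \<and> q = gen_index (fst x) + 1) \<or>
    (q = gen_index (fst x) \<and> p = gen_index (fst x) + 1)"
    unfolding i_def by blast+
qed

lemma crossing_heights:
  "Im (strand_point x (gen_index (fst x)) (1 / 2)) = (if snd x then 1 / 4 else - 1 / 4)"
  "Im (strand_point x (gen_index (fst x) + 1) (1 / 2)) = (if snd x then - 1 / 4 else 1 / 4)"
  by (simp_all add: strand_point_def strand_def Let_def)

lemma strand_point_distinct:
  assumes "p \<in> {1, 2, 3}" "q \<in> {1, 2, 3}" "p \<noteq> q" "t \<in> {0..1}"
  shows "strand_point x p t \<noteq> strand_point x q t"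
proof
  assume eq: "strand_point x p t = strand_point x q t"
  note meet = strands_meet[OF assms arg_cong[OF eq, of Re]]
  have "Im (strand_point x p (1 / 2)) = Im (strand_point x q (1 / 2))"
    using eq meet(1) by simp
  with meet(2) show False using crossing_heights[of x] by (auto split: if_splits)
qed

lemma Re_strand_point_pos:
  assumes "p \<ge> 1" "t \<in> {0..1}"
  shows "Re (strand_point x p t) > 0"
  using assms gen_index_cases[of "fst x"] by (auto simp: strand_point_def strand_def Let_def)

text \<open>A bijection between the names of the strands, which index the components of a configuration, and the
  positions at which the strands start.\<close>

definition labelling :: "(3 \<Rightarrow> nat) \<Rightarrow> bool" where
  "labelling \<pi> \<longleftrightarrow> bij_betw \<pi> UNIV {1, 2, 3}"

lemma labelling_next_pos: "labelling \<pi> \<Longrightarrow> labelling (next_pos x \<circ> \<pi>)"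
proof -
  have "bij_betw (next_pos x) {1, 2, 3} {1, 2, 3}"
    by (rule bij_betwI[where g = "next_pos x"])
      (use gen_index_cases[of "fst x"] in \<open>auto simp: next_pos_def\<close>)
  then show "labelling \<pi> \<Longrightarrow> labelling (next_pos x \<circ> \<pi>)"
    unfolding labelling_def by (rule bij_betw_trans[rotated])
qed

lemma labelling_end_pos: "labelling \<pi> \<Longrightarrow> labelling (end_pos w \<circ> \<pi>)"
  by (induction w arbitrary: \<pi>) (simp_all add: labelling_next_pos comp_assoc)

definition config :: "(3 \<Rightarrow> nat) \<Rightarrow> complex ^ 3" where
  "config \<pi> = (\<chi> i. of_nat (\<pi> i))"

lemma config_inject: "config \<pi> = config \<rho> \<longleftrightarrow> \<pi> = \<rho>"
  by (simp add: config_def Finite_Cartesian_Product.vec_eq_iff fun_eq_iff)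

definition letter_path :: "letter \<Rightarrow> (3 \<Rightarrow> nat) \<Rightarrow> real \<Rightarrow> complex ^ 3" where
  "letter_path x \<pi> t = (\<chi> i. strand_point x (\<pi> i) t)"

text \<open>The letters are joined by \<open>+++\<close>, which makes the later letters faster and faster but fits the library
  of homotopic paths.\<close>

fun word_path :: "word \<Rightarrow> (3 \<Rightarrow> nat) \<Rightarrow> real \<Rightarrow> complex ^ 3" where
  "word_path [] \<pi> = linepath (config \<pi>) (config \<pi>)"
| "word_path (x # w) \<pi> = letter_path x \<pi> +++ word_path w (next_pos x \<circ> \<pi>)"

lemma letter_path_ends [simp]:
  "letter_path x \<pi> 0 = config \<pi>" "letter_path x \<pi> 1 = config (next_pos x \<circ> \<pi>)"
  "pathstart (letter_path x \<pi>) = config \<pi>" "pathfinish (letter_path x \<pi>) = config (next_pos x \<circ> \<pi>)"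
  by (simp_all add: letter_path_def config_def pathstart_def pathfinish_def strand_point_0 strand_point_1)

lemma path_letter_path [simp]: "path (letter_path x \<pi>)"
  unfolding path_def letter_path_def by (intro continuous_intros continuous_on_strand_point)

lemma letter_path_in_Conf:
  assumes "labelling \<pi>" "t \<in> {0..1}"
  shows "letter_path x \<pi> t \<in> Conf"
proof -
  have range: "\<pi> i \<in> {1, 2, 3}" and inj: "i \<noteq> j \<Longrightarrow> \<pi> i \<noteq> \<pi> j" for i j
    using assms(1) unfolding labelling_def bij_betw_def inj_on_def by auto
  have "\<pi> i \<ge> 1" for i using range[of i] by auto
  then show ?thesis
    unfolding Conf_def letter_path_def
    using strand_point_distinct[OF range range inj assms(2)] Re_strand_point_pos[OF _ assms(2)] by auto
qed

lemma path_image_letter_path: "labelling \<pi> \<Longrightarrow> path_image (letter_path x \<pi>) \<subseteq> Conf"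
  unfolding path_image_def using letter_path_in_Conf by blast

lemma config_in_Conf: "labelling \<pi> \<Longrightarrow> config \<pi> \<in> Conf"
  using letter_path_in_Conf[of \<pi> 0] by simp

lemma word_path_ends [simp]:
  "pathstart (word_path w \<pi>) = config \<pi>" "pathfinish (word_path w \<pi>) = config (end_pos w \<circ> \<pi>)"
  by (induction w arbitrary: \<pi>) (simp_all add: comp_assoc)

lemma path_word_path [simp]: "path (word_path w \<pi>)"
  by (induction w arbitrary: \<pi>) (simp_all)

lemma path_image_word_path: "labelling \<pi> \<Longrightarrow> path_image (word_path w \<pi>) \<subseteq> Conf"
  by (induction w arbitrary: \<pi>)
    (simp_all add: config_in_Conf subset_path_image_join path_image_letter_path labelling_next_pos)

lemma word_path_append:
  "labelling \<pi> \<Longrightarrow> homotopic_paths Conf (word_path (u @ v) \<pi>) (word_path u \<pi> +++ word_path v (end_pos u \<circ> \<pi>))"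
proof (induction u arbitrary: \<pi>)
  case Nil
  then have "homotopic_paths Conf (linepath (config \<pi>) (config \<pi>) +++ word_path v \<pi>) (word_path v \<pi>)"
    by (intro homotopic_paths_lid') (simp_all add: path_image_word_path)
  from homotopic_paths_sym[OF this] show ?case
    by (simp only: append_Nil word_path.simps end_pos_simps id_comp)
next
  case (Cons x u)
  define \<rho> where "\<rho> = next_pos x \<circ> \<pi>"
  have \<rho>: "labelling \<rho>" unfolding \<rho>_def using Cons.prems by (rule labelling_next_pos)
  have "homotopic_paths Conf (letter_path x \<pi>) (letter_path x \<pi>)"
    using Cons.prems by (simp add: path_image_letter_path)
  then have "homotopic_paths Conf (letter_path x \<pi> +++ word_path (u @ v) \<rho>)
     (letter_path x \<pi> +++ (word_path u \<rho> +++ word_path v (end_pos u \<circ> \<rho>)))"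
    using Cons.IH[OF \<rho>] by (rule homotopic_paths_join) (simp add: \<rho>_def comp_def)
  also have "homotopic_paths Conf \<dots> ((letter_path x \<pi> +++ word_path u \<rho>) +++ word_path v (end_pos u \<circ> \<rho>))"
    using Cons.prems \<rho> labelling_end_pos[OF \<rho>]
    by (intro homotopic_paths_assoc)
      (simp_all add: path_image_letter_path path_image_word_path \<rho>_def comp_def)
  finally show ?case by (simp add: \<rho>_def comp_def)
qed

definition word_homotopic :: "word \<Rightarrow> word \<Rightarrow> bool" where
  "word_homotopic u v \<longleftrightarrow> (\<forall>\<pi>. labelling \<pi> \<longrightarrow> homotopic_paths Conf (word_path u \<pi>) (word_path v \<pi>))"

lemma word_homotopic_refl: "word_homotopic u u"
  unfolding word_homotopic_def by (simp add: path_image_word_path)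

lemma word_homotopic_sym: "word_homotopic u v \<Longrightarrow> word_homotopic v u"
  unfolding word_homotopic_def by (simp add: homotopic_paths_sym)

lemma word_homotopic_trans: "word_homotopic u v \<Longrightarrow> word_homotopic v w \<Longrightarrow> word_homotopic u w"
  unfolding word_homotopic_def using homotopic_paths_trans by blast

lemma word_homotopic_append:
  assumes "word_homotopic u u'" "word_homotopic v v'"
  shows "word_homotopic (u @ v) (u' @ v')"
  unfolding word_homotopic_def
proof (intro allI impI)
  fix \<pi> assume \<pi>: "labelling \<pi>"
  have u: "homotopic_paths Conf (word_path u \<pi>) (word_path u' \<pi>)"
    using assms(1) \<pi> by (simp add: word_homotopic_def)
  have "end_pos u \<circ> \<pi> = end_pos u' \<circ> \<pi>"
    using homotopic_paths_imp_pathfinish[OF u] by (simp add: config_inject)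
  then have v: "homotopic_paths Conf (word_path v (end_pos u \<circ> \<pi>)) (word_path v' (end_pos u' \<circ> \<pi>))"
    using assms(2) labelling_end_pos[OF \<pi>] by (simp add: word_homotopic_def)
  have "homotopic_paths Conf (word_path (u @ v) \<pi>) (word_path u \<pi> +++ word_path v (end_pos u \<circ> \<pi>))"
    by (rule word_path_append[OF \<pi>])
  also have "homotopic_paths Conf \<dots> (word_path u' \<pi> +++ word_path v' (end_pos u' \<circ> \<pi>))"
    using u v by (rule homotopic_paths_join) simp
  also have "homotopic_paths Conf \<dots> (word_path (u' @ v') \<pi>)"
    using word_path_append[OF \<pi>] homotopic_paths_sym by blast
  finally show "homotopic_paths Conf (word_path (u @ v) \<pi>) (word_path (u' @ v') \<pi>)" .
qed

lemma word_homotopic_cancel: "word_homotopic [x, inv_letter x] []"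
  unfolding word_homotopic_def
proof (intro allI impI)
  fix \<pi> assume \<pi>: "labelling \<pi>"
  let ?\<rho> = "next_pos x \<circ> \<pi>"
  have rev: "letter_path (inv_letter x) ?\<rho> = reversepath (letter_path x \<pi>)"
    by (simp add: fun_eq_iff letter_path_def reversepath_def strand_point_inv)
  have "pathfinish (letter_path (inv_letter x) ?\<rho>) = config \<pi>"
    by (simp only: rev) simp
  then have fin: "config (next_pos (inv_letter x) \<circ> ?\<rho>) = config \<pi>"
    by (simp only: letter_path_ends)
  have "homotopic_paths Conf (letter_path x \<pi> +++ (reversepath (letter_path x \<pi>) +++ linepath (config \<pi>) (config \<pi>)))
     (letter_path x \<pi> +++ reversepath (letter_path x \<pi>))"
    using \<pi> by (intro homotopic_paths_join homotopic_paths_rid') (simp_all add: path_image_letter_path)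
  also have "homotopic_paths Conf \<dots> (linepath (config \<pi>) (config \<pi>))"
    using homotopic_paths_rinv[of "letter_path x \<pi>" Conf] \<pi> by (simp add: path_image_letter_path)
  finally show "homotopic_paths Conf (word_path [x, inv_letter x] \<pi>) (word_path [] \<pi>)"
    by (simp only: word_path.simps rev fin)
qed

section \<open>The braid relation\<close>

text \<open>The strand of w that starts at position p, in the same time scale as in \<open>word_path\<close>.\<close>

fun track :: "word \<Rightarrow> nat \<Rightarrow> real \<Rightarrow> complex" where
  "track [] p = (\<lambda>t. of_nat p)"
| "track (x # w) p = strand_point x p +++ track w (next_pos x p)"

lemma word_path_nth: "word_path w \<pi> t $ i = track w (\<pi> i) t"
  by (induction w arbitrary: \<pi> t)
    (simp_all add: config_def linepath_def joinpaths_def letter_path_def flip: scaleR_left_distrib)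

lemma track_ends: "track w p 0 = of_nat p" "track w p 1 = of_nat (end_pos w p)"
  by (induction w arbitrary: p) (simp_all add: joinpaths_def strand_point_0)

text \<open>A braid in which every strand runs above all strands of larger initial position is determined, up to
  isotopy, by its permutation.\<close>

definition descending :: "word \<Rightarrow> bool" where
  "descending w \<longleftrightarrow> (\<forall>p q t. p \<in> {1, 2, 3} \<and> q \<in> {1, 2, 3} \<and> p < q \<and> t \<in> {0..1} \<and>
     Re (track w p t) = Re (track w q t) \<longrightarrow> Im (track w p t) > Im (track w q t))"

text \<open>Every descending word can be deformed linearly, without changing the projection, to a path that
  runs at the heights \<open>t (1 - t) (2 - p)\<close>, which separate the strands at all times between 0 and 1. For
  two words with the same end positions these paths differ only in their projections, which can
  then be deformed linearly.\<close>

lemma descending_words_homotopic: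
  assumes "descending u" "descending v" "\<And>p. p \<in> {1, 2, 3} \<Longrightarrow> end_pos u p = end_pos v p"
  shows "word_homotopic u v"
  unfolding word_homotopic_def
proof (intro allI impI)
  fix \<pi> assume \<pi>: "labelling \<pi>"
  have range: "\<pi> i \<in> {1, 2, 3}" and inj: "i \<noteq> j \<Longrightarrow> \<pi> i \<noteq> \<pi> j" for i j
    using \<pi> unfolding labelling_def bij_betw_def inj_on_def by auto
  (* The normal form of a descending word: the same projection, with standard heights. *)
  define L where "L w t = (\<chi> i. Complex (Re (track w (\<pi> i) t)) (t * (1 - t) * (2 - real (\<pi> i))))"
    for w t
  have ends: "L w 0 = config \<pi>" "L w 1 = config (end_pos w \<circ> \<pi>)" for w
    by (simp_all add: L_def config_def track_ends complex_eq_iff Finite_Cartesian_Product.vec_eq_iff)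
  have path_L: "path (L w)" for w
  proof -
    have "continuous_on {0..1} (\<lambda>t. word_path w \<pi> t $ i)" for i
      using path_word_path[of w \<pi>] unfolding path_def by (intro continuous_intros)
    then have "continuous_on {0..1} (\<lambda>t. track w (\<pi> i) t)" for i by (simp add: word_path_nth)
    then show ?thesis unfolding path_def L_def Complex_eq by (intro continuous_intros)
  qed
  have Re_pos: "Re (track w (\<pi> i) t) > 0" if "t \<in> {0..1}" for w t i
  proof -
    have "word_path w \<pi> t \<in> Conf"
      using path_image_word_path[OF \<pi>, of w] that unfolding path_image_def by blast
    then have "Re (word_path w \<pi> t $ i) > 0" unfolding Conf_def by blast
    then show ?thesis by (simp add: word_path_nth)
  qed
  have to_L: "homotopic_paths Conf (word_path w \<pi>) (L w)" if w: "descending w" for w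
  proof (rule homotopic_paths_linear[OF path_word_path path_L])
    show "pathstart (L w) = pathstart (word_path w \<pi>)" "pathfinish (L w) = pathfinish (word_path w \<pi>)"
      by (simp_all add: pathstart_def[of "L w"] pathfinish_def[of "L w"] ends)
    fix t assume t: "t \<in> {0..1::real}"
    show "closed_segment (word_path w \<pi> t) (L w t) \<subseteq> Conf"
    proof
      fix v assume "v \<in> closed_segment (word_path w \<pi> t) (L w t)"
      then obtain s where s: "0 \<le> s" "s \<le> 1"
        and v: "v = (1 - s) *\<^sub>R word_path w \<pi> t + s *\<^sub>R L w t"
        by (auto simp: closed_segment_def)
      have Re_v: "Re (v $ i) = Re (track w (\<pi> i) t)" for i
        by (simp add: v L_def word_path_nth algebra_simps)
      have Im_v: "Im (v $ i) = (1 - s) * Im (track w (\<pi> i) t) + s * (t * (1 - t) * (2 - real (\<pi> i)))" for i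
        by (simp add: v L_def word_path_nth)
      have "v $ i \<noteq> v $ j" if less: "\<pi> i < \<pi> j" for i j
      proof
        assume eq: "v $ i = v $ j"
        then have "Re (track w (\<pi> i) t) = Re (track w (\<pi> j) t)" by (metis Re_v)
        with w have Im: "Im (track w (\<pi> i) t) > Im (track w (\<pi> j) t)"
          using less range t unfolding descending_def by blast
        then have "t \<noteq> 0" "t \<noteq> 1" by (auto simp: track_ends)
        then have tt: "t * (1 - t) > 0" using t by simp
        have lower: "t * (1 - t) * (2 - real (\<pi> i)) > t * (1 - t) * (2 - real (\<pi> j))"
          using tt less by (intro mult_strict_left_mono) auto
        have "s * (t * (1 - t) * (2 - real (\<pi> i))) \<ge> s * (t * (1 - t) * (2 - real (\<pi> j)))"
          by (rule mult_left_mono[OF less_imp_le[OF lower] s(1)])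
        moreover have "(1 - s) * Im (track w (\<pi> i) t) \<ge> (1 - s) * Im (track w (\<pi> j) t)"
          using Im s by (intro mult_left_mono) auto
        moreover have "(1 - s) * Im (track w (\<pi> i) t) > (1 - s) * Im (track w (\<pi> j) t) \<or>
           s * (t * (1 - t) * (2 - real (\<pi> i))) > s * (t * (1 - t) * (2 - real (\<pi> j)))"
          using Im s lower by (cases "s = 1") (auto intro: mult_strict_left_mono)
        ultimately have "Im (v $ i) > Im (v $ j)" unfolding Im_v by linarith
        with eq show False by simp
      qed
      then have "v $ i \<noteq> v $ j" if "i \<noteq> j" for i j
        using inj[OF that] by (metis linorder_neqE_nat)
      then show "v \<in> Conf" unfolding Conf_def using Re_v Re_pos[OF t] by simp
    qed
  qed
  have "homotopic_paths Conf (L u) (L v)"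
  proof (rule homotopic_paths_linear[OF path_L path_L])
    have e: "end_pos u \<circ> \<pi> = end_pos v \<circ> \<pi>" using assms(3) range by auto
    then show "pathstart (L v) = pathstart (L u)" "pathfinish (L v) = pathfinish (L u)"
      by (simp_all add: pathstart_def pathfinish_def ends)
    fix t assume t: "t \<in> {0..1::real}"
    show "closed_segment (L u t) (L v t) \<subseteq> Conf"
    proof (cases "t = 0 \<or> t = 1")
      case True
      then show ?thesis
        using e ends config_in_Conf[OF \<pi>] config_in_Conf[OF labelling_end_pos[OF \<pi>]] by auto
    next
      case False
      then have tt: "t * (1 - t) \<noteq> 0" by simp
      show ?thesis
      proof
        fix x assume "x \<in> closed_segment (L u t) (L v t)"
        then obtain s where s: "0 \<le> s" "s \<le> 1" and x: "x = (1 - s) *\<^sub>R L u t + s *\<^sub>R L v t"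
          by (auto simp: closed_segment_def)
        have Im_x: "Im (x $ i) = t * (1 - t) * (2 - real (\<pi> i))" for i
          by (simp add: x L_def algebra_simps)
        have "x $ i \<noteq> x $ j" if "i \<noteq> j" for i j
        proof
          assume "x $ i = x $ j"
          then have "t * (1 - t) * (2 - real (\<pi> i)) = t * (1 - t) * (2 - real (\<pi> j))"
            using Im_x by metis
          then show False using tt inj[OF that] by simp
        qed
        moreover have "Re (x $ i) > 0" for i
        proof -
          have "Re (x $ i) = (1 - s) * Re (track u (\<pi> i) t) + s * Re (track v (\<pi> i) t)"
            by (simp add: x L_def)
          moreover have "(1 - s) * Re (track u (\<pi> i) t) \<ge> 0" "s * Re (track v (\<pi> i) t) \<ge> 0"
            using s Re_pos[OF t] by (simp_all add: less_imp_le)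
          moreover have "(1 - s) * Re (track u (\<pi> i) t) > 0 \<or> s * Re (track v (\<pi> i) t) > 0"
            using s Re_pos[OF t] by (cases "s = 1") auto
          ultimately show ?thesis by linarith
        qed
        ultimately show "x \<in> Conf" unfolding Conf_def by blast
      qed
    qed
  qed
  then show "homotopic_paths Conf (word_path u \<pi>) (word_path v \<pi>)"
    using to_L[OF assms(1)] to_L[OF assms(2)] homotopic_paths_trans homotopic_paths_sym by blast
qed

definition above :: "word \<Rightarrow> nat \<Rightarrow> nat \<Rightarrow> bool" where
  "above w p q \<longleftrightarrow> (\<forall>t\<in>{0..1}. Re (track w p t) = Re (track w q t) \<longrightarrow>
     Im (track w p t) > Im (track w q t))"

lemma above_Nil: "p \<noteq> q \<Longrightarrow> above [] p q"
  by (simp add: above_def)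

text \<open>A positive generator puts the strand with the smaller position on top, so that q must not be the
  strand that passes over p in this letter.\<close>

lemma above_Cons:
  assumes "p \<in> {1, 2, 3}" "q \<in> {1, 2, 3}" "p \<noteq> q"
    and "p = gen_index g + 1 \<longrightarrow> q \<noteq> gen_index g"
    and "above w (next_pos (g, True) p) (next_pos (g, True) q)"
  shows "above ((g, True) # w) p q"
  unfolding above_def
proof (intro ballI impI)
  fix t :: real assume t: "t \<in> {0..1}"
    and eq: "Re (track ((g, True) # w) p t) = Re (track ((g, True) # w) q t)"
  show "Im (track ((g, True) # w) p t) > Im (track ((g, True) # w) q t)"
  proof (cases "t \<le> 1 / 2")
    case True
    then have track: "track ((g, True) # w) r t = strand_point (g, True) r (2 * t)" for r
      by (simp add: joinpaths_def)
    note meet = strands_meet[OF assms(1-3) _ eq[unfolded track]]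
    have "2 * t \<in> {0..1}" using t True by simp
    then have half: "2 * t = 1 / 2" and pq: "p = gen_index g" "q = gen_index g + 1"
      using meet assms(4) by auto
    show ?thesis unfolding track half pq using crossing_heights[of "(g, True)"] by simp
  next
    case False
    then have "track ((g, True) # w) r t = track w (next_pos (g, True) r) (2 * t - 1)" for r
      by (simp add: joinpaths_def)
    then show ?thesis using assms(5) eq t False unfolding above_def by simp
  qed
qed

text \<open>Both sides of the braid relation are positive permutation braids: each pair of strands crosses once.\<close>

lemma descending_braid_relation:
  "descending [(\<sigma>\<^sub>1, True), (\<sigma>\<^sub>2, True), (\<sigma>\<^sub>1, True)]"
  "descending [(\<sigma>\<^sub>2, True), (\<sigma>\<^sub>1, True), (\<sigma>\<^sub>2, True)]"
proof -
  have descending: "descending w" if "above w 1 2" "above w 1 3" "above w 2 3" for w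
    using that unfolding descending_def above_def by auto
  show "descending [(\<sigma>\<^sub>1, True), (\<sigma>\<^sub>2, True), (\<sigma>\<^sub>1, True)]"
    "descending [(\<sigma>\<^sub>2, True), (\<sigma>\<^sub>1, True), (\<sigma>\<^sub>2, True)]"
    by (rule descending; intro above_Cons above_Nil; simp add: next_pos_def)+
qed

lemma word_homotopic_braid_relation:
  "word_homotopic [(\<sigma>\<^sub>1, True), (\<sigma>\<^sub>2, True), (\<sigma>\<^sub>1, True)] [(\<sigma>\<^sub>2, True), (\<sigma>\<^sub>1, True), (\<sigma>\<^sub>2, True)]"
  by (rule descending_words_homotopic) (auto simp: descending_braid_relation next_pos_def)

section \<open>Braid equivalence\<close>

text \<open>Equality in the braid group, generated by the relations of its standard presentation. For three
  strands there are no commuting generators.\<close>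

inductive braid_eq :: "word \<Rightarrow> word \<Rightarrow> bool" where
  braid_eq_refl: "braid_eq u u"
| braid_eq_sym: "braid_eq u v \<Longrightarrow> braid_eq v u"
| braid_eq_trans [trans]: "braid_eq u v \<Longrightarrow> braid_eq v w \<Longrightarrow> braid_eq u w"
| append: "braid_eq u u' \<Longrightarrow> braid_eq v v' \<Longrightarrow> braid_eq (u @ v) (u' @ v')"
| cancel: "braid_eq [x, inv_letter x] []"
| relation: "braid_eq [(\<sigma>\<^sub>1, True), (\<sigma>\<^sub>2, True), (\<sigma>\<^sub>1, True)] [(\<sigma>\<^sub>2, True), (\<sigma>\<^sub>1, True), (\<sigma>\<^sub>2, True)]"

lemma braid_eq_imp_word_homotopic: "braid_eq u v \<Longrightarrow> word_homotopic u v"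
  by (induction rule: braid_eq.induct)
    (blast intro: word_homotopic_refl word_homotopic_sym word_homotopic_trans word_homotopic_append
      word_homotopic_cancel word_homotopic_braid_relation)+

lemma braid_eq_context: "braid_eq u v \<Longrightarrow> braid_eq (x @ u @ y) (x @ v @ y)"
  by (intro braid_eq.append braid_eq_refl)

lemma braid_eq_cancel_context: "braid_eq (u @ [x, inv_letter x] @ v) (u @ v)"
  using braid_eq_context[OF braid_eq.cancel] by simp

lemma braid_eq_right_inverse: "braid_eq (u @ inv_word u) []"
proof (induction u)
  case (Cons x u)
  have "braid_eq ([x] @ (u @ inv_word u) @ [inv_letter x]) ([x] @ [] @ [inv_letter x])"
    using Cons by (rule braid_eq_context)
  also have "braid_eq ([x] @ [] @ [inv_letter x]) []" using braid_eq.cancel by simp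
  finally show ?case by (simp add: inv_word_def)
qed (simp add: inv_word_def braid_eq_refl)

lemma braid_eq_inv_word:
  assumes "braid_eq u v"
  shows "braid_eq (inv_word u) (inv_word v)"
proof -
  have "braid_eq (inv_word u) (inv_word u @ (v @ inv_word v))"
    using braid_eq.append[OF braid_eq_refl braid_eq_sym[OF braid_eq_right_inverse[of v]], of "inv_word u"]
    by simp
  also have "braid_eq \<dots> (inv_word u @ u @ inv_word v)"
    by (rule braid_eq_context[OF braid_eq_sym[OF assms]])
  also have "braid_eq \<dots> ([] @ inv_word v)"
    using braid_eq.append[OF braid_eq_right_inverse[of "inv_word u"] braid_eq_refl, of "inv_word v"]
    by simp
  finally show ?thesis by simp
qed

lemma swap_letter_inv_letter: "swap_letter (inv_letter x) = inv_letter (swap_letter x)"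
  by (cases x rule: swap_letter.cases) (simp_all add: inv_letter_def)

lemma braid_eq_swap_word: "braid_eq u v \<Longrightarrow> braid_eq (swap_word u) (swap_word v)"
proof (induction rule: braid_eq.induct)
  case (append u u' v v')
  then show ?case by (simp add: swap_word_append braid_eq.append)
next
  case (cancel x)
  then show ?case
    using braid_eq.cancel[of "swap_letter x"] by (simp add: swap_word_def swap_letter_inv_letter)
next
  case relation
  then show ?case
    using braid_eq_sym[OF braid_eq_inv_word[OF braid_eq.relation]]
    by (simp add: swap_word_def inv_word_def inv_letter_def)
qed (blast intro: braid_eq_refl braid_eq_sym braid_eq_trans)+

section \<open>Words that braid moves turn into a product of two generators\<close>

text \<open>Words that conjugation and nontrivial words of the same braid lead to \<open>\<sigma>\<^sub>1\<^sup>\<plusminus>\<^sup>1 \<sigma>\<^sub>2\<^sup>\<plusminus>\<^sup>1\<close>. The condition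
  on u excludes the empty word, whose closure is empty in the present model.\<close>

inductive unknot_word :: "word \<Rightarrow> bool" where
  base: "unknot_word [(\<sigma>\<^sub>1, s\<^sub>1), (\<sigma>\<^sub>2, s\<^sub>2)]"
| rotate: "unknot_word (v @ u) \<Longrightarrow> unknot_word (u @ v)"
| braid: "braid_eq u v \<Longrightarrow> u \<noteq> [] \<Longrightarrow> unknot_word v \<Longrightarrow> unknot_word u"

lemma unknot_word_base': "unknot_word [(\<sigma>\<^sub>2, s\<^sub>2), (\<sigma>\<^sub>1, s\<^sub>1)]"
  using unknot_word.rotate[of "[(\<sigma>\<^sub>1, s\<^sub>1)]" "[(\<sigma>\<^sub>2, s\<^sub>2)]"] unknot_word.base by simp

lemma unknot_word_swap_word: "unknot_word w \<Longrightarrow> unknot_word (swap_word w)"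
proof (induction rule: unknot_word.induct)
  case (base s\<^sub>1 s\<^sub>2)
  then show ?case by (simp add: swap_word_def unknot_word_base')
next
  case (rotate v u)
  then show ?case by (simp add: swap_word_append unknot_word.rotate)
next
  case (braid u v)
  then show ?case
    using unknot_word.braid[OF braid_eq_swap_word] by (simp add: swap_word_def)
qed

lemma unknot_word_inv_word: "unknot_word w \<Longrightarrow> unknot_word (inv_word w)"
proof (induction rule: unknot_word.induct)
  case (base s\<^sub>1 s\<^sub>2)
  then show ?case by (simp add: inv_word_def inv_letter_def unknot_word_base')
next
  case (rotate v u)
  then show ?case by (simp add: inv_word_append unknot_word.rotate)
next
  case (braid u v)
  then show ?case
    using unknot_word.braid[OF braid_eq_inv_word] by (simp add: inv_word_def)
qed

lemma unknot_word_cyclic_eq: "cyclic_eq v w \<Longrightarrow> unknot_word v \<Longrightarrow> unknot_word w"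
  unfolding cyclic_eq_iff_append using unknot_word.rotate by blast

abbreviation half_twist :: word where
  "half_twist \<equiv> [(\<sigma>\<^sub>2, True), (\<sigma>\<^sub>1, True), (\<sigma>\<^sub>2, True)]"

text \<open>The half twist exchanges the two generators by conjugation, and the swap of a letter is the inverse of
  the exchanged one.\<close>

lemma half_twist_absorbs:
  assumes "x \<in> {letter_a, letter_b}"
  shows "braid_eq ([swap_letter x] @ half_twist @ [x]) half_twist"
proof -
  have cancel: "braid_eq (u @ [letter_a, (\<sigma>\<^sub>1, True)] @ v) (u @ v)"
    "braid_eq (u @ [(\<sigma>\<^sub>1, True), letter_a] @ v) (u @ v)" for u v
    using braid_eq_cancel_context[of u letter_a v] braid_eq_cancel_context[of u "(\<sigma>\<^sub>1, True)" v]
    by (simp_all add: inv_letter_def)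
  have rel: "braid_eq (u @ half_twist @ v) (u @ [(\<sigma>\<^sub>1, True), (\<sigma>\<^sub>2, True), (\<sigma>\<^sub>1, True)] @ v)" for u v
    by (rule braid_eq_context[OF braid_eq_sym[OF braid_eq.relation]])
  from assms consider "x = letter_a" | "x = letter_b" by auto
  then show ?thesis
  proof cases
    case 1
    then show ?thesis
      using braid_eq_trans[OF rel[of "[letter_b]" "[letter_a]", simplified]
          cancel(2)[of "[letter_b, (\<sigma>\<^sub>1, True), (\<sigma>\<^sub>2, True)]" "[]", simplified]] by simp
  next
    case 2
    then show ?thesis
      using braid_eq_trans[OF rel[of "[letter_a]" "[letter_b]", simplified]
          cancel(1)[of "[]" "[(\<sigma>\<^sub>2, True), (\<sigma>\<^sub>1, True), (\<sigma>\<^sub>2, True)]", simplified]] by simp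
  qed
qed

text \<open>The last letter of the dual of Y is the swap of the first letter of Y. Rotated to the front, it is
  absorbed together with that letter by the half twist between them, until only the centre is left.\<close>

lemma unknot_word_half_twist:
  assumes "set Y \<subseteq> {letter_a, letter_b}" "\<epsilon> \<in> {1, 3}"
  shows "unknot_word (half_twist @ Y @ replicate \<epsilon> letter_a @ dual_word Y)"
  using assms(1)
proof (induction Y)
  case Nil
  have cancel: "braid_eq (u @ [(\<sigma>\<^sub>1, True), letter_a] @ v) (u @ v)"
    "braid_eq (u @ [letter_a, (\<sigma>\<^sub>1, True)] @ v) (u @ v)" for u v
    using braid_eq_cancel_context[of u "(\<sigma>\<^sub>1, True)" v] braid_eq_cancel_context[of u letter_a v]
    by (simp_all add: inv_letter_def)
  have "braid_eq (half_twist @ [letter_a] @ v) ([(\<sigma>\<^sub>1, True), (\<sigma>\<^sub>2, True)] @ v)" for v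
    using braid_eq_trans[OF braid_eq_context[OF braid_eq_sym[OF braid_eq.relation], of "[]" "[letter_a] @ v", simplified]
        cancel(1)[of "[(\<sigma>\<^sub>1, True), (\<sigma>\<^sub>2, True)]" v, simplified]] by simp
  note twist = unknot_word.braid[OF this]
  from assms(2) consider "\<epsilon> = 1" | "\<epsilon> = 3" by auto
  then show ?case
  proof cases
    case 1
    then show ?thesis
      using twist[of "[]"] unknot_word.base by (simp add: dual_word_def swap_word_def)
  next
    case 2
    have "unknot_word [letter_a, letter_a, (\<sigma>\<^sub>1, True), letter_b]"
      using unknot_word.braid[OF cancel(2)[of "[letter_a]" "[letter_b]"]] unknot_word.base[of False True] by simp
    then have "unknot_word ([(\<sigma>\<^sub>1, True), letter_b] @ [letter_a, letter_a])"
      using unknot_word.rotate[of "[letter_a, letter_a]" "[(\<sigma>\<^sub>1, True), letter_b]"] by simp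
    then show ?thesis
      using 2 twist[of "[letter_a, letter_a]"]
      by (simp add: dual_word_def swap_word_def numeral_3_eq_3)
  qed
next
  case (Cons x Y)
  let ?M = "Y @ replicate \<epsilon> letter_a @ dual_word Y"
  have "x \<in> {letter_a, letter_b}" using Cons.prems by auto
  from braid_eq.append[OF half_twist_absorbs[OF this] braid_eq_refl]
  have eq: "braid_eq (([swap_letter x] @ half_twist @ [x]) @ ?M) (half_twist @ ?M)" .
  have "unknot_word (half_twist @ ?M)" using Cons by simp
  with unknot_word.braid[OF eq] have "unknot_word (([swap_letter x] @ half_twist @ [x]) @ ?M)" by simp
  then have "unknot_word ((half_twist @ [x] @ ?M) @ [swap_letter x])"
    using unknot_word.rotate[of "[swap_letter x]" "half_twist @ [x] @ ?M"] by simp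
  then show ?case by (simp add: dual_word_def swap_word_def)
qed

lemma unknot_word_classified:
  assumes "set W \<subseteq> {letter_a, letter_b}" "letter_b \<in> set W"
    and "trace2 (burau ((\<sigma>\<^sub>1, True) # W)) \<in> {1, 3}"
  shows "unknot_word ((\<sigma>\<^sub>1, True) # W)"
proof -
  have cancel: "braid_eq (u @ [(\<sigma>\<^sub>1, True), letter_a] @ v) (u @ v)"
    "braid_eq (u @ [letter_a, (\<sigma>\<^sub>1, True)] @ v) (u @ v)" for u v
    using braid_eq_cancel_context[of u "(\<sigma>\<^sub>1, True)" v] braid_eq_cancel_context[of u letter_a v]
    by (simp_all add: inv_letter_def)
  from trace_classification[OF assms] consider
    "W = [letter_b]" | "W = [letter_a, letter_a, letter_b]" | "W = [letter_a, letter_b, letter_a]"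
    | "W = [letter_b, letter_a, letter_a]"
    | Y \<epsilon> where "set Y \<subseteq> {letter_a, letter_b}" "\<epsilon> \<in> {1, 3}"
     "W = letter_b # Y @ replicate \<epsilon> letter_a @ dual_word Y @ [letter_b]"
    by blast
  then show ?thesis
  proof cases
    case 1
    then show ?thesis by (simp add: unknot_word.base)
  next
    case 2
    then show ?thesis
      using unknot_word.braid[OF cancel(1)[of "[]" "[letter_a, letter_b]"]] unknot_word.base[of False True] by simp
  next
    case 3
    then show ?thesis
      using unknot_word.braid[OF cancel(1)[of "[]" "[letter_b, letter_a]"]] unknot_word_base'[of True False] by simp
  next
    case 4
    have "unknot_word ([letter_a] @ [(\<sigma>\<^sub>1, True), letter_b, letter_a])"
      using unknot_word.braid[OF cancel(2)[of "[]" "[letter_b, letter_a]"]] unknot_word_base'[of True False] by simp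
    then show ?thesis using unknot_word.rotate[of "[letter_a]" "[(\<sigma>\<^sub>1, True), letter_b, letter_a]"] 4 by simp
  next
    case 5
    have "unknot_word ([letter_b] @ ([(\<sigma>\<^sub>1, True), letter_b] @ Y @ replicate \<epsilon> letter_a @ dual_word Y))"
      using unknot_word_half_twist[OF 5(1,2)] by simp
    from unknot_word.rotate[OF this] show ?thesis using 5(3) by simp
  qed
qed

section \<open>Closed braids as closures of paths\<close>

text \<open>The piecewise linear time change that gives the first half of a joined path the fraction
  \<open>1 / (n + 1)\<close> of the time.\<close>

definition two_speed :: "nat \<Rightarrow> real \<Rightarrow> real" where
  "two_speed n t = (if (real n + 1) * t \<le> 1 then (real n + 1) * t / 2
     else 1 / 2 + ((real n + 1) * t - 1) / (2 * real n))"

text \<open>The path of a word in which all letters take the same time, as in the definition of the closed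
  braid.\<close>

fun steady_path :: "word \<Rightarrow> (3 \<Rightarrow> nat) \<Rightarrow> real \<Rightarrow> complex ^ 3" where
  "steady_path [] \<pi> = linepath (config \<pi>) (config \<pi>)"
| "steady_path (x # w) \<pi> = (if w = [] then letter_path x \<pi>
     else (letter_path x \<pi> +++ steady_path w (next_pos x \<circ> \<pi>)) \<circ> two_speed (length w))"

lemma steady_path_sector:
  assumes "j < length w" "t \<in> {0..1}"
  shows "steady_path w \<pi> ((real j + t) / real (length w)) =
    letter_path (w ! j) (end_pos (take j w) \<circ> \<pi>) t"
  using assms(1)
proof (induction w arbitrary: j \<pi>)
  case (Cons x w)
  show ?case
  proof (cases "w = []")
    case True
    then show ?thesis using Cons.prems by simp
  next
    case False
    define m where "m = length w"
    have m: "m > 0" using False by (simp add: m_def)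
    have scale: "(real m + 1) * ((real j + t) / real (length (x # w))) = real j + t"
      by (simp add: m_def add.commute)
    have step: "steady_path (x # w) \<pi> \<tau> = (letter_path x \<pi> +++ steady_path w (next_pos x \<circ> \<pi>)) (two_speed m \<tau>)" for \<tau>
      using False by (simp add: m_def)
    show ?thesis
    proof (cases j)
      case 0
      then have speed: "two_speed m ((real j + t) / real (length (x # w))) = t / 2"
        using assms(2) unfolding two_speed_def scale by simp
      show ?thesis
        unfolding step speed using 0 assms(2) by (simp add: joinpaths_def)
    next
      case (Suc i)
      have i: "i < length w" using Cons.prems Suc by simp
      have IH: "steady_path w (next_pos x \<circ> \<pi>) ((real i + t) / real m) =
          letter_path ((x # w) ! j) (end_pos (take j (x # w)) \<circ> \<pi>) t"
        using Cons.IH[OF i, of "next_pos x \<circ> \<pi>"] Suc by (simp add: m_def comp_def)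
      have speed: "two_speed m ((real j + t) / real (length (x # w))) = 1 / 2 + (real i + t) / (2 * real m)"
      proof (cases "real i + t = 0")
        case True
        then show ?thesis using Suc unfolding two_speed_def scale by simp
      next
        case False
        then have "real i + t > 0" using assms(2) by simp
        then show ?thesis using Suc unfolding two_speed_def scale by simp
      qed
      have "steady_path (x # w) \<pi> ((real j + t) / real (length (x # w))) =
          (letter_path x \<pi> +++ steady_path w (next_pos x \<circ> \<pi>)) (1 / 2 + (real i + t) / (2 * real m))"
        unfolding step speed ..
      also have "\<dots> = steady_path w (next_pos x \<circ> \<pi>) ((real i + t) / real m)"
      proof (cases "real i + t = 0")
        case True
        then have "i = 0" "t = 0" using assms(2) by auto
        then show ?thesis using IH Suc by (simp add: joinpaths_def)
      next
        case False
        then have "(real i + t) / (2 * real m) > 0" using assms(2) m by simp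
        then have "\<not> 1 / 2 + (real i + t) / (2 * real m) \<le> 1 / 2" by linarith
        moreover have "2 * (1 / 2 + (real i + t) / (2 * real m)) - 1 = (real i + t) / real m"
          using m by (simp add: field_simps)
        ultimately show ?thesis unfolding joinpaths_def by (simp only: if_False)
      qed
      finally show ?thesis unfolding IH .
    qed
  qed
qed simp

lemma two_speed_props:
  assumes "n > 0"
  shows "continuous_on {0..1} (two_speed n)" "two_speed n \<in> {0..1} \<rightarrow> {0..1}"
    "two_speed n 0 = 0" "two_speed n 1 = 1"
proof -
  have "two_speed n = (\<lambda>t. min ((real n + 1) * t / 2) (1 / 2) + max 0 (((real n + 1) * t - 1) / (2 * real n)))"
  proof
    fix t
    show "two_speed n t = min ((real n + 1) * t / 2) (1 / 2) + max 0 (((real n + 1) * t - 1) / (2 * real n))"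
    proof (cases "(real n + 1) * t \<le> 1")
      case True
      then have "((real n + 1) * t - 1) / (2 * real n) \<le> 0" using assms by (simp add: divide_nonpos_pos)
      then show ?thesis using True by (simp add: two_speed_def)
    next
      case False
      then have "((real n + 1) * t - 1) / (2 * real n) > 0" using assms by simp
      then show ?thesis using False by (simp add: two_speed_def)
    qed
  qed
  then show "continuous_on {0..1} (two_speed n)"
    using assms by (auto intro!: continuous_intros)
  show "two_speed n \<in> {0..1} \<rightarrow> {0..1}"
  proof
    fix t :: real assume t: "t \<in> {0..1}"
    then have "real n * t \<le> real n" by (simp add: mult_left_le)
    moreover have "(real n + 1) * t = real n * t + t" by (simp add: distrib_right)
    ultimately have "(real n + 1) * t - 1 \<le> real n" using t by simp
    then have "((real n + 1) * t - 1) / (2 * real n) \<le> real n / (2 * real n)"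
      by (rule divide_right_mono) simp
    also have "\<dots> = 1 / 2" using assms by simp
    finally have q: "((real n + 1) * t - 1) / (2 * real n) \<le> 1 / 2" .
    show "two_speed n t \<in> {0..1}"
    proof (cases "(real n + 1) * t \<le> 1")
      case True
      then have "two_speed n t = (real n + 1) * t / 2" by (simp add: two_speed_def)
      moreover have "(real n + 1) * t \<ge> 0" using t by simp
      ultimately show ?thesis using True by (simp only: atLeastAtMost_iff) linarith
    next
      case False
      then have "two_speed n t = 1 / 2 + ((real n + 1) * t - 1) / (2 * real n)"
        by (simp add: two_speed_def)
      moreover have "((real n + 1) * t - 1) / (2 * real n) \<ge> 0" using False by simp
      ultimately show ?thesis using q by (simp only: atLeastAtMost_iff) linarith
    qed
  qed
  show "two_speed n 0 = 0" "two_speed n 1 = 1" using assms by (simp_all add: two_speed_def)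
qed

lemma steady_path_homotopic_word_path:
  "w \<noteq> [] \<Longrightarrow> labelling \<pi> \<Longrightarrow> homotopic_paths Conf (steady_path w \<pi>) (word_path w \<pi>)"
proof (induction w arbitrary: \<pi>)
  case (Cons x w)
  define \<rho> where "\<rho> = next_pos x \<circ> \<pi>"
  have \<rho>: "labelling \<rho>" unfolding \<rho>_def using Cons.prems by (simp only: labelling_next_pos)
  have lp: "homotopic_paths Conf (letter_path x \<pi>) (letter_path x \<pi>)"
    using Cons.prems by (simp add: path_image_letter_path)
  show ?case
  proof (cases "w = []")
    case True
    have "homotopic_paths Conf (letter_path x \<pi> +++ linepath (config \<rho>) (config \<rho>)) (letter_path x \<pi>)"
      using Cons.prems by (intro homotopic_paths_rid') (simp_all add: path_image_letter_path \<rho>_def)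
    then have "homotopic_paths Conf (word_path (x # w) \<pi>) (steady_path (x # w) \<pi>)"
      by (simp add: True \<rho>_def)
    then show ?thesis by (rule homotopic_paths_sym)
  next
    case False
    note IH = Cons.IH[OF False \<rho>]
    have start: "pathfinish (letter_path x \<pi>) = pathstart (steady_path w \<rho>)"
      using homotopic_paths_imp_pathstart[OF IH] by (simp add: \<rho>_def comp_def)
    have J: "homotopic_paths Conf (letter_path x \<pi> +++ steady_path w \<rho>) (letter_path x \<pi> +++ word_path w \<rho>)"
      by (rule homotopic_paths_join[OF lp IH start])
    have "homotopic_paths Conf (letter_path x \<pi> +++ steady_path w \<rho>)
      ((letter_path x \<pi> +++ steady_path w \<rho>) \<circ> two_speed (length w))"
      using homotopic_paths_imp_path[OF J] homotopic_paths_imp_subset[OF J] two_speed_props[of "length w"] False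
      by (intro homotopic_paths_reparametrize[of _ _ "two_speed (length w)"]) auto
    from homotopic_paths_trans[OF homotopic_paths_sym[OF this] J]
    show ?thesis using False by (simp add: \<rho>_def comp_def)
  qed
qed simp

lemma path_closure_cong:
  "(\<And>t. t \<in> {0..1} \<Longrightarrow> c t = d t) \<Longrightarrow> path_closure c = path_closure d"
  unfolding path_closure_def by (intro image_cong) auto

lemma braid_closure_eq_pages:
  "braid_closure w = {page ((real j + t) / real (length w)) (strand_point (w ! j) p t) | j p t.
     j < length w \<and> p \<in> {1, 2, 3} \<and> t \<in> {0..1}}"
  unfolding braid_closure_def page_def strand_point_def by simp

lemma path_closure_steady_path:
  assumes "w \<noteq> []" "labelling \<pi>"
  shows "path_closure (steady_path w \<pi>) = braid_closure w"
proof -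
  let ?n = "length w"
  have n: "?n > 0" using assms(1) by simp
  have lab: "labelling (end_pos (take j w) \<circ> \<pi>)" for j by (rule labelling_end_pos[OF assms(2)])
  have "x \<in> braid_closure w" if x_in: "x \<in> path_closure (steady_path w \<pi>)" for x
  proof -
    from x_in obtain \<tau> i where \<tau>: "\<tau> \<in> {0..1::real}" and x: "x = page \<tau> (steady_path w \<pi> \<tau> $ i)"
      by (auto simp: path_closure_def)
    obtain j t where jt: "j < ?n" "t \<in> {0..1}" "\<tau> = (real j + t) / real ?n"
    proof (cases "\<tau> = 1")
      case True
      obtain m where "?n = Suc m" using n gr0_conv_Suc by blast
      with True show ?thesis using that[of m 1] by simp
    next
      case False
      define j where "j = nat \<lfloor>\<tau> * real ?n\<rfloor>"
      have pos: "\<tau> * real ?n \<ge> 0" using \<tau> by simp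
      have "\<tau> * real ?n < real ?n" using \<tau> False n by simp
      moreover have "real j \<le> \<tau> * real ?n" "\<tau> * real ?n < real j + 1"
        using pos unfolding j_def by linarith+
      ultimately show ?thesis
        using that[of j "\<tau> * real ?n - real j"] n by auto
    qed
    have "(end_pos (take j w) \<circ> \<pi>) i \<in> {1, 2, 3}"
      using lab[of j] unfolding labelling_def bij_betw_def by blast
    moreover have "x = page ((real j + t) / real ?n) (strand_point (w ! j) ((end_pos (take j w) \<circ> \<pi>) i) t)"
      unfolding x jt(3) steady_path_sector[OF jt(1,2)] by (simp add: letter_path_def)
    ultimately show ?thesis
      unfolding braid_closure_eq_pages using jt(1,2) by blast
  qed
  moreover have "x \<in> path_closure (steady_path w \<pi>)" if x_in: "x \<in> braid_closure w" for x
  proof -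
    from x_in obtain j p t where jt: "j < ?n" "t \<in> {0..1}" and p: "p \<in> {1, 2, 3}"
      and x: "x = page ((real j + t) / real ?n) (strand_point (w ! j) p t)"
      unfolding braid_closure_eq_pages by blast
    obtain i where i: "p = (end_pos (take j w) \<circ> \<pi>) i"
      using lab[of j] p unfolding labelling_def bij_betw_def by blast
    have "x = page ((real j + t) / real ?n) (steady_path w \<pi> ((real j + t) / real ?n) $ i)"
      unfolding x i steady_path_sector[OF jt] by (simp add: letter_path_def)
    moreover have "(real j + t) / real ?n \<in> {0..1}"
    proof -
      have "real j + 1 \<le> real ?n" using jt(1) by linarith
      then show ?thesis using jt n by (auto simp: divide_simps)
    qed
    ultimately show ?thesis
      unfolding path_closure_def by (intro rev_image_eqI[of "((real j + t) / real ?n, i)"]) auto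
  qed
  ultimately show ?thesis by blast
qed

text \<open>The homotopy fixes the ends, so that the permutation of the end points is constant.\<close>

lemma path_closure_homotopic_paths:
  assumes "homotopic_paths Conf c d" "bij \<sigma>" "\<And>i. c 1 $ i = c 0 $ \<sigma> i"
  shows "ambient_isotopic (path_closure c) (path_closure d)"
proof -
  obtain h where h: "continuous_on ({0..1} \<times> {0..1}) h" "h \<in> ({0..1} \<times> {0..1}) \<rightarrow> Conf"
    "\<And>t. t \<in> {0..1} \<Longrightarrow> h (0, t) = c t" "\<And>t. t \<in> {0..1} \<Longrightarrow> h (1, t) = d t"
    "\<And>s. s \<in> {0..1::real} \<Longrightarrow> pathstart (h \<circ> Pair s) = pathstart c \<and> pathfinish (h \<circ> Pair s) = pathfinish c"
    using assms(1) unfolding homotopic_paths by metis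
  have "ambient_isotopic (path_closure (\<lambda>t. h (0, t))) (path_closure (\<lambda>t. h (1, t)))"
  proof (rule path_closure_homotopy[of "\<lambda>s t. h (s, t)" \<sigma>])
    show "continuous_on ({0..1} \<times> {0..1}) (\<lambda>(s, t). h (s, t))" using h(1) by simp
    show "h (s, t) \<in> Conf" if "s \<in> {0..1}" "t \<in> {0..1}" for s t
      using h(2) that by auto
    show "h (s, 1) $ i = h (s, 0) $ \<sigma> i" if "s \<in> {0..1}" for s i
      using h(5)[OF that] assms(3) by (simp add: pathstart_def pathfinish_def)
  qed (rule assms(2))
  also have "path_closure (\<lambda>t. h (0, t)) = path_closure c"
    by (rule path_closure_cong) (rule h(3))
  also have "path_closure (\<lambda>t. h (1, t)) = path_closure d"
    by (rule path_closure_cong) (rule h(4))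
  finally show ?thesis .
qed

text \<open>The permutation of the strands of a word, transported from the positions to the names of the strands.\<close>

lemma labelling_monodromy:
  assumes "labelling \<pi>"
  obtains \<sigma> where "bij \<sigma>" "\<And>i. end_pos w (\<pi> i) = \<pi> (\<sigma> i)"
proof -
  define \<sigma> where "\<sigma> = the_inv_into UNIV \<pi> \<circ> (end_pos w \<circ> \<pi>)"
  have "bij_betw (end_pos w \<circ> \<pi>) UNIV {1, 2, 3}"
    using labelling_end_pos[OF assms] by (simp add: labelling_def)
  moreover have "bij_betw (the_inv_into UNIV \<pi>) {1, 2, 3} UNIV"
    using assms unfolding labelling_def by (rule bij_betw_the_inv_into)
  ultimately have "bij \<sigma>" unfolding \<sigma>_def by (rule bij_betw_trans)
  moreover have "end_pos w (\<pi> i) = \<pi> (\<sigma> i)" for i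
  proof -
    have "end_pos w (\<pi> i) \<in> \<pi> ` UNIV"
      using labelling_end_pos[OF assms, of w] assms unfolding labelling_def bij_betw_def by auto
    then show ?thesis
      using assms unfolding \<sigma>_def labelling_def bij_betw_def by (simp add: f_the_inv_into_f)
  qed
  ultimately show ?thesis by (rule that)
qed

definition standard_labelling :: "3 \<Rightarrow> nat" where
  "standard_labelling i = (if i = 1 then 1 else if i = 2 then 2 else 3)"

lemma labelling_standard: "labelling standard_labelling"
proof -
  have "inj standard_labelling"
    unfolding inj_def forall_3 by (simp add: standard_labelling_def)
  moreover have "range standard_labelling = {1, 2, 3}"
    unfolding UNIV_3 by (auto simp: standard_labelling_def)
  ultimately show ?thesis by (simp add: labelling_def bij_betw_def)
qed

theorem braid_eq_closure_isotopic:
  assumes "braid_eq u v" "u \<noteq> []" "v \<noteq> []"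
  shows "ambient_isotopic (braid_closure u) (braid_closure v)"
proof -
  let ?\<pi> = standard_labelling
  note \<pi> = labelling_standard
  have su: "homotopic_paths Conf (steady_path u ?\<pi>) (word_path u ?\<pi>)"
    and sv: "homotopic_paths Conf (steady_path v ?\<pi>) (word_path v ?\<pi>)"
    using steady_path_homotopic_word_path \<pi> assms(2,3) by blast+
  have "homotopic_paths Conf (word_path u ?\<pi>) (word_path v ?\<pi>)"
    using braid_eq_imp_word_homotopic[OF assms(1)] \<pi> by (simp add: word_homotopic_def)
  then have hom: "homotopic_paths Conf (steady_path u ?\<pi>) (steady_path v ?\<pi>)"
    using su sv homotopic_paths_trans homotopic_paths_sym by blast
  have ends: "steady_path u ?\<pi> 0 = config ?\<pi>" "steady_path u ?\<pi> 1 = config (end_pos u \<circ> ?\<pi>)"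
    using homotopic_paths_imp_pathstart[OF su] homotopic_paths_imp_pathfinish[OF su]
    by (simp_all add: pathstart_def[of "steady_path u ?\<pi>"] pathfinish_def[of "steady_path u ?\<pi>"])
  obtain \<sigma> where \<sigma>: "bij \<sigma>" "\<And>i. end_pos u (?\<pi> i) = ?\<pi> (\<sigma> i)"
    using labelling_monodromy[OF \<pi>] by metis
  have "ambient_isotopic (path_closure (steady_path u ?\<pi>)) (path_closure (steady_path v ?\<pi>))"
    using hom \<sigma>(1) by (rule path_closure_homotopic_paths) (simp add: ends config_def \<sigma>(2))
  then show ?thesis by (simp add: path_closure_steady_path assms(2,3) \<pi>)
qed

section \<open>Rotation about the axis\<close>

lemma ambient_isotopic_rotate_axis:
  "ambient_isotopic K ((\<lambda>x. (fst x * cis \<alpha>, snd x)) ` K)" for K :: "space3 set"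
  unfolding ambient_isotopic_def
proof (intro exI[of _ "\<lambda>t x. (fst x * cis (t * \<alpha>), snd x)"] conjI ballI allI)
  show "continuous_on ({0..1} \<times> UNIV) (\<lambda>(t, x :: space3). (fst x * cis (t * \<alpha>), snd x))"
    unfolding case_prod_unfold by (intro continuous_intros)
  show "\<exists>G. homeomorphism UNIV UNIV (\<lambda>x :: space3. (fst x * cis (t * \<alpha>), snd x)) G" for t
  proof (intro exI[of _ "\<lambda>x. (fst x * cis (- (t * \<alpha>)), snd x)"] homeomorphismI)
    show "continuous_on UNIV (\<lambda>x :: space3. (fst x * cis (t * \<alpha>), snd x))"
      "continuous_on UNIV (\<lambda>x :: space3. (fst x * cis (- (t * \<alpha>)), snd x))"
      by (intro continuous_intros)+
  qed (auto simp: cis_mult mult.assoc)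
qed auto

lemma page_rotate: "(fst (page t \<zeta>) * cis (2 * pi * s), snd (page t \<zeta>)) = page (t + s) \<zeta>"
  by (simp add: page_def cis_mult distrib_left mult.assoc)

lemma page_periodic: "page (t + 1) \<zeta> = page t \<zeta>" "page (t - 1) \<zeta> = page t \<zeta>"
proof -
  have "cis (2 * pi * (t + 1)) = cis (2 * pi * t)" for t
    by (simp add: distrib_left flip: cis_mult)
  from this[of t] this[of "t - 1"] show "page (t + 1) \<zeta> = page t \<zeta>" "page (t - 1) \<zeta> = page t \<zeta>"
    by (simp_all add: page_def)
qed

text \<open>The sectors of a cyclically permuted word are the sectors of the word, turned by a fixed angle.\<close>

lemma braid_closure_rotate_subset:
  "(\<lambda>x. (fst x * cis (2 * pi * (- real (length u) / real (length (u @ v)))), snd x)) ` braid_closure (u @ v)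
    \<subseteq> braid_closure (v @ u)"
proof
  let ?n = "real (length (u @ v))" and ?k = "length u"
  fix y assume "y \<in> (\<lambda>x. (fst x * cis (2 * pi * (- real ?k / ?n)), snd x)) ` braid_closure (u @ v)"
  then obtain j p t where j: "j < length (u @ v)" and p: "p \<in> {1, 2, 3}" and t: "t \<in> {0..1::real}"
    and y: "y = page ((real j + t) / ?n + - real ?k / ?n) (strand_point ((u @ v) ! j) p t)"
    unfolding braid_closure_eq_pages page_rotate[symmetric] by blast
  have n: "?n > 0" using j by linarith
  have len: "length (v @ u) = length (u @ v)" by simp
  show "y \<in> braid_closure (v @ u)"
  proof (cases "j < ?k")
    case True
    then have "(u @ v) ! j = (v @ u) ! (j + length v)" by (simp add: nth_append)
    moreover have "- real ?k / ?n = real (length v) / ?n - 1"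
    proof -
      have "real (length v) / ?n - 1 = (real (length v) - ?n) / ?n"
        using n by (simp only: diff_divide_distrib divide_self)
      then show ?thesis by simp
    qed
    then have "(real j + t) / ?n + - real ?k / ?n = (real (j + length v) + t) / ?n - 1"
      by (simp only: add_divide_distrib of_nat_add)
    then have "page ((real j + t) / ?n + - real ?k / ?n) \<zeta> = page ((real (j + length v) + t) / ?n) \<zeta>" for \<zeta>
      by (simp only: page_periodic)
    ultimately have "y = page ((real (j + length v) + t) / ?n) (strand_point ((v @ u) ! (j + length v)) p t)"
      unfolding y by simp
    moreover have "j + length v < length (v @ u)" using True by simp
    ultimately show ?thesis unfolding braid_closure_eq_pages len using p t by blast
  next
    case False
    then have "j - ?k < length v" using j by auto
    then have "(u @ v) ! j = (v @ u) ! (j - ?k)" using False by (simp add: nth_append)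
    moreover have "(real j + t) / ?n + - real ?k / ?n = (real (j - ?k) + t) / ?n"
      using n False by (simp add: of_nat_diff diff_divide_distrib add_divide_distrib)
    ultimately have "y = page ((real (j - ?k) + t) / ?n) (strand_point ((v @ u) ! (j - ?k)) p t)"
      unfolding y by simp
    moreover have "j - ?k < length (v @ u)" using j by simp
    ultimately show ?thesis unfolding braid_closure_eq_pages len using p t by blast
  qed
qed

lemma braid_closure_rotate: "ambient_isotopic (braid_closure (u @ v)) (braid_closure (v @ u))"
proof (cases "u @ v = []")
  case True
  then show ?thesis by (simp add: ambient_isotopic_refl)
next
  case False
  define R where "R s x = (fst x * cis (2 * pi * s), snd x)" for s :: real and x :: space3
  let ?n = "real (length (u @ v))"
  have n: "?n > 0" using False by (simp only: of_nat_0_less_iff length_greater_0_conv) simp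
  have sub: "R (- real (length u) / ?n) ` braid_closure (u @ v) \<subseteq> braid_closure (v @ u)"
    unfolding R_def by (rule braid_closure_rotate_subset)
  have sub': "R (- real (length v) / ?n) ` braid_closure (v @ u) \<subseteq> braid_closure (u @ v)"
    using braid_closure_rotate_subset[of v u] unfolding R_def by (simp add: add.commute)
  have "(real (length u) + real (length v)) / ?n = 1" using n by simp
  then have one: "- real (length u) / ?n + - real (length v) / ?n = - 1"
    unfolding add_divide_distrib by linarith
  have R_add: "R s (R s' x) = R (s + s') x" for s s' x
    by (simp add: R_def mult.assoc cis_mult distrib_left add.commute)
  have "R (- real (length u) / ?n) (R (- real (length v) / ?n) x) = x" for x
    unfolding R_add one using cis_multiple_2pi[of "-1"] by (simp add: R_def)
  then have "R (- real (length u) / ?n) ` (R (- real (length v) / ?n) ` braid_closure (v @ u)) = braid_closure (v @ u)"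
    by (simp add: image_image)
  with sub sub' have "R (- real (length u) / ?n) ` braid_closure (u @ v) = braid_closure (v @ u)"
    by blast
  then show ?thesis
    using ambient_isotopic_rotate_axis[of "braid_closure (u @ v)" "2 * pi * (- real (length u) / ?n)"]
    unfolding R_def by simp
qed

lemma is_unknot_isotopic: "ambient_isotopic K L \<Longrightarrow> is_unknot L \<Longrightarrow> is_unknot K"
  unfolding is_unknot_def by (rule ambient_isotopic_trans)

section \<open>The closure of a product of two generators\<close>

text \<open>The open half planes on both sides of the imaginary axis and the two open halves of this axis are
  convex and do not contain 0.\<close>

lemma segment_avoids_zero:
  fixes x y :: complex
  assumes "Re x * Re y > 0 \<or> (Re x = 0 \<and> Re y = 0 \<and> Im x * Im y > 0)" "s \<in> {0..1}"
  shows "(1 - s) *\<^sub>R x + s *\<^sub>R y \<noteq> 0"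
proof -
  have real: "(1 - s) * a + s * b \<noteq> 0" if "a * b > 0" for a b :: real
  proof -
    from that consider "a > 0" "b > 0" | "a < 0" "b < 0" by (auto simp: zero_less_mult_iff)
    then show ?thesis
    proof cases
      case 1
      then have "(1 - s) * a \<ge> 0" "s * b \<ge> 0" "(1 - s) * a > 0 \<or> s * b > 0"
        using assms(2) by (auto simp: zero_less_mult_iff)
      then show ?thesis by linarith
    next
      case 2
      then have "(1 - s) * a \<le> 0" "s * b \<le> 0" "(1 - s) * a < 0 \<or> s * b < 0"
        using assms(2) by (auto simp: mult_less_0_iff mult_le_0_iff)
      then show ?thesis by linarith
    qed
  qed
  show ?thesis
    using real[of "Re x" "Re y"] real[of "Im x" "Im y"] assms(1) by (auto simp: complex_eq_iff)
qed

lemma sgn_sin: "\<bar>x\<bar> < pi \<Longrightarrow> sgn (sin x) = sgn x"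
  using sin_gt_zero[of x] sin_gt_zero[of "- x"] by (cases x "0::real" rule: linorder_cases) auto

definition sign_of :: "bool \<Rightarrow> real" where
  "sign_of b = (if b then 1 else -1)"

text \<open>The linear function with the values \<open>- sign_of b\<^sub>1\<close> at -1/2 and \<open>- sign_of b\<^sub>2\<close> at 1/2, the values of
  the cosine at the two crossings.\<close>

definition slope :: "bool \<Rightarrow> bool \<Rightarrow> real \<Rightarrow> real" where
  "slope b\<^sub>1 b\<^sub>2 c = - (sign_of b\<^sub>1 + sign_of b\<^sub>2) / 2 - (sign_of b\<^sub>2 - sign_of b\<^sub>1) * c"

definition height :: "bool \<Rightarrow> bool \<Rightarrow> real \<Rightarrow> real" where
  "height b\<^sub>1 b\<^sub>2 a = sin a * slope b\<^sub>1 b\<^sub>2 (cos a)"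

text \<open>The three strands are pieces of one closed curve which winds three times around the axis, parametrised
  by an angle. The offsets let strand 1 cross strand 2 at time 1/4 and strand 3 at time 3/4.\<close>

definition phase :: "3 \<Rightarrow> real \<Rightarrow> real" where
  "phase i t = 2 * pi / 3 * (t - 5 / 4 + (if i = 1 then 0 else if i = 2 then 2 else 1))"

text \<open>A trigonometric model of the braid \<open>\<sigma>\<^sub>1\<^sup>\<plusminus>\<^sup>1 \<sigma>\<^sub>2\<^sup>\<plusminus>\<^sup>1\<close>, where \<open>b\<^sub>1\<close> and \<open>b\<^sub>2\<close> are the signs.\<close>

definition trig_braid :: "bool \<Rightarrow> bool \<Rightarrow> real \<Rightarrow> complex ^ 3" where
  "trig_braid b\<^sub>1 b\<^sub>2 t = (\<chi> i. Complex (2 + cos (phase i t)) (height b\<^sub>1 b\<^sub>2 (phase i t)))"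

lemma height_bound: "\<bar>height b\<^sub>1 b\<^sub>2 a\<bar> \<le> 1"
proof -
  have "height b\<^sub>1 b\<^sub>2 a \<in> {sin a, - sin a, sin (2 * a), - sin (2 * a)}"
    by (auto simp: height_def slope_def sign_of_def sin_double)
  then show ?thesis by (auto simp: abs_sin_le_one)
qed

text \<open>The right-hand sides come from the sum-to-product formula. They show that the differences vanish
  only at the times 1/4 and 3/4, since the arguments of the sine stay between \<open>- \<pi>\<close> and \<open>\<pi>\<close>.\<close>

lemma trig_braid_differences:
  "Re (trig_braid b\<^sub>1 b\<^sub>2 t $ 1) - Re (trig_braid b\<^sub>1 b\<^sub>2 t $ 2) = sqrt 3 * sin (2 * pi / 3 * (t - 1 / 4))"
  "Re (trig_braid b\<^sub>1 b\<^sub>2 t $ 1) - Re (trig_braid b\<^sub>1 b\<^sub>2 t $ 3) = sqrt 3 * sin (2 * pi / 3 * (t - 3 / 4))"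
  "Re (trig_braid b\<^sub>1 b\<^sub>2 t $ 3) - Re (trig_braid b\<^sub>1 b\<^sub>2 t $ 2) = sqrt 3 * sin (2 * pi / 3 * (3 / 2 - (t + 1 / 4)))"
proof -
  have s: "sin (2 * pi / 3) = sqrt 3 / 2"
    using sin_pi_minus[of "pi / 3"] sin_60 by (simp add: field_simps)
  have diff: "cos (phase i t) - cos (phase j t) = 2 * sin ((phase i t + phase j t) / 2) * sin ((phase j t - phase i t) / 2)"
    for i j by (rule cos_diff_cos)
  have 1: "(phase 1 t + phase 2 t) / 2 = 2 * pi / 3 * (t - 1 / 4)" "(phase 2 t - phase 1 t) / 2 = 2 * pi / 3"
    "(phase 1 t + phase 3 t) / 2 = 2 * pi / 3 * (t - 3 / 4)" "(phase 3 t - phase 1 t) / 2 = pi / 3"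
    "(phase 3 t + phase 2 t) / 2 = pi - 2 * pi / 3 * (3 / 2 - (t + 1 / 4))" "(phase 2 t - phase 3 t) / 2 = pi / 3"
    by (simp_all add: phase_def field_simps)
  show "Re (trig_braid b\<^sub>1 b\<^sub>2 t $ 1) - Re (trig_braid b\<^sub>1 b\<^sub>2 t $ 2) = sqrt 3 * sin (2 * pi / 3 * (t - 1 / 4))"
    using diff[of 1 2] unfolding 1 s by (simp add: trig_braid_def)
  show "Re (trig_braid b\<^sub>1 b\<^sub>2 t $ 1) - Re (trig_braid b\<^sub>1 b\<^sub>2 t $ 3) = sqrt 3 * sin (2 * pi / 3 * (t - 3 / 4))"
    using diff[of 1 3] unfolding 1 sin_60 by (simp add: trig_braid_def)
  show "Re (trig_braid b\<^sub>1 b\<^sub>2 t $ 3) - Re (trig_braid b\<^sub>1 b\<^sub>2 t $ 2) = sqrt 3 * sin (2 * pi / 3 * (3 / 2 - (t + 1 / 4)))"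
    using diff[of 3 2] unfolding 1 sin_60 sin_pi_minus by (simp add: trig_braid_def)
qed

lemma trig_braid_heights:
  "Im (trig_braid b\<^sub>1 b\<^sub>2 (1 / 4) $ 1) - Im (trig_braid b\<^sub>1 b\<^sub>2 (1 / 4) $ 2) = sqrt 3 * sign_of b\<^sub>1"
  "Im (trig_braid b\<^sub>1 b\<^sub>2 (3 / 4) $ 1) - Im (trig_braid b\<^sub>1 b\<^sub>2 (3 / 4) $ 3) = sqrt 3 * sign_of b\<^sub>2"
proof -
  have p: "phase 1 (1 / 4) = - (2 * pi / 3)" "phase 2 (1 / 4) = 2 * pi / 3"
    "phase 1 (3 / 4) = - (pi / 3)" "phase 3 (3 / 4) = pi / 3"
    by (simp_all add: phase_def)
  have sc: "sin (2 * pi / 3) = sqrt 3 / 2" "cos (2 * pi / 3) = - 1 / 2"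
    using sin_pi_minus[of "pi / 3"] cos_pi_minus[of "pi / 3"] sin_60 cos_60 by (simp_all add: field_simps)
  have odd: "height b\<^sub>1 b\<^sub>2 (- x) = - height b\<^sub>1 b\<^sub>2 x" for x
    by (simp add: height_def)
  have "slope b\<^sub>1 b\<^sub>2 (- 1 / 2) = - sign_of b\<^sub>1" "slope b\<^sub>1 b\<^sub>2 (1 / 2) = - sign_of b\<^sub>2"
    unfolding slope_def by (simp_all add: field_simps)
  then have h: "height b\<^sub>1 b\<^sub>2 (2 * pi / 3) = - (sqrt 3 / 2 * sign_of b\<^sub>1)"
    "height b\<^sub>1 b\<^sub>2 (pi / 3) = - (sqrt 3 / 2 * sign_of b\<^sub>2)"
    unfolding height_def sc sin_60 cos_60 by simp_all
  have Im: "Im (trig_braid b\<^sub>1 b\<^sub>2 t $ i) = height b\<^sub>1 b\<^sub>2 (phase i t)" for t i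
    by (simp add: trig_braid_def)
  show "Im (trig_braid b\<^sub>1 b\<^sub>2 (1 / 4) $ 1) - Im (trig_braid b\<^sub>1 b\<^sub>2 (1 / 4) $ 2) = sqrt 3 * sign_of b\<^sub>1"
    unfolding Im p odd h by linarith
  show "Im (trig_braid b\<^sub>1 b\<^sub>2 (3 / 4) $ 1) - Im (trig_braid b\<^sub>1 b\<^sub>2 (3 / 4) $ 3) = sqrt 3 * sign_of b\<^sub>2"
    unfolding Im p odd h by linarith
qed

lemma steady_two_letters:
  assumes "t \<in> {0..1}"
  shows "t \<le> 1 / 2 \<Longrightarrow> steady_path [x, y] \<pi> t = letter_path x \<pi> (2 * t)"
    and "t \<ge> 1 / 2 \<Longrightarrow> steady_path [x, y] \<pi> t = letter_path y (next_pos x \<circ> \<pi>) (2 * t - 1)"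
proof -
  show "steady_path [x, y] \<pi> t = letter_path x \<pi> (2 * t)" if "t \<le> 1 / 2"
    using steady_path_sector[of 0 "[x, y]" "2 * t" \<pi>] that assms by simp
  show "steady_path [x, y] \<pi> t = letter_path y (next_pos x \<circ> \<pi>) (2 * t - 1)" if "t \<ge> 1 / 2"
    using steady_path_sector[of 1 "[x, y]" "2 * t - 1" \<pi>] that assms by simp
qed

lemma standard_labelling_simps [simp]:
  "standard_labelling 1 = 1" "standard_labelling 2 = 2" "standard_labelling 3 = 3"
  by (simp_all add: standard_labelling_def)

abbreviation two_letter_path where "two_letter_path b\<^sub>1 b\<^sub>2 \<equiv> steady_path [(\<sigma>\<^sub>1, b\<^sub>1), (\<sigma>\<^sub>2, b\<^sub>2)] standard_labelling"

lemma steady_differences: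
  assumes "t \<in> {0..1}"
  shows "Re (two_letter_path b\<^sub>1 b\<^sub>2 t $ 1) - Re (two_letter_path b\<^sub>1 b\<^sub>2 t $ 2) = (if t \<le> 1 / 2 then 4 * t - 1 else 2 * t)"
    and "Re (two_letter_path b\<^sub>1 b\<^sub>2 t $ 1) - Re (two_letter_path b\<^sub>1 b\<^sub>2 t $ 3) = (if t \<le> 1 / 2 then 2 * t - 2 else 4 * t - 3)"
    and "Re (two_letter_path b\<^sub>1 b\<^sub>2 t $ 3) - Re (two_letter_path b\<^sub>1 b\<^sub>2 t $ 2) = (if t \<le> 1 / 2 then 1 + 2 * t else 3 - 2 * t)"
    and "t = 1 / 4 \<Longrightarrow> Im (two_letter_path b\<^sub>1 b\<^sub>2 t $ 1) - Im (two_letter_path b\<^sub>1 b\<^sub>2 t $ 2) = sign_of b\<^sub>1 / 2"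
    and "t = 3 / 4 \<Longrightarrow> Im (two_letter_path b\<^sub>1 b\<^sub>2 t $ 1) - Im (two_letter_path b\<^sub>1 b\<^sub>2 t $ 3) = sign_of b\<^sub>2 / 2"
proof -
  note [simp] = letter_path_def strand_point_def strand_def Let_def next_pos_def sign_of_def
  have "Re (two_letter_path b\<^sub>1 b\<^sub>2 t $ 1) - Re (two_letter_path b\<^sub>1 b\<^sub>2 t $ 2) = 4 * t - 1 \<and>
      Re (two_letter_path b\<^sub>1 b\<^sub>2 t $ 1) - Re (two_letter_path b\<^sub>1 b\<^sub>2 t $ 3) = 2 * t - 2 \<and>
      Re (two_letter_path b\<^sub>1 b\<^sub>2 t $ 3) - Re (two_letter_path b\<^sub>1 b\<^sub>2 t $ 2) = 1 + 2 * t" if "t \<le> 1 / 2"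
    unfolding steady_two_letters(1)[OF assms that] by simp
  moreover have "Re (two_letter_path b\<^sub>1 b\<^sub>2 t $ 1) - Re (two_letter_path b\<^sub>1 b\<^sub>2 t $ 2) = 2 * t \<and>
      Re (two_letter_path b\<^sub>1 b\<^sub>2 t $ 1) - Re (two_letter_path b\<^sub>1 b\<^sub>2 t $ 3) = 4 * t - 3 \<and>
      Re (two_letter_path b\<^sub>1 b\<^sub>2 t $ 3) - Re (two_letter_path b\<^sub>1 b\<^sub>2 t $ 2) = 3 - 2 * t" if "t \<ge> 1 / 2"
    unfolding steady_two_letters(2)[OF assms that] by simp
  ultimately show "Re (two_letter_path b\<^sub>1 b\<^sub>2 t $ 1) - Re (two_letter_path b\<^sub>1 b\<^sub>2 t $ 2) = (if t \<le> 1 / 2 then 4 * t - 1 else 2 * t)"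
    "Re (two_letter_path b\<^sub>1 b\<^sub>2 t $ 1) - Re (two_letter_path b\<^sub>1 b\<^sub>2 t $ 3) = (if t \<le> 1 / 2 then 2 * t - 2 else 4 * t - 3)"
    "Re (two_letter_path b\<^sub>1 b\<^sub>2 t $ 3) - Re (two_letter_path b\<^sub>1 b\<^sub>2 t $ 2) = (if t \<le> 1 / 2 then 1 + 2 * t else 3 - 2 * t)"
    by (cases "t \<le> 1 / 2"; simp)+
  show "Im (two_letter_path b\<^sub>1 b\<^sub>2 t $ 1) - Im (two_letter_path b\<^sub>1 b\<^sub>2 t $ 2) = sign_of b\<^sub>1 / 2" if t: "t = 1 / 4"
  proof -
    have "t \<le> 1 / 2" using t by simp
    show ?thesis unfolding steady_two_letters(1)[OF assms \<open>t \<le> 1 / 2\<close>] unfolding t by simp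
  qed
  show "Im (two_letter_path b\<^sub>1 b\<^sub>2 t $ 1) - Im (two_letter_path b\<^sub>1 b\<^sub>2 t $ 3) = sign_of b\<^sub>2 / 2" if t: "t = 3 / 4"
  proof -
    have "t \<ge> 1 / 2" using t by simp
    show ?thesis unfolding steady_two_letters(2)[OF assms \<open>t \<ge> 1 / 2\<close>] unfolding t by simp
  qed
qed

text \<open>Both paths have the same crossings at the same times with the same strands on top. Hence at each time
  the differences of two points lie, for both paths, in the same half plane or half axis.\<close>

lemma segment_steady_trig_in_Conf:
  assumes t: "t \<in> {0..1}" and s: "s \<in> {0..1}"
  shows "(1 - s) *\<^sub>R two_letter_path b\<^sub>1 b\<^sub>2 t + s *\<^sub>R trig_braid b\<^sub>1 b\<^sub>2 t \<in> Conf"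
proof -
  define w where "w = two_letter_path b\<^sub>1 b\<^sub>2 t"
  define u where "u = trig_braid b\<^sub>1 b\<^sub>2 t"
  define v where "v = (1 - s) *\<^sub>R w + s *\<^sub>R u"
  have mult_pos: "x * (sqrt 3 * sin (2 * pi / 3 * y)) > 0" if "sgn x = sgn y" "y \<noteq> 0" "\<bar>y\<bar> < 3 / 2" for x y :: real
  proof -
    have "2 * pi / 3 * \<bar>y\<bar> < 2 * pi / 3 * (3 / 2)"
      by (rule mult_strict_left_mono[OF that(3)]) simp
    then have "sgn (sin (2 * pi / 3 * y)) = sgn (2 * pi / 3 * y)"
      by (intro sgn_sin) (simp add: abs_mult)
    also have "\<dots> = sgn x" using that(1) by (simp add: sgn_mult)
    finally have "sgn (x * (sqrt 3 * sin (2 * pi / 3 * y))) = sgn x * sgn x" by (simp add: sgn_mult)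
    also have "\<dots> = 1" using that(1,2) by (auto simp: sgn_if split: if_splits)
    finally show ?thesis by (simp add: sgn_1_pos)
  qed
  have ne: "v $ i \<noteq> v $ j"
    if x: "Re (w $ i) - Re (w $ j) = x" and y: "Re (u $ i) - Re (u $ j) = sqrt 3 * sin (2 * pi / 3 * y)"
    and sgn: "(sgn x = sgn y \<and> y \<noteq> 0 \<and> \<bar>y\<bar> < 3 / 2) \<or>
      (x = 0 \<and> y = 0 \<and> (Im (w $ i) - Im (w $ j)) * (Im (u $ i) - Im (u $ j)) > 0)" for i j x y
  proof -
    have "Re (w $ i - w $ j) * Re (u $ i - u $ j) > 0 \<or>
      (Re (w $ i - w $ j) = 0 \<and> Re (u $ i - u $ j) = 0 \<and> Im (w $ i - w $ j) * Im (u $ i - u $ j) > 0)"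
      unfolding minus_complex.sel x y using sgn mult_pos[of x y] by auto
    from segment_avoids_zero[OF this s]
    have "(1 - s) *\<^sub>R (w $ i - w $ j) + s *\<^sub>R (u $ i - u $ j) \<noteq> 0" .
    moreover have "v $ i - v $ j = (1 - s) *\<^sub>R (w $ i - w $ j) + s *\<^sub>R (u $ i - u $ j)"
      by (simp add: v_def algebra_simps)
    ultimately show ?thesis by auto
  qed
  note dw = steady_differences[OF t, of b\<^sub>1 b\<^sub>2, folded w_def]
  note du = trig_braid_differences[of b\<^sub>1 b\<^sub>2 t, folded u_def]
  have sq: "sign_of b / 2 * (sqrt 3 * sign_of b) > 0" for b by (simp add: sign_of_def)
  have "v $ 1 \<noteq> v $ 2"
  proof (rule ne[OF dw(1) du(1)], cases "t = 1 / 4")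
    case True
    then have "Im (u $ 1) - Im (u $ 2) = sqrt 3 * sign_of b\<^sub>1"
      unfolding u_def by (simp only: trig_braid_heights)
    then have "(Im (w $ 1) - Im (w $ 2)) * (Im (u $ 1) - Im (u $ 2)) > 0"
      using sq[of b\<^sub>1] unfolding dw(4)[OF True] by (simp only:)
    with True show "(sgn (if t \<le> 1 / 2 then 4 * t - 1 else 2 * t) = sgn (t - 1 / 4) \<and> t - 1 / 4 \<noteq> 0 \<and> \<bar>t - 1 / 4\<bar> < 3 / 2) \<or>
      ((if t \<le> 1 / 2 then 4 * t - 1 else 2 * t) = 0 \<and> t - 1 / 4 = 0 \<and> (Im (w $ 1) - Im (w $ 2)) * (Im (u $ 1) - Im (u $ 2)) > 0)"
      by simp
  qed (use t in \<open>auto simp: sgn_if split: if_splits\<close>)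
  moreover have "v $ 1 \<noteq> v $ 3"
  proof (rule ne[OF dw(2) du(2)], cases "t = 3 / 4")
    case True
    then have "Im (u $ 1) - Im (u $ 3) = sqrt 3 * sign_of b\<^sub>2"
      unfolding u_def by (simp only: trig_braid_heights)
    then have "(Im (w $ 1) - Im (w $ 3)) * (Im (u $ 1) - Im (u $ 3)) > 0"
      using sq[of b\<^sub>2] unfolding dw(5)[OF True] by (simp only:)
    with True show "(sgn (if t \<le> 1 / 2 then 2 * t - 2 else 4 * t - 3) = sgn (t - 3 / 4) \<and> t - 3 / 4 \<noteq> 0 \<and> \<bar>t - 3 / 4\<bar> < 3 / 2) \<or>
      ((if t \<le> 1 / 2 then 2 * t - 2 else 4 * t - 3) = 0 \<and> t - 3 / 4 = 0 \<and> (Im (w $ 1) - Im (w $ 3)) * (Im (u $ 1) - Im (u $ 3)) > 0)"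
      by simp
  qed (use t in \<open>auto simp: sgn_if split: if_splits\<close>)
  moreover have "v $ 3 \<noteq> v $ 2"
    by (rule ne[OF dw(3) du(3)]) (use t in \<open>auto simp: sgn_if split: if_splits\<close>)
  ultimately have "\<forall>i j. i \<noteq> j \<longrightarrow> v $ i \<noteq> v $ j"
    unfolding forall_3 by simp
  moreover have "Re (v $ i) > 0" for i
  proof -
    have "two_letter_path b\<^sub>1 b\<^sub>2 t \<in> Conf"
    proof (cases "t \<le> 1 / 2")
      case True
      show ?thesis unfolding steady_two_letters(1)[OF t True]
        using t True by (intro letter_path_in_Conf labelling_standard) auto
    next
      case False
      then have "t \<ge> 1 / 2" by simp
      show ?thesis unfolding steady_two_letters(2)[OF t \<open>t \<ge> 1 / 2\<close>]
        using t False by (intro letter_path_in_Conf labelling_standard labelling_next_pos) auto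
    qed
    then have "Re (two_letter_path b\<^sub>1 b\<^sub>2 t $ i) > 0" unfolding Conf_def by blast
    moreover have "Re (trig_braid b\<^sub>1 b\<^sub>2 t $ i) > 0"
    proof -
      have "Re (trig_braid b\<^sub>1 b\<^sub>2 t $ i) = 2 + cos (phase i t)" by (simp add: trig_braid_def)
      then show ?thesis using cos_ge_minus_one[of "phase i t"] by linarith
    qed
    ultimately have "(1 - s) * Re (two_letter_path b\<^sub>1 b\<^sub>2 t $ i) \<ge> 0" "s * Re (trig_braid b\<^sub>1 b\<^sub>2 t $ i) \<ge> 0"
      "(1 - s) * Re (two_letter_path b\<^sub>1 b\<^sub>2 t $ i) > 0 \<or> s * Re (trig_braid b\<^sub>1 b\<^sub>2 t $ i) > 0"
      using s by (auto simp: zero_less_mult_iff)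
    then show ?thesis by (simp add: v_def w_def u_def del: steady_path.simps) linarith
  qed
  ultimately show ?thesis unfolding Conf_def v_def[symmetric] w_def[symmetric] u_def[symmetric] by blast
qed

text \<open>Along the closed curve, strand 1 is continued by strand 3, strand 3 by strand 2 and strand 2 by
  strand 1.\<close>

lemma next_phase:
  defines "\<sigma> \<equiv> (\<lambda>i :: 3. if i = 1 then 3 else if i = 2 then 1 else 2)"
  shows "bij \<sigma>" and "cos (phase i 1) = cos (phase (\<sigma> i) 0)" and "sin (phase i 1) = sin (phase (\<sigma> i) 0)"
    and "two_letter_path b\<^sub>1 b\<^sub>2 1 $ i = two_letter_path b\<^sub>1 b\<^sub>2 0 $ \<sigma> i"
proof -
  have "inj \<sigma>" unfolding inj_def \<sigma>_def forall_3 by simp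
  then show "bij \<sigma>" by (simp add: bij_def finite_UNIV_inj_surj)
  have "phase 1 1 = phase 3 0" "phase 2 1 = phase 1 0 + 2 * pi" "phase 3 1 = phase 2 0"
    by (simp_all add: phase_def field_simps)
  then have "\<forall>i. cos (phase i 1) = cos (phase (\<sigma> i) 0) \<and> sin (phase i 1) = sin (phase (\<sigma> i) 0)"
    unfolding forall_3 \<sigma>_def by simp
  then show "cos (phase i 1) = cos (phase (\<sigma> i) 0)" "sin (phase i 1) = sin (phase (\<sigma> i) 0)" by auto
  have "two_letter_path b\<^sub>1 b\<^sub>2 1 = letter_path (\<sigma>\<^sub>2, b\<^sub>2) (next_pos (\<sigma>\<^sub>1, b\<^sub>1) \<circ> standard_labelling) 1"
    "two_letter_path b\<^sub>1 b\<^sub>2 0 = letter_path (\<sigma>\<^sub>1, b\<^sub>1) standard_labelling 0"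
    using steady_two_letters(2)[of 1 "(\<sigma>\<^sub>1, b\<^sub>1)" "(\<sigma>\<^sub>2, b\<^sub>2)" standard_labelling]
      steady_two_letters(1)[of 0 "(\<sigma>\<^sub>1, b\<^sub>1)" "(\<sigma>\<^sub>2, b\<^sub>2)" standard_labelling] by simp_all
  moreover have "\<forall>i. config (next_pos (\<sigma>\<^sub>2, b\<^sub>2) \<circ> (next_pos (\<sigma>\<^sub>1, b\<^sub>1) \<circ> standard_labelling)) $ i
      = config standard_labelling $ \<sigma> i"
    unfolding forall_3 \<sigma>_def by (simp add: config_def next_pos_def)
  ultimately show "two_letter_path b\<^sub>1 b\<^sub>2 1 $ i = two_letter_path b\<^sub>1 b\<^sub>2 0 $ \<sigma> i"
    by (simp only: letter_path_ends)
qed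

lemma continuous_on_phase [continuous_intros]:
  "continuous_on S f \<Longrightarrow> continuous_on S (\<lambda>x. phase i (f x))"
  unfolding phase_def by (intro continuous_intros)

lemma continuous_on_trig_braid [continuous_intros]:
  fixes f :: "'a::t2_space \<Rightarrow> real"
  shows "continuous_on S f \<Longrightarrow> continuous_on S (\<lambda>x. trig_braid b\<^sub>1 b\<^sub>2 (f x))"
  unfolding trig_braid_def Complex_eq height_def slope_def by (intro continuous_intros)

lemma closure_isotopic_trig_braid:
  "ambient_isotopic (braid_closure [(\<sigma>\<^sub>1, b\<^sub>1), (\<sigma>\<^sub>2, b\<^sub>2)]) (path_closure (trig_braid b\<^sub>1 b\<^sub>2))"
proof -
  define H where "H s t = (1 - s) *\<^sub>R two_letter_path b\<^sub>1 b\<^sub>2 t + s *\<^sub>R trig_braid b\<^sub>1 b\<^sub>2 t" for s t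
  have "path (two_letter_path b\<^sub>1 b\<^sub>2)"
    using homotopic_paths_imp_path[OF steady_path_homotopic_word_path[OF _ labelling_standard]] by blast
  then have cW: "continuous_on ({0..1} \<times> {0..1}) (\<lambda>p. two_letter_path b\<^sub>1 b\<^sub>2 (snd p))"
    unfolding path_def by (rule continuous_on_compose2) (auto intro!: continuous_intros)
  have "ambient_isotopic (path_closure (H 0)) (path_closure (H 1))"
  proof (rule path_closure_homotopy)
    show "continuous_on ({0..1} \<times> {0..1}) (\<lambda>(s, t). H s t)"
      unfolding case_prod_unfold H_def by (intro continuous_intros cW)
    show "H s t \<in> Conf" if "s \<in> {0..1}" "t \<in> {0..1}" for s t
      unfolding H_def by (rule segment_steady_trig_in_Conf[OF that(2,1)])
    show "H s 1 $ i = H s 0 $ (if i = 1 then 3 else if i = 2 then 1 else 2)" for s i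
      unfolding H_def vector_add_component vector_scaleR_component next_phase(4)
      by (simp only: trig_braid_def vec_lambda_beta height_def next_phase(2,3))
  qed (rule next_phase(1))
  moreover have "H 0 = two_letter_path b\<^sub>1 b\<^sub>2" "H 1 = trig_braid b\<^sub>1 b\<^sub>2"
    unfolding H_def by (simp_all del: steady_path.simps)
  ultimately have "ambient_isotopic (path_closure (two_letter_path b\<^sub>1 b\<^sub>2)) (path_closure (trig_braid b\<^sub>1 b\<^sub>2))"
    by (simp only:)
  moreover have "path_closure (two_letter_path b\<^sub>1 b\<^sub>2) = braid_closure [(\<sigma>\<^sub>1, b\<^sub>1), (\<sigma>\<^sub>2, b\<^sub>2)]"
    by (rule path_closure_steady_path[OF _ labelling_standard]) simp
  ultimately show ?thesis by (simp only:)
qed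

text \<open>The trigonometric braid, with every page turned by a right angle about the point 2.\<close>

definition turned_braid :: "bool \<Rightarrow> bool \<Rightarrow> real \<Rightarrow> complex ^ 3" where
  "turned_braid b\<^sub>1 b\<^sub>2 t = (\<chi> i. Complex (2 - height b\<^sub>1 b\<^sub>2 (phase i t)) (cos (phase i t)))"

text \<open>During the turn the points stay within distance \<open>sqrt 2\<close> of the point 2 and never reach the axis.\<close>

lemma trig_braid_isotopic_turned:
  "ambient_isotopic (path_closure (trig_braid b\<^sub>1 b\<^sub>2)) (path_closure (turned_braid b\<^sub>1 b\<^sub>2))"
proof -
  define H where "H s t = (\<chi> i. 2 + cis (s * (pi / 2)) * (trig_braid b\<^sub>1 b\<^sub>2 t $ i - 2))" for s t
  have "ambient_isotopic (path_closure (H 0)) (path_closure (H 1))"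
  proof (rule path_closure_homotopy)
    show "continuous_on ({0..1} \<times> {0..1}) (\<lambda>(s, t). H s t)"
      unfolding case_prod_unfold H_def by (intro continuous_intros)
    show "H s t \<in> Conf" if s: "s \<in> {0..1}" and t: "t \<in> {0..1}" for s t
    proof -
      have "trig_braid b\<^sub>1 b\<^sub>2 t \<in> Conf"
        using segment_steady_trig_in_Conf[OF t, of 1 b\<^sub>1 b\<^sub>2] by simp
      then have "H s t $ i \<noteq> H s t $ j" if "i \<noteq> j" for i j
        using that by (simp add: H_def Conf_def)
      moreover have "Re (H s t $ i) > 0" for i
      proof -
        have "(norm (trig_braid b\<^sub>1 b\<^sub>2 t $ i - 2))\<^sup>2 = (cos (phase i t))\<^sup>2 + (height b\<^sub>1 b\<^sub>2 (phase i t))\<^sup>2"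
          by (simp add: trig_braid_def cmod_power2)
        also have "\<dots> \<le> 1 + 1"
          using height_bound[of b\<^sub>1 b\<^sub>2 "phase i t"] abs_cos_le_one[of "phase i t"]
          by (intro add_mono) (simp_all add: abs_square_le_1)
        also have "\<dots> < 2\<^sup>2" by simp
        finally have "norm (trig_braid b\<^sub>1 b\<^sub>2 t $ i - 2) < 2"
          by (rule power_less_imp_less_base) simp
        then have "\<bar>Re (cis (s * (pi / 2)) * (trig_braid b\<^sub>1 b\<^sub>2 t $ i - 2))\<bar> < 2"
          using abs_Re_le_cmod[of "cis (s * (pi / 2)) * (trig_braid b\<^sub>1 b\<^sub>2 t $ i - 2)"]
          unfolding norm_mult norm_cis by linarith
        moreover have "Re (H s t $ i) = 2 + Re (cis (s * (pi / 2)) * (trig_braid b\<^sub>1 b\<^sub>2 t $ i - 2))"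
          by (simp add: H_def)
        ultimately show ?thesis by linarith
      qed
      ultimately show ?thesis unfolding Conf_def by blast
    qed
    show "H s 1 $ i = H s 0 $ (if i = 1 then 3 else if i = 2 then 1 else 2)" for s i
      unfolding H_def vec_lambda_beta
      by (simp only: trig_braid_def vec_lambda_beta height_def next_phase(2,3))
  qed (rule next_phase(1))
  moreover have "H 0 = trig_braid b\<^sub>1 b\<^sub>2"
    by (simp add: H_def fun_eq_iff Finite_Cartesian_Product.vec_eq_iff)
  moreover have "H 1 = turned_braid b\<^sub>1 b\<^sub>2"
    by (simp add: H_def fun_eq_iff Finite_Cartesian_Product.vec_eq_iff trig_braid_def turned_braid_def
        complex_eq_iff)
  ultimately show ?thesis by simp
qed

text \<open>The closure of the turned braid, parametrised by the phase: as the pages are turned, the height of the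
  curve is the cosine of the phase.\<close>

definition trig_knot :: "bool \<Rightarrow> bool \<Rightarrow> real \<Rightarrow> space3" where
  "trig_knot b\<^sub>1 b\<^sub>2 a = (of_real (2 - height b\<^sub>1 b\<^sub>2 a) * (\<i> * cis a ^ 3), cos a)"

lemma trig_knot_cong: "cos a = cos b \<Longrightarrow> sin a = sin b \<Longrightarrow> trig_knot b\<^sub>1 b\<^sub>2 a = trig_knot b\<^sub>1 b\<^sub>2 b"
  by (simp add: trig_knot_def height_def complex_eq_iff cis_conv_exp[symmetric] cis.ctr)

text \<open>At time t all three phases a satisfy \<open>3 a + \<pi> / 2 = 2 \<pi> t\<close> up to multiples of \<open>2 \<pi>\<close>, which gives the
  angle of the page in terms of the phase.\<close>

lemma page_turned_braid: "page t (turned_braid b\<^sub>1 b\<^sub>2 t $ i) = trig_knot b\<^sub>1 b\<^sub>2 (phase i t)"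
proof -
  have shift: "cis (x + 2 * pi) = cis x" "cis (x - 2 * pi) = cis x" for x
    by (simp_all add: complex_eq_iff cos_diff sin_diff)
  have "\<forall>i. \<i> * cis (3 * phase i t) = cis (2 * pi * t)"
  proof -
    have "\<i> * cis (3 * phase j t) = cis (3 * phase j t + pi / 2)" for j
      by (simp flip: cis_mult)
    moreover have "3 * phase 1 t + pi / 2 = 2 * pi * t - 2 * pi" "3 * phase 2 t + pi / 2 = 2 * pi * t + 2 * pi"
      "3 * phase 3 t + pi / 2 = 2 * pi * t"
      by (simp_all add: phase_def field_simps)
    ultimately show ?thesis unfolding forall_3 by (simp only: shift)
  qed
  moreover have "cis (phase i t) ^ 3 = cis (3 * phase i t)"
    using Complex.DeMoivre[of "phase i t" 3] by simp
  ultimately have "cis (2 * pi * t) = \<i> * cis (phase i t) ^ 3"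
    by simp
  then show ?thesis by (simp add: page_def turned_braid_def trig_knot_def)
qed

text \<open>During the unit of time each strand covers one third of the phases.\<close>

lemma path_closure_turned_braid: "path_closure (turned_braid b\<^sub>1 b\<^sub>2) = range (trig_knot b\<^sub>1 b\<^sub>2)"
proof -
  have "path_closure (turned_braid b\<^sub>1 b\<^sub>2) = (\<lambda>(t, i). trig_knot b\<^sub>1 b\<^sub>2 (phase i t)) ` ({0..1} \<times> UNIV)"
    by (simp add: path_closure_def page_turned_braid)
  moreover have "trig_knot b\<^sub>1 b\<^sub>2 a \<in> (\<lambda>(t, i). trig_knot b\<^sub>1 b\<^sub>2 (phase i t)) ` ({0..1} \<times> UNIV)" for a
  proof -
    (* Strand 1 has phase -d at time 0, so that strands 1, 3 and 2 run in this order through the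
       phases from -d to 2 pi - d, each over a third of the circle. *)
    define d where "d = 5 * pi / 6"
    obtain x where x: "0 \<le> x" "x < 2 * pi" "cos (a + d) = cos x" "sin (a + d) = sin x"
      by (rule sincos_total_2pi[of "cos (a + d)" "sin (a + d)"]) simp_all
    define y where "y = 3 * x / (2 * pi)"
    have "x = 2 * pi / 3 * y" by (simp add: y_def)
    have y: "0 \<le> y" "y < 3" using x(1,2) by (simp_all add: y_def divide_simps)
    have "cos (a + d - d) = cos (x - d)" "sin (a + d - d) = sin (x - d)"
      unfolding cos_diff sin_diff x(3,4) by simp_all
    then have a: "trig_knot b\<^sub>1 b\<^sub>2 a = trig_knot b\<^sub>1 b\<^sub>2 (x - d)" by (intro trig_knot_cong) simp_all
    have ph: "phase 1 y = x - d" "phase 3 (y - 1) = x - d" "phase 2 (y - 2) = x - d"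
      by (simp_all add: phase_def d_def \<open>x = 2 * pi / 3 * y\<close> field_simps)
    consider "y \<le> 1" | "1 \<le> y" "y \<le> 2" | "2 \<le> y" by linarith
    then show ?thesis
    proof cases
      case 1
      then show ?thesis using y ph a by (intro rev_image_eqI[of "(y, 1)"]) auto
    next
      case 2
      then show ?thesis using y ph a by (intro rev_image_eqI[of "(y - 1, 3)"]) auto
    next
      case 3
      then show ?thesis using y ph a by (intro rev_image_eqI[of "(y - 2, 2)"]) auto
    qed
  qed
  ultimately show ?thesis by auto
qed

lemma ambient_isotopicI:
  fixes A B :: "real \<Rightarrow> 'a::topological_space \<Rightarrow> 'a"
  assumes "continuous_on ({0..1} \<times> UNIV) (\<lambda>(t, x). A t x)"
    and "\<And>t. t \<in> {0..1} \<Longrightarrow> continuous_on UNIV (B t)"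
    and "\<And>t x. A t (B t x) = x" "\<And>t x. B t (A t x) = x" "\<And>x. A 0 x = x" "A 1 ` K = L"
  shows "ambient_isotopic K L"
  unfolding ambient_isotopic_def
proof (intro exI[of _ A] conjI ballI allI)
  show "\<exists>G. homeomorphism UNIV UNIV (A t) G" if t: "t \<in> {0..1}" for t
  proof (intro exI[of _ "B t"] homeomorphismI)
    show "continuous_on UNIV (A t)"
      using continuous_on_compose2[OF assms(1), of UNIV "\<lambda>x. (t, x)"] t
      by (force intro!: continuous_intros)
  qed (use assms t in auto)
qed (use assms in auto)

text \<open>The curve meets each level \<open>h = cos a\<close> in the points of phase a and -a. Splitting the
  first coordinate into its even and its odd part gives their midpoint m and the direction E of the
  segment between them, both polynomials in h. Here S and T are the Chebyshev polynomials with
  \<open>sin (3 a) = sin a * S (cos a)\<close> and \<open>cos (3 a) = T (cos a)\<close>. The direction vanishes nowhere,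
  because S vanishes only at \<open>\<plusminus> 1/2\<close>, and there the slope is a sign and T is not 0.\<close>

lemma trig_knot_levels:
  obtains m E :: "real \<Rightarrow> complex"
  where "\<And>a. trig_knot b\<^sub>1 b\<^sub>2 a = (m (cos a) + of_real (sin a) * E (cos a), cos a)"
    and "\<And>h. E h \<noteq> 0" and "continuous_on UNIV m" "continuous_on UNIV E"
proof -
  define S T where "S h = 4 * h\<^sup>2 - 1" and "T h = 4 * h ^ 3 - 3 * h" for h :: real
  define m where "m h = Complex ((1 - h\<^sup>2) * slope b\<^sub>1 b\<^sub>2 h * S h) (2 * T h)" for h
  define E where "E h = Complex (- 2 * S h) (- slope b\<^sub>1 b\<^sub>2 h * T h)" for h
  have knot: "trig_knot b\<^sub>1 b\<^sub>2 a = (m (cos a) + of_real (sin a) * E (cos a), cos a)" for a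
  proof -
  define c s where "c = cos a" "s = sin a"
  have ss: "s\<^sup>2 = 1 - c\<^sup>2" unfolding c_s_def by (rule sin_squared_eq)
  have "cis a = Complex c s" by (simp add: c_s_def complex_eq_iff)
  then have "cis a ^ 3 = Complex (c ^ 3 - 3 * c * s\<^sup>2) (s * (3 * c\<^sup>2 - s\<^sup>2))"
    by (simp add: complex_eq_iff power3_eq_cube power2_eq_square algebra_simps)
  also have "\<dots> = Complex (T c) (s * S c)"
    unfolding ss T_def S_def by (simp add: power3_eq_cube power2_eq_square algebra_simps)
  finally have cube: "cis a ^ 3 = Complex (T c) (s * S c)" .
  have "of_real (2 - height b\<^sub>1 b\<^sub>2 a) * (\<i> * cis a ^ 3) =
      Complex (- 2 * s * S c + s\<^sup>2 * slope b\<^sub>1 b\<^sub>2 c * S c) (2 * T c - s * slope b\<^sub>1 b\<^sub>2 c * T c)"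
    unfolding cube height_def c_s_def[symmetric]
    by (simp add: complex_eq_iff power2_eq_square algebra_simps)
  also have "\<dots> = m c + of_real s * E c"
    unfolding ss m_def E_def by (simp add: complex_eq_iff algebra_simps)
  finally show ?thesis
    by (simp add: trig_knot_def c_s_def)
  qed
  have E_nonzero: "E h \<noteq> 0" for h
  proof
    assume "E h = 0"
    then have S: "S h = 0" and kT: "slope b\<^sub>1 b\<^sub>2 h * T h = 0" by (simp_all add: E_def complex_eq_iff)
    then have "(2 * h - 1) * (2 * h + 1) = 0" by (simp add: S_def power2_eq_square algebra_simps)
    then have "h = 1 / 2 \<or> h = - 1 / 2" by auto
    then show False
    proof
      assume h: "h = 1 / 2"
      have "T (1 / 2) = - 1" by (simp add: T_def power3_eq_cube)
      then have "slope b\<^sub>1 b\<^sub>2 (1 / 2) = 0" using kT unfolding h by simp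
      then show False by (simp add: slope_def sign_of_def split: if_splits)
    next
      assume h: "h = - 1 / 2"
      have "T (- 1 / 2) = 1" by (simp add: T_def power3_eq_cube)
      then have "slope b\<^sub>1 b\<^sub>2 (- 1 / 2) = 0" using kT unfolding h by simp
      then show False by (simp add: slope_def sign_of_def split: if_splits)
    qed
  qed
  have "continuous_on UNIV m" "continuous_on UNIV E"
    unfolding m_def E_def S_def T_def slope_def Complex_eq by (intro continuous_intros)+
  with knot E_nonzero show thesis by (rule that)
qed

text \<open>In each level, translate the midpoint to the axis and divide by the direction E. Since the
  line of heights is contractible, E has a continuous logarithm, and the division is
  connected to the identity. The result is a vertical round circle, to be turned into the
  horizontal one.\<close>

lemma is_unknot_trig_knot: "is_unknot (range (trig_knot b\<^sub>1 b\<^sub>2))"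
proof -
  obtain m E where knot: "\<And>a. trig_knot b\<^sub>1 b\<^sub>2 a = (m (cos a) + of_real (sin a) * E (cos a), cos a)"
    and E: "\<And>h. E h \<noteq> 0" and m_cont: "continuous_on UNIV m" and E_cont: "continuous_on UNIV E"
    by (rule trig_knot_levels[of b\<^sub>1 b\<^sub>2]) (rule that)
  obtain l where l_cont: "continuous_on UNIV l" and l: "\<And>h :: real. E h = exp (l h)"
    using continuous_logarithm_on_contractible[OF E_cont contractible_UNIV] E by auto
  have cont_snd: "continuous_on X (\<lambda>p. f (snd (g p)))"
    if "continuous_on UNIV f" "continuous_on X g" for X :: "'x::topological_space set" and f :: "real \<Rightarrow> complex" and g :: "'x \<Rightarrow> space3"
    using that by (intro continuous_on_compose2[OF that(1)] continuous_on_snd) auto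
  have "ambient_isotopic (range (trig_knot b\<^sub>1 b\<^sub>2)) (range (\<lambda>a. (of_real (sin a), cos a)))"
  proof (rule ambient_isotopicI)
    let ?A = "\<lambda>s x. ((fst x - of_real s * m (snd x)) * exp (- of_real s * l (snd x)), snd x)"
    let ?B = "\<lambda>s x. (fst x * exp (of_real s * l (snd x)) + of_real s * m (snd x), snd x)"
    show "continuous_on ({0..1} \<times> UNIV) (\<lambda>(s, x). ?A s x)"
      unfolding case_prod_unfold by (intro continuous_intros cont_snd[OF m_cont] cont_snd[OF l_cont])
    show "continuous_on UNIV (?B s)" for s
      by (intro continuous_intros cont_snd[OF m_cont] cont_snd[OF l_cont])
    show "?A s (?B s x) = x" "?B s (?A s x) = x" for s x
      by (simp_all add: mult.assoc flip: exp_add)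
    show "?A 0 x = x" for x by simp
    have "?A 1 (trig_knot b\<^sub>1 b\<^sub>2 a) = (of_real (sin a), cos a)" for a
      unfolding knot using l[of "cos a"] by (simp add: mult.assoc flip: exp_add)
    then show "?A 1 ` range (trig_knot b\<^sub>1 b\<^sub>2) = range (\<lambda>a. (of_real (sin a), cos a))"
      unfolding image_image by (simp only:)
  qed
  also have "ambient_isotopic \<dots> {(z, h). norm z = 1 \<and> h = 0}"
  proof (rule ambient_isotopicI)
    let ?R = "\<lambda>s x. (Complex (Re (fst x)) (Im (fst x) * cos (s * (pi / 2)) + snd x * sin (s * (pi / 2))),
      snd x * cos (s * (pi / 2)) - Im (fst x) * sin (s * (pi / 2)))"
    show "continuous_on ({0..1} \<times> UNIV) (\<lambda>(s, x). ?R s x)"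
      unfolding case_prod_unfold Complex_eq by (intro continuous_intros)
    show "continuous_on UNIV (?R (- s))" for s
      unfolding Complex_eq by (intro continuous_intros)
    have inv: "(y * cos u - h * sin u) * cos u + (h * cos u + y * sin u) * sin u = y"
      "(y * cos u + h * sin u) * cos u - (h * cos u - y * sin u) * sin u = y" for y h u :: real
    proof -
      have "(y * p - h * q) * p + (h * p + y * q) * q = y * (q\<^sup>2 + p\<^sup>2)"
        "(y * p + h * q) * p - (h * p - y * q) * q = y * (q\<^sup>2 + p\<^sup>2)" for p q :: real
        by (simp_all add: power2_eq_square algebra_simps)
      from this[of "cos u" "sin u"]
      show "(y * cos u - h * sin u) * cos u + (h * cos u + y * sin u) * sin u = y"
        "(y * cos u + h * sin u) * cos u - (h * cos u - y * sin u) * sin u = y" by simp_all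
    qed
    show "?R s (?R (- s) x) = x" "?R (- s) (?R s x) = x" for s x
      using inv[of "Im (fst x)" "s * (pi / 2)" "snd x"] inv[of "snd x" "s * (pi / 2)" "Im (fst x)"]
      by (simp_all add: prod_eq_iff complex_eq_iff)
    show "?R 0 x = x" for x by (simp add: prod_eq_iff complex_eq_iff)
    have "?R 1 ` range (\<lambda>a. (of_real (sin a), cos a)) = range (\<lambda>a. (Complex (sin a) (cos a), 0))"
      by (simp add: image_image)
    also have "\<dots> = {(z, h). norm z = 1 \<and> h = 0}"
    proof (intro subset_antisym subsetI)
      fix x :: space3 assume "x \<in> {(z, h). norm z = 1 \<and> h = 0}"
      then have "norm (fst x) = 1" "snd x = 0" by auto
      then have sq: "(Im (fst x))\<^sup>2 + (Re (fst x))\<^sup>2 = 1"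
        using cmod_power2[of "fst x"] by simp
      obtain a where "Im (fst x) = cos a" "Re (fst x) = sin a"
        by (rule sincos_total_2pi[OF sq])
      then have "x = (Complex (sin a) (cos a), 0)" using \<open>snd x = 0\<close> by (simp add: prod_eq_iff complex_eq_iff)
      then show "x \<in> range (\<lambda>a. (Complex (sin a) (cos a), 0))" by blast
    qed (auto simp: cmod_def)
    finally show "?R 1 ` range (\<lambda>a. (of_real (sin a), cos a)) = {(z, h). norm z = 1 \<and> h = 0}" .
  qed
  finally show ?thesis unfolding is_unknot_def .
qed

lemma is_unknot_two_letters: "is_unknot (braid_closure [(\<sigma>\<^sub>1, b\<^sub>1), (\<sigma>\<^sub>2, b\<^sub>2)])"
proof -
  have "ambient_isotopic (braid_closure [(\<sigma>\<^sub>1, b\<^sub>1), (\<sigma>\<^sub>2, b\<^sub>2)]) (range (trig_knot b\<^sub>1 b\<^sub>2))"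
    using ambient_isotopic_trans[OF closure_isotopic_trig_braid trig_braid_isotopic_turned]
    unfolding path_closure_turned_braid .
  then show ?thesis using is_unknot_trig_knot by (rule is_unknot_isotopic)
qed

lemma unknot_word_nonempty: "unknot_word w \<Longrightarrow> w \<noteq> []"
  by (induction rule: unknot_word.induct) auto

theorem unknot_word_closure: "unknot_word w \<Longrightarrow> is_unknot (braid_closure w)"
proof (induction rule: unknot_word.induct)
  case (base s\<^sub>1 s\<^sub>2)
  show ?case by (rule is_unknot_two_letters)
next
  case (rotate v u)
  show ?case by (rule is_unknot_isotopic[OF braid_closure_rotate rotate.IH])
next
  case (braid u v)
  then show ?case
    using is_unknot_isotopic[OF braid_eq_closure_isotopic] unknot_word_nonempty by blast
qed

section \<open>The edges of a closed braid diagram\<close>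

definition edges :: "word \<Rightarrow> (nat \<times> nat) set" where
  "edges w = {..<length w} \<times> {1, 2, 3}"

definition next_edge :: "word \<Rightarrow> nat \<times> nat \<Rightarrow> nat \<times> nat" where
  "next_edge w e = (next_level w (fst e), next_pos (w ! fst e) (snd e))"

lemma next_pos_involution: "next_pos x (next_pos x p) = p"
  by (auto simp: next_pos_def)

lemma next_pos_range: "p \<in> {1, 2, 3} \<Longrightarrow> next_pos x p \<in> {1, 2, 3}"
  using gen_index_cases[of "fst x"] by (auto simp: next_pos_def)

lemma next_level_less: "j < length w \<Longrightarrow> next_level w j < length w"
  unfolding next_level_def by (rule mod_less_divisor) auto

lemma next_level_inj:
  assumes "i < length w" "j < length w" "next_level w i = next_level w j"
  shows "i = j"
proof -
  have "next_level w k = (if Suc k = length w then 0 else Suc k)" if "k < length w" for k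
    using that by (auto simp: next_level_def)
  then show ?thesis using assms by (auto split: if_splits)
qed

lemma next_edge_in_edges: "e \<in> edges w \<Longrightarrow> next_edge w e \<in> edges w"
  unfolding edges_def next_edge_def mem_Times_iff fst_conv snd_conv lessThan_iff
  using next_level_less next_pos_range by blast

lemma inj_on_next_edge: "inj_on (next_edge w) (edges w)"
proof (rule inj_onI)
  fix e f assume e: "e \<in> edges w" "f \<in> edges w" and eq: "next_edge w e = next_edge w f"
  then have "fst e = fst f" using next_level_inj by (auto simp: edges_def next_edge_def)
  moreover have "snd e = snd f"
    using eq calculation next_pos_involution by (metis next_edge_def snd_conv)
  ultimately show "e = f" by (simp add: prod_eq_iff)
qed

definition edge_point :: "word \<Rightarrow> nat \<times> nat \<Rightarrow> real \<Rightarrow> space3" where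
  "edge_point w e t = page ((real (fst e) + t) / real (length w)) (strand_point (w ! fst e) (snd e) t)"

lemma braid_closure_edges: "braid_closure w = (\<Union>e\<in>edges w. edge_point w e ` {0..1})"
proof -
  have "braid_closure w = {edge_point w (j, p) t | j p t. j < length w \<and> p \<in> {1, 2, 3} \<and> t \<in> {0..1}}"
    unfolding braid_closure_def edge_point_def page_def strand_point_def by simp
  also have "\<dots> = (\<Union>e\<in>edges w. edge_point w e ` {0..1})"
  proof (rule subset_antisym; rule subsetI)
    fix x assume "x \<in> (\<Union>e\<in>edges w. edge_point w e ` {0..1})"
    then obtain e t where "e \<in> edges w" "t \<in> {0..1}" "x = edge_point w e t" by blast
    moreover obtain j p where "e = (j, p)" by (cases e)
    ultimately show "x \<in> {edge_point w (j, p) t | j p t. j < length w \<and> p \<in> {1, 2, 3} \<and> t \<in> {0..1}}"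
      unfolding edges_def by blast
  qed (unfold edges_def, blast)
  finally show ?thesis .
qed

lemma edge_point_1:
  assumes "e \<in> edges w"
  shows "edge_point w e 1 = edge_point w (next_edge w e) 0"
proof -
  have j: "fst e < length w" using assms by (auto simp: edges_def)
  show ?thesis
  proof (cases "Suc (fst e) = length w")
    case True
    then have "next_level w (fst e) = 0" by (simp add: next_level_def)
    moreover have "(real (fst e) + 1) / real (length w) = 1" using True by (simp flip: True)
    ultimately show ?thesis
      by (simp add: edge_point_def next_edge_def strand_point_0 strand_point_1 page_1)
  next
    case False
    then have "next_level w (fst e) = Suc (fst e)" using j by (simp add: next_level_def)
    then show ?thesis
      by (simp add: edge_point_def next_edge_def strand_point_0 strand_point_1 add.commute)
  qed
qed

text \<open>The angle determines the sector and the time in it, and the strands of a sector are disjoint.\<close>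

lemma edge_point_inj:
  assumes e: "e \<in> edges w" "f \<in> edges w" and t: "0 \<le> t" "t < 1" "0 \<le> s" "s < 1"
    and eq: "edge_point w e t = edge_point w f s"
  shows "e = f"
proof -
  let ?n = "real (length w)"
  have je: "fst e < length w" "fst f < length w" and pe: "snd e \<in> {1, 2, 3}" "snd f \<in> {1, 2, 3}"
    using e by (auto simp: edges_def)
  have pos: "Re (strand_point (w ! fst e) (snd e) t) > 0" "Re (strand_point (w ! fst f) (snd f) s) > 0"
    using t pe by (auto intro!: Re_strand_point_pos)
  have range: "0 \<le> (real (fst e) + t) / ?n" "(real (fst e) + t) / ?n < 1"
    "0 \<le> (real (fst f) + s) / ?n" "(real (fst f) + s) / ?n < 1"
  proof -
    have "real (fst e) + 1 \<le> ?n" "real (fst f) + 1 \<le> ?n" using je by linarith+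
    then show "0 \<le> (real (fst e) + t) / ?n" "(real (fst e) + t) / ?n < 1"
      "0 \<le> (real (fst f) + s) / ?n" "(real (fst f) + s) / ?n < 1"
      using t by (auto simp: divide_simps)
  qed
  have "(real (fst e) + t) / ?n = (real (fst f) + s) / ?n"
    using arg_cong[OF eq, of page_angle] pos range by (simp add: edge_point_def page_angle_page)
  then have sum: "real (fst e) + t = real (fst f) + s" using je by auto
  then have "real (fst e) < real (fst f) + 1" "real (fst f) < real (fst e) + 1" using t by linarith+
  then have j: "fst e = fst f" by linarith
  then have "t = s" using sum by simp
  have "strand_point (w ! fst e) (snd e) t = strand_point (w ! fst f) (snd f) s"
    using arg_cong[OF eq, of page_point] pos by (simp add: edge_point_def page_point_page)
  then have "snd e = snd f"
    using strand_point_distinct[of "snd e" "snd f" t "w ! fst e"] pe t j \<open>t = s\<close> by auto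
  with j show ?thesis by (simp add: prod_eq_iff)
qed

text \<open>A set of edges that is closed under continuation is a union of components of the closed braid, and a
  knot is connected.\<close>

lemma knot_single_cycle:
  assumes knot: "is_knot (braid_closure w)"
    and A: "A \<subseteq> edges w" "A \<noteq> {}" "\<And>e. e \<in> A \<Longrightarrow> next_edge w e \<in> A"
  shows "A = edges w"
proof (rule ccontr)
  assume "A \<noteq> edges w"
  define B where "B = edges w - A"
  have B: "B \<subseteq> edges w" "B \<noteq> {}" using A(1) \<open>A \<noteq> edges w\<close> by (auto simp: B_def)
  have fin: "finite (edges w)" by (simp add: edges_def)
  have surj: "next_edge w ` A = A"
    using A fin inj_on_subset[OF inj_on_next_edge A(1)] by (intro endo_inj_surj) (auto dest: finite_subset)
  have B_closed: "next_edge w e \<in> B" if "e \<in> B" for e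
  proof (rule ccontr)
    have e: "e \<in> edges w" "e \<notin> A" using that by (auto simp: B_def)
    assume "next_edge w e \<notin> B"
    then have "next_edge w e \<in> next_edge w ` A"
      using next_edge_in_edges[OF e(1)] surj by (simp add: B_def)
    then obtain f where "f \<in> A" "next_edge w e = next_edge w f" by blast
    then have "e = f" using inj_onD[OF inj_on_next_edge] e(1) A(1) by blast
    then show False using \<open>f \<in> A\<close> e(2) by simp
  qed
  define K where "K X = (\<Union>e\<in>X. edge_point w e ` {0..1})" for X
  have closed_K: "closed (K X)" if "X \<subseteq> edges w" for X
  proof -
    have "continuous_on {0..1} (edge_point w e)" for e
      unfolding edge_point_def divide_inverse by (intro continuous_intros continuous_on_strand_point)
    then have "compact (edge_point w e ` {0..1})" for e
      by (intro compact_continuous_image) auto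
    then show ?thesis
      unfolding K_def using finite_subset[OF that fin] by (intro closed_UN) (auto intro: compact_imp_closed)
  qed
  have normal: "\<exists>e\<in>X. \<exists>t. 0 \<le> t \<and> t < 1 \<and> x = edge_point w e t"
    if x: "x \<in> K X" and X: "X \<subseteq> edges w" "\<And>e. e \<in> X \<Longrightarrow> next_edge w e \<in> X" for X x
  proof -
    from x obtain e t where e: "e \<in> X" "t \<in> {0..1}" "x = edge_point w e t" by (auto simp: K_def)
    show ?thesis
    proof (cases "t = 1")
      case True
      then have "x = edge_point w (next_edge w e) 0" using e X(1) edge_point_1 by blast
      then show ?thesis using X(2)[OF e(1)] by (intro bexI[of _ "next_edge w e"] exI[of _ 0]) auto
    next
      case False
      then show ?thesis using e by (intro bexI[of _ e] exI[of _ t]) auto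
    qed
  qed
  have disjoint: "K A \<inter> K B = {}"
  proof (rule ccontr)
    assume "K A \<inter> K B \<noteq> {}"
    then obtain x where x: "x \<in> K A" "x \<in> K B" by blast
    obtain e t where e: "e \<in> A" "0 \<le> t" "t < 1" "x = edge_point w e t"
      using normal[OF x(1) A(1) A(3)] by blast
    obtain f s where f: "f \<in> B" "0 \<le> s" "s < 1" "x = edge_point w f s"
      using normal[OF x(2) B(1) B_closed] by blast
    have "e \<in> edges w" "f \<in> edges w" using e(1) f(1) A(1) B(1) by auto
    from edge_point_inj[OF this e(2,3) f(2,3)] have "e = f" using e(4) f(4) by simp
    then show False using e(1) f(1) by (simp add: B_def)
  qed
  have "edge_point w e 0 \<in> K X" if "e \<in> X" for e X
    unfolding K_def using that by (intro UN_I[of e] image_eqI[of _ _ 0]) auto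
  then have ne: "K A \<noteq> {}" "K B \<noteq> {}" using A(2) B(2) by blast+
  have un: "braid_closure w = K A \<union> K B"
  proof -
    have "edges w = A \<union> B" using A(1) by (auto simp: B_def)
    then show ?thesis unfolding braid_closure_edges K_def by (simp only: UN_Un)
  qed
  have "connected (braid_closure w)"
  proof -
    have "connected (sphere (0::complex) 1)" by (intro connected_sphere) simp
    then show ?thesis using knot homeomorphic_connectedness unfolding is_knot_def by blast
  qed
  moreover have "closed (K A) \<and> closed (K B) \<and> braid_closure w \<subseteq> K A \<union> K B \<and>
      K A \<inter> K B \<inter> braid_closure w = {} \<and> K A \<inter> braid_closure w \<noteq> {} \<and> K B \<inter> braid_closure w \<noteq> {}"
    unfolding un using closed_K[OF A(1)] closed_K[OF B(1)] disjoint ne by simp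
  ultimately show False unfolding connected_closed by (elim notE) (intro exI)
qed

section \<open>The arcs of a closed braid diagram\<close>

lemma next_pos_crossing:
  "next_pos x (over_in x) = over_out x" "next_pos x (under_in x) = under_out x"
  "p \<noteq> over_in x \<Longrightarrow> p \<noteq> over_out x \<Longrightarrow> next_pos x p = p"
  by (cases "snd x"; auto simp: next_pos_def over_in_def over_out_def)+

lemma crossing_positions: "over_in x \<in> {1, 2, 3}" "over_out x \<in> {1, 2, 3}" "over_in x \<noteq> over_out x"
  using gen_index_cases[of "fst x"] by (auto simp: over_in_def over_out_def)

lemma overpass_iff:
  "(e, f) \<in> overpass w \<longleftrightarrow> e \<in> edges w \<and> snd e \<noteq> under_in (w ! fst e) \<and> f = next_edge w e"
proof -
  obtain j p where e: "e = (j, p)" by (cases e)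
  define P :: "nat set" where "P = {1, 2, 3}"
  have P: "over_in (w ! j) \<in> P" "over_in (w ! j) \<noteq> over_out (w ! j)"
    using crossing_positions[of "w ! j"] unfolding P_def by blast+
  have nxt: "next_pos (w ! j) (over_in (w ! j)) = over_out (w ! j)"
    "p \<noteq> over_in (w ! j) \<Longrightarrow> p \<noteq> over_out (w ! j) \<Longrightarrow> next_pos (w ! j) p = p"
    by (rule next_pos_crossing)+
  show ?thesis
    unfolding overpass_def edges_def next_edge_def P_def[symmetric] e
    using P nxt by auto
qed

definition arc_start :: "word \<Rightarrow> nat \<Rightarrow> nat \<times> nat" where
  "arc_start w a = next_edge w (a, under_in (w ! a))"

lemma diagram_arc_eq: "diagram_arc w a = (overpass w)\<^sup>* `` {arc_start w a}"
  by (simp add: diagram_arc_def arc_start_def next_edge_def next_pos_crossing)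

lemma under_in_edge: "a < length w \<Longrightarrow> (a, under_in (w ! a)) \<in> edges w"
  using crossing_positions(2)[of "w ! a"] by (simp add: edges_def)

lemma over_in_edge: "a < length w \<Longrightarrow> (a, over_in (w ! a)) \<in> edges w"
  using crossing_positions(1)[of "w ! a"] by (simp add: edges_def)

lemma arc_start_edge: "a < length w \<Longrightarrow> arc_start w a \<in> edges w"
  unfolding arc_start_def by (intro next_edge_in_edges under_in_edge)

lemma arc_start_not_continued:
  assumes "a < length w"
  shows "(e, arc_start w a) \<notin> overpass w"
proof
  assume "(e, arc_start w a) \<in> overpass w"
  then have e: "e \<in> edges w" "snd e \<noteq> under_in (w ! fst e)" "next_edge w (a, under_in (w ! a)) = next_edge w e"
    by (auto simp: overpass_iff arc_start_def)
  then have "e = (a, under_in (w ! a))"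
    using inj_onD[OF inj_on_next_edge e(3)] under_in_edge[OF assms] by simp
  with e(2) show False by simp
qed

text \<open>Continuation is injective, and the first edge of an arc is not the continuation of an overpassing
  edge; so the way back from e to the start of its arc is unique.\<close>

lemma diagram_arc_unique:
  assumes "e \<in> diagram_arc w a" "e \<in> diagram_arc w b" "a < length w" "b < length w"
  shows "a = b"
proof -
  have "(arc_start w a, e) \<in> (overpass w)\<^sup>*" "(arc_start w b, e) \<in> (overpass w)\<^sup>*"
    using assms(1,2) by (auto simp: diagram_arc_eq)
  then show ?thesis
  proof (induction rule: rtrancl_induct)
    case base
    then have "arc_start w a = arc_start w b"
      using arc_start_not_continued[OF assms(3)] by (cases rule: rtranclE) auto
    then show ?case
      using inj_onD[OF inj_on_next_edge, of w "(a, under_in (w ! a))" "(b, under_in (w ! b))"]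
        under_in_edge assms(3,4) by (simp add: arc_start_def)
  next
    case (step y z)
    from step.prems show ?case
    proof (cases rule: rtranclE)
      case base
      then show ?thesis using step.hyps(2) arc_start_not_continued[OF assms(4)] by blast
    next
      case (step y')
      then have "y' \<in> edges w" "y \<in> edges w" "next_edge w y' = next_edge w y"
        using \<open>(y, z) \<in> overpass w\<close> unfolding overpass_iff by blast+
      then have "y' = y" using inj_onD[OF inj_on_next_edge] by blast
      then show ?thesis using step(1) \<open>(arc_start w b, y) \<in> (overpass w)\<^sup>* \<Longrightarrow> a = b\<close> by blast
    qed
  qed
qed

text \<open>The edges on arcs are closed under continuation: an edge either continues in its arc or dives at a
  crossing, where a new arc starts.\<close>

lemma diagram_arc_exists:
  assumes knot: "is_knot (braid_closure w)" and e: "e \<in> edges w"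
  shows "\<exists>a<length w. e \<in> diagram_arc w a"
proof -
  define A where "A = {e \<in> edges w. \<exists>a<length w. e \<in> diagram_arc w a}"
  have "0 < length w" using e by (auto simp: edges_def)
  then have "arc_start w 0 \<in> A" using arc_start_edge by (auto simp: A_def diagram_arc_eq)
  then have "A \<noteq> {}" by blast
  have sub: "A \<subseteq> edges w" by (auto simp: A_def)
  have step: "next_edge w f \<in> A" if f: "f \<in> A" for f
  proof (cases "snd f = under_in (w ! fst f)")
    case True
    have "fst f < length w" using f by (auto simp: A_def edges_def)
    moreover have "next_edge w f = arc_start w (fst f)"
      unfolding arc_start_def True[symmetric] by simp
    ultimately show ?thesis using arc_start_edge by (auto simp: A_def diagram_arc_eq)
  next
    case False
    then have "(f, next_edge w f) \<in> overpass w" using f by (simp add: A_def overpass_iff)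
    moreover obtain a where "a < length w" "f \<in> diagram_arc w a" using f by (auto simp: A_def)
    ultimately have "next_edge w f \<in> diagram_arc w a"
      by (auto simp: diagram_arc_eq intro: rtrancl_into_rtrancl)
    then show ?thesis using f \<open>a < length w\<close> next_edge_in_edges by (auto simp: A_def)
  qed
  have "A = edges w" by (rule knot_single_cycle[OF knot sub \<open>A \<noteq> {}\<close> step])
  then show ?thesis using e unfolding A_def by blast
qed

section \<open>Colourings of a closed braid diagram\<close>

text \<open>How the colours at the three positions change at a crossing: the overstrand keeps its colour, and the
  colours of the two underarcs have twice the colour of the overarc as their sum.\<close>

definition colour_step :: "letter \<Rightarrow> (nat \<Rightarrow> int) \<Rightarrow> nat \<Rightarrow> int" where
  "colour_step x c q = (if q = over_out x then c (over_in x)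
     else if q = under_out x then 2 * c (over_in x) - c (under_in x) else c q)"

fun mat2_apply :: "mat2 \<Rightarrow> int \<times> int \<Rightarrow> int \<times> int" where
  "mat2_apply (p, q, r, s) (a, b) = (p * a + q * b, r * a + s * b)"

lemma mat2_apply_mult: "mat2_apply (mat2_mult M N) v = mat2_apply M (mat2_apply N v)"
  by (cases M; cases N; cases v) (simp add: algebra_simps)

definition differences :: "(nat \<Rightarrow> int) \<Rightarrow> int \<times> int" where
  "differences c = (c 1 - c 2, c 2 - c 3)"

lemma differences_colour_step: "differences (colour_step x c) = mat2_apply (burau_letter x) (differences c)"
  by (cases x rule: burau_letter.cases)
    (auto simp: differences_def colour_step_def over_in_def over_out_def eval_nat_numeral)

text \<open>Together with the differences, the alternating sum determines the three colours.\<close>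

lemma alternating_sum_colour_step:
  "colour_step x c 1 - colour_step x c 2 + colour_step x c 3 = c 1 - c 2 + c 3"
  by (cases x rule: burau_letter.cases) (auto simp: colour_step_def over_in_def over_out_def eval_nat_numeral)

lemma differences_fold: "differences (fold colour_step w c) = mat2_apply (burau w) (differences c)"
  by (induction w arbitrary: c)
    (simp_all add: differences_colour_step mat2_apply_mult, simp add: differences_def)

lemma alternating_sum_fold:
  "fold colour_step w c 1 - fold colour_step w c 2 + fold colour_step w c 3 = c 1 - c 2 + c 3"
  by (induction w arbitrary: c) (simp_all only: fold_simps alternating_sum_colour_step)

text \<open>Modulo m the word fixes the differences of the colours; the invariant alternating sum excludes a
  simultaneous shift of all three colours.\<close>

lemma colours_close_up:
  fixes m :: int
  assumes "mat2_apply (burau w) (differences c) = (x, y)" "differences c = (x', y')"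
    and "m dvd x - x'" "m dvd y - y'" "q \<in> {1, 2, 3}"
  shows "m dvd fold colour_step w c q - c q"
proof -
  let ?c = "fold colour_step w c"
  have d: "?c 1 - ?c 2 = x" "?c 2 - ?c 3 = y" "c 1 - c 2 = x'" "c 2 - c 3 = y'"
    using differences_fold[of w c] assms(1,2) by (simp_all add: differences_def)
  have alt: "?c 1 - ?c 2 + ?c 3 = c 1 - c 2 + c 3" by (rule alternating_sum_fold)
  have "?c 3 - c 3 = - (x - x')" "?c 2 - c 2 = (y - y') - (x - x')" "?c 1 - c 1 = y - y'"
    using d alt by linarith+
  moreover have "m dvd - (x - x')" "m dvd (y - y') - (x - x')"
    using assms(3,4) by (simp_all only: dvd_minus_iff dvd_diff)
  ultimately have "m dvd ?c 1 - c 1" "m dvd ?c 2 - c 2" "m dvd ?c 3 - c 3"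
    using assms(4) by (simp_all only:)
  then show ?thesis using assms(5) by blast
qed

text \<open>A matrix M of determinant 1 satisfies \<open>det (M - 1) = 2 - tr M\<close>, so that M - 1 is singular modulo m. A
  column of its adjugate that does not vanish modulo m is a fixed vector, and if both columns vanish
  then every vector is fixed.\<close>

lemma fixed_vector_mod:
  fixes M :: mat2 and m :: int
  assumes "det2 M = 1" "m dvd 2 - trace2 M" "\<not> is_unit m"
  obtains a b x y where "mat2_apply M (a, b) = (x, y)" "m dvd x - a" "m dvd y - b" "\<not> (m dvd a \<and> m dvd b)"
proof -
  obtain p q r s where M: "M = (p, q, r, s)" by (cases M)
  have det: "(p - 1) * (s - 1) - q * r = 2 - trace2 M"
    using assms(1) by (simp add: M algebra_simps)
  consider "\<not> (m dvd s - 1 \<and> m dvd r)" | "\<not> (m dvd q \<and> m dvd p - 1)"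
    | "m dvd p - 1" "m dvd r" by blast
  then show thesis
  proof cases
    case 1
    have "p * (s - 1) + q * (- r) - (s - 1) = 2 - trace2 M" "r * (s - 1) + s * (- r) - (- r) = 0"
      using det by (simp_all add: algebra_simps)
    then show thesis
      using that[of "s - 1" "- r" "p * (s - 1) + q * (- r)" "r * (s - 1) + s * (- r)"] 1 assms(2)
      by (simp only: M mat2_apply.simps dvd_minus_iff) simp
  next
    case 2
    have "p * (- q) + q * (p - 1) - (- q) = 0" "r * (- q) + s * (p - 1) - (p - 1) = 2 - trace2 M"
      using det by (simp_all add: algebra_simps)
    then show thesis
      using that[of "- q" "p - 1" "p * (- q) + q * (p - 1)" "r * (- q) + s * (p - 1)"] 2 assms(2)
      by (simp only: M mat2_apply.simps dvd_minus_iff) simp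
  next
    case 3
    then show thesis using that[of 1 0 p r] assms(3) by (simp add: M)
  qed
qed

text \<open>Multiply the system by the adjugate matrix.\<close>

lemma det_kernel_mod:
  fixes A :: "int mat" and m :: int
  assumes A: "A \<in> carrier_mat k k" and v: "v \<in> carrier_vec k"
    and dvd: "\<And>i. i < k \<Longrightarrow> m dvd vec_index (A *\<^sub>v v) i" and j: "j < k"
  shows "m dvd Determinant.det A * vec_index v j"
proof -
  have adj: "adj_mat A \<in> carrier_mat k k" "adj_mat A * A = Determinant.det A \<cdot>\<^sub>m 1\<^sub>m k"
    using adj_mat[OF A] by auto
  have Av: "A *\<^sub>v v \<in> carrier_vec k" using A v by simp
  have expand: "vec_index (B *\<^sub>v y) j = (\<Sum>i<k. B $$ (j, i) * vec_index y i)"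
    if "B \<in> carrier_mat k k" "y \<in> carrier_vec k" for B :: "int mat" and y
    using that j by (simp add: scalar_prod_def lessThan_atLeast0)
  have "adj_mat A *\<^sub>v (A *\<^sub>v v) = (adj_mat A * A) *\<^sub>v v"
    using assoc_mult_mat_vec[OF adj(1) A v] by simp
  also have "\<dots> = Determinant.det A \<cdot>\<^sub>v v"
    unfolding adj(2) using v by auto
  finally have "Determinant.det A * vec_index v j = vec_index (adj_mat A *\<^sub>v (A *\<^sub>v v)) j"
    using j v by simp
  also have "\<dots> = (\<Sum>i<k. adj_mat A $$ (j, i) * vec_index (A *\<^sub>v v) i)"
    by (rule expand[OF adj(1) Av])
  finally show ?thesis by (simp only:) (intro dvd_sum dvd_mult dvd, simp)
qed

text \<open>The colours of the edges that result from the colours c of the edges at the cut.\<close>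

definition level_colour :: "word \<Rightarrow> (nat \<Rightarrow> int) \<Rightarrow> nat \<times> nat \<Rightarrow> int" where
  "level_colour w c e = fold colour_step (take (fst e) w) c (snd e)"

text \<open>Colours are carried from level to level by construction; only at the cut, where the last level
  meets the first one, is there something to close up, and there the colours agree modulo m.\<close>

lemma level_colour_next_edge:
  assumes close: "\<And>q. q \<in> {1, 2, 3} \<Longrightarrow> m dvd fold colour_step w c q - c q"
    and e: "e \<in> edges w"
  shows "m dvd colour_step (w ! fst e) (\<lambda>q. level_colour w c (fst e, q)) (next_pos (w ! fst e) (snd e))
    - level_colour w c (next_edge w e)"
proof -
  obtain j p where jp: "e = (j, p)" by (cases e)
  have j: "j < length w" and p: "p \<in> {1, 2, 3}" using e by (auto simp: jp edges_def)
  have step: "fold colour_step (take (Suc j) w) c = colour_step (w ! j) (\<lambda>q. level_colour w c (j, q))"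
    using j by (simp add: take_Suc_conv_app_nth level_colour_def)
  show ?thesis
  proof (cases "Suc j = length w")
    case True
    then have "next_level w j = 0" "take (Suc j) w = w" by (simp_all add: next_level_def)
    then show ?thesis
      using close[OF next_pos_range[OF p], of "w ! j"] step
      by (simp add: jp next_edge_def level_colour_def[of w c "(0, _)"])
  next
    case False
    then have "next_level w j = Suc j" using j by (simp add: next_level_def)
    then show ?thesis
      using step by (simp add: jp next_edge_def level_colour_def[of w c "(Suc j, _)"])
  qed
qed

lemma colour_step_next_pos:
  "q \<noteq> under_in x \<Longrightarrow> colour_step x c (next_pos x q) = c q"
  "colour_step x c (next_pos x (under_in x)) = 2 * c (over_in x) - c (under_in x)"
proof -
  show "colour_step x c (next_pos x q) = c q" if "q \<noteq> under_in x"
    using that next_pos_crossing(1)[of x] next_pos_crossing(3)[of q x]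
    by (cases "q = over_in x") (simp_all add: colour_step_def)
  show "colour_step x c (next_pos x (under_in x)) = 2 * c (over_in x) - c (under_in x)"
    unfolding next_pos_crossing(2) colour_step_def using crossing_positions(3)[of x] by simp
qed

text \<open>Suppose that a prime m divides 2 - trace. The colours that start from a vector fixed modulo m close
  up and satisfy the colouring equations modulo m. After subtraction of the colour of the first arc
  they form a kernel vector modulo m of the first minor. As its determinant is a unit, all arcs have
  the same colour modulo m, whereas the initial colours differ.\<close>

theorem trace_of_determinant_one:
  assumes knot: "is_knot (braid_closure w)" and w: "w \<noteq> []" and one: "closure_determinant w = 1"
  shows "trace2 (burau w) \<in> {1, 3}"
proof (rule ccontr)
  let ?n = "length w"
  let ?k = "2 - trace2 (burau w)"
  assume "trace2 (burau w) \<notin> {1, 3}"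
  then have "?k \<noteq> 1" "?k \<noteq> - 1" by auto
  then have not_unit: "\<not> is_unit ?k" by simp
  obtain m :: int where m: "prime m" "m dvd ?k"
  proof (cases "?k = 0")
    case True
    obtain m :: int where "prime m" "m dvd 2" using prime_divisor_exists[of "2 :: int"] by auto
    then show ?thesis using that True by simp
  next
    case False
    then show ?thesis using that prime_divisor_exists[of ?k] not_unit by blast
  qed
  obtain a b x y where fixed: "mat2_apply (burau w) (a, b) = (x, y)" "m dvd x - a" "m dvd y - b"
    and nontrivial: "\<not> (m dvd a \<and> m dvd b)"
    using fixed_vector_mod[OF det2_burau m(2)] m(1) not_prime_unit by metis
  (* Initial colours whose consecutive differences form the fixed vector. *)
  define c where "c = (\<lambda>q :: nat. if q = 1 then a + b else if q = 2 then b else 0)"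
  have dc: "differences c = (a, b)" by (simp add: differences_def c_def)
  have close: "m dvd fold colour_step w c q - c q" if "q \<in> {1, 2, 3}" for q
    using colours_close_up[OF _ dc fixed(2,3) that] fixed(1) dc by simp
  define C where "C = level_colour w c"
  have C_eq: "(\<lambda>q. level_colour w c (j, q)) = (\<lambda>q. C (j, q))" for j by (simp add: C_def)
  have cross: "m dvd 2 * C (j, over_in (w ! j)) - C (j, under_in (w ! j)) - C (arc_start w j)"
    if "j < ?n" for j
    using level_colour_next_edge[OF close under_in_edge[OF that]]
    by (simp add: colour_step_next_pos C_def arc_start_def)
  have along: "m dvd C e - C f" if "(e, f) \<in> overpass w" for e f
  proof -
    have e: "e \<in> edges w" "snd e \<noteq> under_in (w ! fst e)" "f = next_edge w e"
      using that by (simp_all add: overpass_iff)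
    show ?thesis
      using level_colour_next_edge[OF close e(1)] e(3)
      by (simp add: colour_step_next_pos(1)[OF e(2)] C_def)
  qed
  have arc: "m dvd C (arc_start w i) - C e" if "e \<in> diagram_arc w i" for e i
  proof -
    have "(arc_start w i, e) \<in> (overpass w)\<^sup>*" using that by (simp add: diagram_arc_eq)
    then show ?thesis
    proof (induction rule: rtrancl_induct)
      case base
      show ?case by simp
    next
      case (step f g)
      show ?case using dvd_add[OF step.IH along[OF step.hyps(2)]] by simp
    qed
  qed
  (* Subtracting a constant colouring makes the entry of arc 0 vanish, so that deleting its column
     loses nothing. *)
  define v where "v i = C (arc_start w i) - C (arc_start w 0)" for i
  have pick: "\<exists>i<?n. (\<Sum>j<?n. of_bool (e \<in> diagram_arc w j) * v j) = v i \<and> e \<in> diagram_arc w i"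
    if e: "e \<in> edges w" for e
  proof -
    from diagram_arc_exists[OF knot e] obtain i where i: "i < ?n" "e \<in> diagram_arc w i" by (elim exE conjE)
    have single: "of_bool (e \<in> diagram_arc w j) * v j = (if j = i then v i else 0)" if j: "j < ?n" for j
    proof (cases "j = i")
      case True
      then show ?thesis using i(2) by simp
    next
      case False
      then have "e \<notin> diagram_arc w j" using diagram_arc_unique[OF _ i(2) j i(1)] by blast
      then show ?thesis using False by simp
    qed
    have "(\<Sum>j<?n. of_bool (e \<in> diagram_arc w j) * v j) = (\<Sum>j<?n. if j = i then v i else 0)"
      by (rule sum.cong[OF refl], rule single) simp
    also have "\<dots> = v i" using i(1) by simp
    finally show ?thesis using i by (intro exI[of _ i] conjI)
  qed
  let ?M = "colouring_matrix w"
  have entry: "?M $$ (i, j) = 2 * of_bool ((i, over_in (w ! i)) \<in> diagram_arc w j)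
       - of_bool ((i, under_in (w ! i)) \<in> diagram_arc w j) - of_bool (arc_start w i \<in> diagram_arc w j)"
    if "i < ?n" "j < ?n" for i j
    using that by (simp add: colouring_matrix_def arc_start_def next_edge_def next_pos_crossing)
  have row: "m dvd (\<Sum>j<?n. ?M $$ (i, j) * v j)" if i: "i < ?n" for i
  proof -
    have "(\<Sum>j<?n. ?M $$ (i, j) * v j) = 2 * (\<Sum>j<?n. of_bool ((i, over_in (w ! i)) \<in> diagram_arc w j) * v j)
       - (\<Sum>j<?n. of_bool ((i, under_in (w ! i)) \<in> diagram_arc w j) * v j)
       - (\<Sum>j<?n. of_bool (arc_start w i \<in> diagram_arc w j) * v j)"
      unfolding sum_distrib_left sum_subtractf[symmetric]
      by (intro sum.cong) (simp_all add: entry[OF i] algebra_simps)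
    moreover obtain p where p: "(\<Sum>j<?n. of_bool ((i, over_in (w ! i)) \<in> diagram_arc w j) * v j) = v p"
      "(i, over_in (w ! i)) \<in> diagram_arc w p" using pick[OF over_in_edge[OF i]] by blast
    moreover obtain q where q: "(\<Sum>j<?n. of_bool ((i, under_in (w ! i)) \<in> diagram_arc w j) * v j) = v q"
      "(i, under_in (w ! i)) \<in> diagram_arc w q" using pick[OF under_in_edge[OF i]] by blast
    moreover obtain r where r: "(\<Sum>j<?n. of_bool (arc_start w i \<in> diagram_arc w j) * v j) = v r"
      "arc_start w i \<in> diagram_arc w r" using pick[OF arc_start_edge[OF i]] by blast
    ultimately have "(\<Sum>j<?n. ?M $$ (i, j) * v j) =
        2 * C (arc_start w p) - C (arc_start w q) - C (arc_start w r)"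
      by (simp add: v_def)
    also have "\<dots> = 2 * (C (arc_start w p) - C (i, over_in (w ! i)))
        - (C (arc_start w q) - C (i, under_in (w ! i))) - (C (arc_start w r) - C (arc_start w i))
        + (2 * C (i, over_in (w ! i)) - C (i, under_in (w ! i)) - C (arc_start w i))"
      by simp
    also have "m dvd \<dots>"
      by (rule dvd_add[OF dvd_diff[OF dvd_diff[OF dvd_mult[OF arc[OF p(2)]] arc[OF q(2)]] arc[OF r(2)]] cross[OF i]])
    finally show ?thesis .
  qed
  define A where "A = mat_delete ?M 0 0"
  define u where "u = vec (?n - 1) (\<lambda>j. v (Suc j))"
  have M: "dim_row ?M = ?n" "dim_col ?M = ?n" by (simp_all add: colouring_matrix_def)
  have A: "A \<in> carrier_mat (?n - 1) (?n - 1)" by (simp add: A_def M mat_delete_def)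
  have "m dvd vec_index (A *\<^sub>v u) i" if i: "i < ?n - 1" for i
  proof -
    have "vec_index (A *\<^sub>v u) i = (\<Sum>j<?n - 1. ?M $$ (Suc i, Suc j) * v (Suc j))"
      using i A by (simp add: scalar_prod_def u_def lessThan_atLeast0 A_def mat_delete_def M)
    also have "\<dots> = (\<Sum>j<?n. ?M $$ (Suc i, j) * v j)"
    proof -
      obtain l where l: "?n = Suc l" using w by (cases w) auto
      show ?thesis unfolding l sum.lessThan_Suc_shift by (simp add: v_def)
    qed
    finally show ?thesis using row[of "Suc i"] i by simp
  qed
  moreover have "u \<in> carrier_vec (?n - 1)" by (simp add: u_def)
  ultimately have kernel: "m dvd Determinant.det A * v (Suc j)" if "j < ?n - 1" for j
    using det_kernel_mod[OF A, of u m j] that by (simp add: u_def)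
  have "\<bar>Determinant.det A\<bar> = 1" using one by (simp add: closure_determinant_def A_def)
  then have "Determinant.det A = 1 \<or> Determinant.det A = - 1" by linarith
  then have v_Suc: "m dvd v (Suc j)" if "j < ?n - 1" for j using kernel[OF that] by auto
  have v: "m dvd v i" if "i < ?n" for i
    using that v_Suc by (cases i) (auto simp: v_def)
  have same: "m dvd C e - C (arc_start w 0)" if e: "e \<in> edges w" for e
  proof -
    obtain i where i: "i < ?n" "e \<in> diagram_arc w i" using diagram_arc_exists[OF knot e] by blast
    have "C e - C (arc_start w 0) = v i - (C (arc_start w i) - C e)" by (simp add: v_def)
    then show ?thesis using dvd_diff[OF v[OF i(1)] arc[OF i(2)]] by (simp only:)
  qed
  have edge0: "(0, q) \<in> edges w" if "q \<in> {1, 2, 3}" for q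
    using w that by (auto simp: edges_def simp del: insert_iff One_nat_def)
  have C0: "C (0, q) = c q" for q by (simp add: C_def level_colour_def)
  have "m dvd c q - c r" if "q \<in> {1, 2, 3}" "r \<in> {1, 2, 3}" for q r
    using dvd_diff[OF same[OF edge0[OF that(1)]] same[OF edge0[OF that(2)]]] by (simp add: C0)
  from this[of 1 2] this[of 2 3] have "m dvd a" "m dvd b" by (simp_all add: c_def)
  with nontrivial show False by simp
qed

section \<open>The classification\<close>

theorem proposition2p2:
  fixes w :: word
  assumes "cyclic_almost_alternating w"
    and "is_knot (braid_closure w)"
    and "closure_determinant w = 1"
  shows "is_unknot (braid_closure w) \<and>
    (\<exists>v. cyclic_eq w v \<and>
      (form1 v \<or> form2 v \<or> form3 v \<or> form4 v \<or> form5 v \<or> form6 v))"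
proof -
  obtain V X where V: "set V \<subseteq> {letter_a, letter_b}" "letter_b \<in> set V"
    and X: "X = (\<sigma>\<^sub>1, True) # V"
    and w_X: "cyclic_eq w X \<or> cyclic_eq w (swap_word X) \<or> cyclic_eq w (inv_word X) \<or>
      cyclic_eq w (inv_word (swap_word X))"
    using almost_alternating_normal_form[OF assms(1)] .
  have "w \<noteq> []"
    using w_X by (auto simp: X cyclic_eq_def swap_word_def inv_word_def)
  then have trace: "trace2 (burau w) \<in> {1, 3}"
    by (rule trace_of_determinant_one[OF assms(2) _ assms(3)])
  moreover have "trace2 (burau w) = trace2 (burau X)"
    using w_X trace_cyclic_eq[of w] trace_burau_swap_word trace_burau_inv_word by metis
  ultimately have "trace2 (burau X) \<in> {1, 3}" by (simp only:)
  then have unknot_X: "unknot_word X"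
    unfolding X by (rule unknot_word_classified[OF V])
  have "unknot_word w"
    using w_X unknot_word_cyclic_eq[OF cyclic_eq_sym] unknot_X unknot_word_swap_word[OF unknot_X]
      unknot_word_inv_word[OF unknot_X] unknot_word_inv_word[OF unknot_word_swap_word[OF unknot_X]]
    by metis
  then have "is_unknot (braid_closure w)" by (rule unknot_word_closure)
  with almost_alternating_forms[OF assms(1) trace] show ?thesis by blast
qed

end
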